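(* Let $d\ge 2$ and let $f:\mathbb{R}^d\to\mathbb{R}$ be $M$-strongly self-concordant, $\mu$-strongly convex and $L$-smooth, with $\varkappa=L/\mu$. Consider the greedy or random SR1 or BFGS method (described in the context) started from $\boldsymbol{G}_0=L\boldsymbol{I}_d$ and a point $\boldsymbol{x}_0$ satisfying $M\lambda_0\le\frac{\ln\frac32}{4\varkappa}$. Then: (1) for the greedy BFGS/SR1 method, there is an integer $k_0=O\left((d+\varkappa)\ln(d\varkappa)\right)$ such that $$\lambda_{k_0+k}\le\left(1-\frac1d\right)^{k(k-1)/2}\cdot\left(\frac12\right)^k\cdot\left(1-\frac1{2\varkappa}\right)^{k_0}\cdot\lambda_0\qquad\text{for all }k\ge0;$$ (2) for the random BFGS/SR1 method and any $\delta\in(0,1)$, there is an integer $k_0=O\left((d+\varkappa)\ln(d\varkappa/\delta)\right)$ such that, with probability at least $1-\delta$ over the random directions, $$\lambda_{k_0+k}\le\left(1-\frac1{d+1}\right)^{k(k-1)/2}\cdot\left(\frac12\right)^k\cdot\left(1-\frac1{2\varkappa}\right)^{k_0}\cdot\lambda_0\qquad\text{for all }k\ge0.$$ The constants implied by $O(\cdot)$ are absolute.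
   Context: A twice differentiable $f:\mathbb{R}^d\to\mathbb{R}$ is $\mu$-strongly convex and $L$-smooth ($\mu,L>0$) if $\mu \boldsymbol{I}_d\preceq\nabla^2 f(\boldsymbol{x})\preceq L\boldsymbol{I}_d$ for all $\boldsymbol{x}$. Write $\|\boldsymbol{h}\|_{\boldsymbol{z}}=\sqrt{\boldsymbol{h}^\top\nabla^2 f(\boldsymbol{z})\boldsymbol{h}}$. $f$ is $M$-strongly self-concordant ($M>0$) if $\nabla^2 f(\boldsymbol{y})-\nabla^2 f(\boldsymbol{x})\preceq M\|\boldsymbol{y}-\boldsymbol{x}\|_{\boldsymbol{z}}\nabla^2 f(\boldsymbol{w})$ for all $\boldsymbol{x},\boldsymbol{y},\boldsymbol{z},\boldsymbol{w}\in\mathbb{R}^d$. Here $\preceq$ is the Loewner order. $\lambda_f(\boldsymbol{x})=\sqrt{\nabla f(\boldsymbol{x})^\top[\nabla^2 f(\boldsymbol{x})]^{-1}\nabla f(\boldsymbol{x})}$, $\lambda_k=\lambda_f(\boldsymbol{x}_k)$; $\boldsymbol{e}_1,\dots,\boldsymbol{e}_d$ are the standard basis vectors; $\mathrm{Unif}(\mathcal{S}^{d-1})$ is the uniform distribution on the unit sphere. For symmetric $\boldsymbol{G}\succeq\boldsymbol{A}\succ0$: $\mathrm{SR1}(\boldsymbol{G},\boldsymbol{A},\boldsymbol{u})=\boldsymbol{G}$ if $\boldsymbol{G}\boldsymbol{u}=\boldsymbol{A}\boldsymbol{u}$, otherwise $\boldsymbol{G}-\frac{(\boldsymbol{G}-\boldsymbol{A})\boldsymbol{u}\boldsymbol{u}^\top(\boldsymbol{G}-\boldsymbol{A})}{\boldsymbol{u}^\top(\boldsymbol{G}-\boldsymbol{A})\boldsymbol{u}}$;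 and, for $\boldsymbol{u}\neq\boldsymbol{0}$, $\mathrm{BFGS}(\boldsymbol{G},\boldsymbol{A},\boldsymbol{u})=\boldsymbol{G}-\frac{\boldsymbol{G}\boldsymbol{u}\boldsymbol{u}^\top\boldsymbol{G}}{\boldsymbol{u}^\top\boldsymbol{G}\boldsymbol{u}}+\frac{\boldsymbol{A}\boldsymbol{u}\boldsymbol{u}^\top\boldsymbol{A}}{\boldsymbol{u}^\top\boldsymbol{A}\boldsymbol{u}}$. Method: given $\boldsymbol{x}_0$, symmetric $\boldsymbol{G}_0\succeq\nabla^2 f(\boldsymbol{x}_0)$ and square $\boldsymbol{L}_0$ with $\boldsymbol{L}_0^\top\boldsymbol{L}_0=\boldsymbol{G}_0^{-1}$, for each $k\ge0$ set $\boldsymbol{x}_{k+1}=\boldsymbol{x}_k-\boldsymbol{G}_k^{-1}\nabla f(\boldsymbol{x}_k)$, $r_k=\|\boldsymbol{x}_{k+1}-\boldsymbol{x}_k\|_{\boldsymbol{x}_k}$, $\tilde{\boldsymbol{G}}_k=(1+Mr_k)\boldsymbol{G}_k$, $\tilde{\boldsymbol{L}}_k=\boldsymbol{L}_k/\sqrt{1+Mr_k}$, $\boldsymbol{A}_k=\nabla^2 f(\boldsymbol{x}_{k+1})$, and use one fixed rule among the following. - SR1: $\boldsymbol{G}_{k+1}=\mathrm{SR1}(\tilde{\boldsymbol{G}}_k,\boldsymbol{A}_k,\boldsymbol{u}_k)$ with $\boldsymbol{u}_k\in\arg\max_{\boldsymbol{u}\in\{\boldsymbol{e}_1,\dots,\boldsymbol{e}_d\}}\boldsymbol{u}^\top(\tilde{\boldsymbol{G}}_k-\boldsymbol{A}_k)\boldsymbol{u}$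 (greedy) or $\boldsymbol{u}_k\sim\mathrm{Unif}(\mathcal{S}^{d-1})$ independent of the past (random). - BFGS: $\boldsymbol{G}_{k+1}=\mathrm{BFGS}(\tilde{\boldsymbol{G}}_k,\boldsymbol{A}_k,\boldsymbol{u}_k)$ with $\boldsymbol{u}_k=\tilde{\boldsymbol{L}}_k^\top\tilde{\boldsymbol{u}}_k$, where $\tilde{\boldsymbol{u}}_k\in\arg\max_{\tilde{\boldsymbol{u}}\in\{\boldsymbol{e}_1,\dots,\boldsymbol{e}_d\}}\tilde{\boldsymbol{u}}^\top\tilde{\boldsymbol{L}}_k^{-\top}\boldsymbol{A}_k^{-1}\tilde{\boldsymbol{L}}_k^{-1}\tilde{\boldsymbol{u}}$ (greedy) or $\tilde{\boldsymbol{u}}_k\sim\mathrm{Unif}(\mathcal{S}^{d-1})$ independent of the past (random); and $\boldsymbol{L}_{k+1}=\tilde{\boldsymbol{L}}_k-\frac{[\tilde{\boldsymbol{L}}_k\boldsymbol{A}_k\boldsymbol{u}_k-\boldsymbol{v}_k]\boldsymbol{u}_k^\top}{\boldsymbol{u}_k^\top\boldsymbol{A}_k\boldsymbol{u}_k}$, $\boldsymbol{v}_k=\sqrt{\boldsymbol{u}_k^\top\boldsymbol{A}_k\boldsymbol{u}_k}\frac{\tilde{\boldsymbol{u}}_k}{\|\tilde{\boldsymbol{u}}_k\|}$, which satisfies $\boldsymbol{L}_{k+1}^\top\boldsymbol{L}_{k+1}=\boldsymbol{G}_{k+1}^{-1}$. Ties in the arg max are broken arbitrarily. *)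

theory Defs
  imports "HOL-Probability.Probability" "Jordan_Normal_Form.Gauss_Jordan_Elimination"
begin

hide_type (open) Finite_Cartesian_Product.vec
hide_const (open) Finite_Cartesian_Product.vec Finite_Cartesian_Product.mat
no_notation Finite_Cartesian_Product.vec_nth (infixl "$" 90)
no_notation Inner_Product.real_inner_class.inner (infix "\<bullet>" 70)

text \<open>
  The constants hidden in the complexity bounds are uniform in the dimension, so the dimension
  has to be a number and not a type: a point of Euclidean d-space is an element of
  \<^term>\<open>carrier_vec d\<close>. Since the type of these vectors is not a normed space, (Frechet)
  differentiability is spelled out; values outside the carrier play no role.
\<close>

definition vnorm :: "real vec \<Rightarrow> real" where
  "vnorm v = sqrt (v \<bullet> v)"

definition has_gradient :: "nat \<Rightarrow> (real vec \<Rightarrow> real) \<Rightarrow> real vec \<Rightarrow> real vec \<Rightarrow> bool" where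
  "has_gradient d f x g \<longleftrightarrow> g \<in> carrier_vec d \<and>
     (\<forall>\<epsilon>>0. \<exists>\<delta>>0. \<forall>h\<in>carrier_vec d. vnorm h < \<delta> \<longrightarrow>
        \<bar>f (x + h) - f x - g \<bullet> h\<bar> \<le> \<epsilon> * vnorm h)"

definition has_jacobian :: "nat \<Rightarrow> (real vec \<Rightarrow> real vec) \<Rightarrow> real vec \<Rightarrow> real mat \<Rightarrow> bool" where
  "has_jacobian d F x J \<longleftrightarrow> J \<in> carrier_mat d d \<and>
     (\<forall>\<epsilon>>0. \<exists>\<delta>>0. \<forall>h\<in>carrier_vec d. vnorm h < \<delta> \<longrightarrow>
        vnorm (F (x + h) - F x - J *\<^sub>v h) \<le> \<epsilon> * vnorm h)"

definition grad :: "nat \<Rightarrow> (real vec \<Rightarrow> real) \<Rightarrow> real vec \<Rightarrow> real vec" where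
  "grad d f x = (SOME g. has_gradient d f x g)"

definition hess :: "nat \<Rightarrow> (real vec \<Rightarrow> real) \<Rightarrow> real vec \<Rightarrow> real mat" where
  "hess d f x = (SOME H. has_jacobian d (grad d f) x H)"

definition twice_differentiable :: "nat \<Rightarrow> (real vec \<Rightarrow> real) \<Rightarrow> bool" where
  "twice_differentiable d f \<longleftrightarrow>
     (\<forall>x\<in>carrier_vec d. (\<exists>g. has_gradient d f x g) \<and> (\<exists>H. has_jacobian d (grad d f) x H))"

definition loewner_le :: "nat \<Rightarrow> real mat \<Rightarrow> real mat \<Rightarrow> bool" where
  "loewner_le d A B \<longleftrightarrow>
     A \<in> carrier_mat d d \<and> B \<in> carrier_mat d d \<and> transpose_mat A = A \<and> transpose_mat B = B \<and>
     (\<forall>h\<in>carrier_vec d. h \<bullet> (A *\<^sub>v h) \<le> h \<bullet> (B *\<^sub>v h))"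

definition strongly_convex :: "nat \<Rightarrow> real \<Rightarrow> (real vec \<Rightarrow> real) \<Rightarrow> bool" where
  "strongly_convex d \<mu> f \<longleftrightarrow> (\<forall>x\<in>carrier_vec d. loewner_le d (\<mu> \<cdot>\<^sub>m 1\<^sub>m d) (hess d f x))"

definition smooth :: "nat \<Rightarrow> real \<Rightarrow> (real vec \<Rightarrow> real) \<Rightarrow> bool" where
  "smooth d L f \<longleftrightarrow> (\<forall>x\<in>carrier_vec d. loewner_le d (hess d f x) (L \<cdot>\<^sub>m 1\<^sub>m d))"

definition local_norm :: "nat \<Rightarrow> (real vec \<Rightarrow> real) \<Rightarrow> real vec \<Rightarrow> real vec \<Rightarrow> real" where
  "local_norm d f z h = sqrt (h \<bullet> (hess d f z *\<^sub>v h))"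

definition strongly_self_concordant :: "nat \<Rightarrow> real \<Rightarrow> (real vec \<Rightarrow> real) \<Rightarrow> bool" where
  "strongly_self_concordant d M f \<longleftrightarrow>
     (\<forall>x\<in>carrier_vec d. \<forall>y\<in>carrier_vec d. \<forall>z\<in>carrier_vec d. \<forall>w\<in>carrier_vec d.
        loewner_le d (hess d f y - hess d f x) ((M * local_norm d f z (y - x)) \<cdot>\<^sub>m hess d f w))"

text \<open>\<^term>\<open>mat_inverse\<close> returns an option; \<open>minv\<close> is only meaningful for invertible matrices.\<close>

definition minv :: "real mat \<Rightarrow> real mat" where
  "minv A = the (mat_inverse A)"

definition newton_decrement :: "nat \<Rightarrow> (real vec \<Rightarrow> real) \<Rightarrow> real vec \<Rightarrow> real" where
  "newton_decrement d f x = sqrt (grad d f x \<bullet> (minv (hess d f x) *\<^sub>v grad d f x))"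

definition outer_prod :: "real vec \<Rightarrow> real vec \<Rightarrow> real mat" where
  "outer_prod u v = mat (dim_vec u) (dim_vec v) (\<lambda>(i, j). u $ i * v $ j)"

definition SR1_update :: "real mat \<Rightarrow> real mat \<Rightarrow> real vec \<Rightarrow> real mat" where
  "SR1_update G A u =
     (if G *\<^sub>v u = A *\<^sub>v u then G
      else G - (1 / (u \<bullet> ((G - A) *\<^sub>v u))) \<cdot>\<^sub>m ((G - A) * outer_prod u u * (G - A)))"

definition BFGS_update :: "real mat \<Rightarrow> real mat \<Rightarrow> real vec \<Rightarrow> real mat" where
  "BFGS_update G A u =
     G - (1 / (u \<bullet> (G *\<^sub>v u))) \<cdot>\<^sub>m (G * outer_prod u u * G)
       + (1 / (u \<bullet> (A *\<^sub>v u))) \<cdot>\<^sub>m (A * outer_prod u u * A)"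

text \<open>
  A run of a method consists of the iterates \<open>x\<close>, the Hessian estimates \<open>G\<close>, the factors \<open>F\<close>
  (with \<open>(F k)\<^sup>T F k = (G k)\<^sup>-\<^sup>1\<close>; the letter L is reserved for the smoothness constant)
  and the chosen directions \<open>s\<close>. For SR1, \<open>s k\<close> is the update direction itself and \<open>F\<close> is not
  used; for BFGS, \<open>s k\<close> is the direction before it is multiplied by the transposed scaled factor.
\<close>

datatype qn_rule = SR1 | BFGS

definition qn_scale :: "nat \<Rightarrow> (real vec \<Rightarrow> real) \<Rightarrow> real \<Rightarrow> (nat \<Rightarrow> real vec) \<Rightarrow> nat \<Rightarrow> real" where
  "qn_scale d f M x k = 1 + M * local_norm d f (x k) (x (Suc k) - x k)"

definition scaled_G ::
  "nat \<Rightarrow> (real vec \<Rightarrow> real) \<Rightarrow> real \<Rightarrow> (nat \<Rightarrow> real vec) \<Rightarrow> (nat \<Rightarrow> real mat) \<Rightarrow> nat \<Rightarrow> real mat" where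
  "scaled_G d f M x G k = qn_scale d f M x k \<cdot>\<^sub>m G k"

definition scaled_F ::
  "nat \<Rightarrow> (real vec \<Rightarrow> real) \<Rightarrow> real \<Rightarrow> (nat \<Rightarrow> real vec) \<Rightarrow> (nat \<Rightarrow> real mat) \<Rightarrow> nat \<Rightarrow> real mat" where
  "scaled_F d f M x F k = (1 / sqrt (qn_scale d f M x k)) \<cdot>\<^sub>m F k"

definition qn_update ::
  "qn_rule \<Rightarrow> nat \<Rightarrow> (real vec \<Rightarrow> real) \<Rightarrow> real \<Rightarrow> (nat \<Rightarrow> real vec) \<Rightarrow> (nat \<Rightarrow> real mat)
     \<Rightarrow> (nat \<Rightarrow> real mat) \<Rightarrow> (nat \<Rightarrow> real vec) \<Rightarrow> nat \<Rightarrow> bool" where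
  "qn_update rule d f M x G F s k \<longleftrightarrow>
     (let Gt = scaled_G d f M x G k; Ft = scaled_F d f M x F k; A = hess d f (x (Suc k)) in
      case rule of
        SR1 \<Rightarrow> G (Suc k) = SR1_update Gt A (s k)
      | BFGS \<Rightarrow>
          (let u = transpose_mat Ft *\<^sub>v s k;
               v = (sqrt (u \<bullet> (A *\<^sub>v u)) / vnorm (s k)) \<cdot>\<^sub>v s k
           in G (Suc k) = BFGS_update Gt A u \<and>
              F (Suc k) = Ft - (1 / (u \<bullet> (A *\<^sub>v u))) \<cdot>\<^sub>m outer_prod (Ft *\<^sub>v (A *\<^sub>v u) - v) u))"

definition qn_run ::
  "qn_rule \<Rightarrow> nat \<Rightarrow> (real vec \<Rightarrow> real) \<Rightarrow> real \<Rightarrow> real vec \<Rightarrow> real mat \<Rightarrow> real mat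
     \<Rightarrow> (nat \<Rightarrow> real vec) \<Rightarrow> (nat \<Rightarrow> real mat) \<Rightarrow> (nat \<Rightarrow> real mat) \<Rightarrow> (nat \<Rightarrow> real vec) \<Rightarrow> bool" where
  "qn_run rule d f M x0 G0 F0 x G F s \<longleftrightarrow>
     x 0 = x0 \<and> G 0 = G0 \<and> F 0 = F0 \<and>
     (\<forall>k. x (Suc k) = x k - minv (G k) *\<^sub>v grad d f (x k) \<and> qn_update rule d f M x G F s k)"

definition std_basis :: "nat \<Rightarrow> real vec set" where
  "std_basis d = unit_vec d ` {..<d}"

definition greedy_directions ::
  "qn_rule \<Rightarrow> nat \<Rightarrow> (real vec \<Rightarrow> real) \<Rightarrow> real \<Rightarrow> (nat \<Rightarrow> real vec) \<Rightarrow> (nat \<Rightarrow> real mat)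
     \<Rightarrow> (nat \<Rightarrow> real mat) \<Rightarrow> (nat \<Rightarrow> real vec) \<Rightarrow> bool" where
  "greedy_directions rule d f M x G F s \<longleftrightarrow>
     (\<forall>k. let Gt = scaled_G d f M x G k; Ft = scaled_F d f M x F k; A = hess d f (x (Suc k));
              Q = (case rule of
                     SR1 \<Rightarrow> Gt - A
                   | BFGS \<Rightarrow> transpose_mat (minv Ft) * minv A * minv Ft)
          in is_arg_max (\<lambda>v. v \<bullet> (Q *\<^sub>v v)) (\<lambda>v. v \<in> std_basis d) (s k))"

text \<open>
  The uniform distribution on the unit sphere, obtained by radial projection of the uniform
  distribution on the unit ball (the origin, where the projection is not defined, is a null set).
  The directions of a random method are independent of the past, hence i.i.d.; they are realised on
  the canonical product space. Keeping the sample space fixed also prevents the absolute constant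
  from depending on its type.
\<close>

definition unif_sphere :: "nat \<Rightarrow> (nat \<Rightarrow> real) measure" where
  "unif_sphere d =
     distr (uniform_measure (Pi\<^sub>M {..<d} (\<lambda>_. lborel))
              {y \<in> space (Pi\<^sub>M {..<d} (\<lambda>_. lborel)). (\<Sum>i<d. (y i)\<^sup>2) \<le> 1})
           (Pi\<^sub>M {..<d} (\<lambda>_. borel))
           (\<lambda>y. \<lambda>i\<in>{..<d}. y i / sqrt (\<Sum>j<d. (y j)\<^sup>2))"

definition direction_space :: "nat \<Rightarrow> (nat \<Rightarrow> nat \<Rightarrow> real) measure" where
  "direction_space d = Pi\<^sub>M UNIV (\<lambda>_. unif_sphere d)"

definition directions :: "nat \<Rightarrow> (nat \<Rightarrow> nat \<Rightarrow> real) \<Rightarrow> nat \<Rightarrow> real vec" where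
  "directions d \<omega> k = vec d (\<omega> k)"

end

theory Submission
  imports Defs "Jordan_Normal_Form.Determinant"
begin

text \<open>
  Let \<open>s = M * \<lambda>\<^sub>k\<close>. Evaluating \<open>w \<bullet> \<nabla>f\<close> along a step by the mean value theorem yields a Hessian \<open>J\<close> within a
  factor \<open>1 + s\<close> of the Hessian \<open>H\<close> at the iterate, and \<open>H \<le> G \<le> \<eta> H\<close> then gives
  \<open>\<lambda>\<^sub>k\<^sub>+\<^sub>1 \<le> (1 + s) max {s, 1 - 1 / (\<eta> (1 + s))} \<lambda>\<^sub>k\<close>. The updates preserve the two-sided bound with
  \<open>\<eta> \<le> 3/2 \<kappa>\<close>, whence linear convergence at rate \<open>1 - 1/(2\<kappa>)\<close>. For the superlinear phase the error of
  \<open>G\<close> is measured by \<open>\<theta> = tr (G - H) / \<mu>\<close> (SR1) or \<open>\<theta> = tr (H\<^sup>-\<^sup>1 G) - d\<close> (BFGS), which bounds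
  \<open>\<eta> - 1\<close>. An update with unit direction \<open>u\<close> decreases it by a quadratic form \<open>u \<bullet> Q u\<close> with
  \<open>tr Q = \<theta>\<close>, so a greedy choice of \<open>u\<close>, or a random one in expectation, contracts it by \<open>1 - 1/d\<close>.
  Hence \<open>\<rho> = \<theta> + 2 d \<kappa> s\<close> contracts by \<open>(1 - 1/d) exp (6 d \<kappa> s)\<close>, the exponents are summable, and
  \<open>\<lambda>\<^sub>k\<^sub>+\<^sub>1 \<le> \<rho>\<^sub>k \<lambda>\<^sub>k\<close>. In the random case, Markov's inequality and a union bound over all steps turn
  the bound on the expectation into one that holds with probability \<open>1 - \<delta>\<close>, at the price of
  replacing \<open>1 - 1/d\<close> by \<open>1 - 1/(d + 1)\<close>.
\<close>

section \<open>Positive semidefinite matrices\<close>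

text \<open>In the mean value step the vector w is fixed in advance; the intermediate Hessian
  depends on w, which is harmless because only its two-sided comparison with \<open>H\<close>
  enters. Each step rescales \<open>G\<close> and moves the Hessian, which adds to theta an error of
  order d \<kappa> s. The potential rho carries that error as a second summand: since lambda itself
  shrinks by the factor rho, the next summand is at most 2 d \<kappa> s rho, a multiple of rho, and
  no additive error survives. Accordingly k0 = k1 + j1: after k1 iterations of linear convergence
  the remaining exponents sum to at most ln 2, and j1 further ones bring rho from its a priori
  bound, polynomial in d and \<kappa>, below 1/2. In the random case no filtration is set up: the
  directions are coordinates of a product space, the state at time k is a function of the
  coordinates below k, and redrawing coordinate k preserves the product measure, so the conditional
  expectation is an inner integral over the sphere. The price is measurability of the whole
  recursion, including Hessians and inverses.\<close>

lemma scalar_prod_add_r: "dim_vec v = dim_vec w \<Longrightarrow> u \<bullet> (v + w) = u \<bullet> v + u \<bullet> (w :: real vec)"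
  by (simp add: scalar_prod_def algebra_simps sum.distrib)

lemma scalar_prod_add_l:
  "dim_vec u = dim_vec w \<Longrightarrow> dim_vec v = dim_vec w \<Longrightarrow> (u + v) \<bullet> w = u \<bullet> w + v \<bullet> (w :: real vec)"
  by (simp add: scalar_prod_def algebra_simps sum.distrib)

lemma scalar_prod_minus_r: "dim_vec v = dim_vec w \<Longrightarrow> u \<bullet> (v - w) = u \<bullet> v - u \<bullet> (w :: real vec)"
  by (simp add: scalar_prod_def algebra_simps sum_subtractf)

lemma scalar_prod_minus_l:
  "dim_vec u = dim_vec w \<Longrightarrow> dim_vec v = dim_vec w \<Longrightarrow> (u - v) \<bullet> w = u \<bullet> w - v \<bullet> (w :: real vec)"
  by (simp add: scalar_prod_def algebra_simps sum_subtractf)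

lemma scalar_prod_comm: "dim_vec u = dim_vec v \<Longrightarrow> u \<bullet> v = v \<bullet> (u :: real vec)"
  by (simp add: scalar_prod_def mult.commute)

lemma mult_mat_vec_add_r:
  "dim_vec v = dim_col A \<Longrightarrow> dim_vec w = dim_col A \<Longrightarrow> A *\<^sub>v (v + w) = A *\<^sub>v v + A *\<^sub>v (w :: real vec)"
  by (rule eq_vecI) (auto simp: scalar_prod_add_r)

lemma mult_mat_vec_minus_r:
  "dim_vec v = dim_col A \<Longrightarrow> dim_vec w = dim_col A \<Longrightarrow> A *\<^sub>v (v - w) = A *\<^sub>v v - A *\<^sub>v (w :: real vec)"
  by (rule eq_vecI) (auto simp: scalar_prod_minus_r)

lemma mult_mat_vec_smult_r:
  "dim_vec v = dim_col A \<Longrightarrow> A *\<^sub>v (c \<cdot>\<^sub>v v) = c \<cdot>\<^sub>v (A *\<^sub>v (v :: real vec))"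
  by (rule eq_vecI) auto

lemma mult_mat_vec_add_l:
  "dim_row A = dim_row B \<Longrightarrow> dim_col A = dim_col B \<Longrightarrow> dim_vec v = dim_col B \<Longrightarrow>
   (A + B) *\<^sub>v v = A *\<^sub>v v + B *\<^sub>v (v :: real vec)"
  by (rule eq_vecI) (auto simp: scalar_prod_def algebra_simps sum.distrib)

lemma mult_mat_vec_minus_l:
  "dim_row A = dim_row B \<Longrightarrow> dim_col A = dim_col B \<Longrightarrow> dim_vec v = dim_col B \<Longrightarrow>
   (A - B) *\<^sub>v v = A *\<^sub>v v - B *\<^sub>v (v :: real vec)"
  by (rule eq_vecI) (auto simp: scalar_prod_def algebra_simps sum_subtractf)

lemma mult_mat_vec_smult_l:
  "dim_vec v = dim_col A \<Longrightarrow> (c \<cdot>\<^sub>m A) *\<^sub>v v = c \<cdot>\<^sub>v (A *\<^sub>v (v :: real vec))"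
  by (rule eq_vecI) (auto simp: scalar_prod_def algebra_simps sum_distrib_left)

lemma mult_mat_vec_assoc:
  "dim_col A = dim_row B \<Longrightarrow> dim_col B = dim_vec v \<Longrightarrow> (A * B) *\<^sub>v v = A *\<^sub>v (B *\<^sub>v (v :: real vec))"
  by (rule assoc_mult_mat_vec[of _ "dim_row A" "dim_col A" _ "dim_col B"]) (auto intro!: carrier_vecI carrier_matI)

lemma outer_prod_mult_vec: "dim_vec v = dim_vec w \<Longrightarrow> outer_prod u v *\<^sub>v w = (v \<bullet> w) \<cdot>\<^sub>v u"
  by (rule eq_vecI) (auto simp: outer_prod_def scalar_prod_def algebra_simps sum_distrib_left)

lemma dim_outer_prod [simp]:
  "dim_row (outer_prod u v) = dim_vec u" "dim_col (outer_prod u v) = dim_vec v"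
  by (simp_all add: outer_prod_def)

lemma one_mult_vec: "dim_vec v = n \<Longrightarrow> 1\<^sub>m n *\<^sub>v v = (v :: real vec)"
  by (rule one_mult_mat_vec) (auto intro!: carrier_vecI)

text \<open>The side conditions are equations between dimensions rather than carrier memberships, so
  that the simplifier can discharge them while it expands quadratic forms.\<close>

lemmas mat_vec_simps =
  scalar_prod_add_r scalar_prod_add_l scalar_prod_minus_r scalar_prod_minus_l
  scalar_prod_smult_left scalar_prod_smult_right
  mult_mat_vec_add_r mult_mat_vec_minus_r mult_mat_vec_smult_r
  mult_mat_vec_add_l mult_mat_vec_minus_l mult_mat_vec_smult_l mult_mat_vec_assoc
  outer_prod_mult_vec one_mult_vec

definition psd :: "nat \<Rightarrow> real mat \<Rightarrow> bool" where
  "psd d A \<longleftrightarrow> A \<in> carrier_mat d d \<and> transpose_mat A = A \<and> (\<forall>h\<in>carrier_vec d. 0 \<le> h \<bullet> (A *\<^sub>v h))"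

definition pd :: "nat \<Rightarrow> real mat \<Rightarrow> bool" where
  "pd d A \<longleftrightarrow> A \<in> carrier_mat d d \<and> transpose_mat A = A \<and>
     (\<forall>h\<in>carrier_vec d. h \<noteq> 0\<^sub>v d \<longrightarrow> 0 < h \<bullet> (A *\<^sub>v h))"

definition tr :: "real mat \<Rightarrow> real" where
  "tr A = (\<Sum>i<dim_row A. A $$ (i, i))"

lemma pd_imp_psd: "pd d A \<Longrightarrow> psd d A"
  unfolding pd_def psd_def
proof (intro conjI ballI; (elim conjE)?)
  fix h :: "real vec" assume A: "A \<in> carrier_mat d d" "\<forall>h\<in>carrier_vec d. h \<noteq> 0\<^sub>v d \<longrightarrow> 0 < h \<bullet> (A *\<^sub>v h)"
    and h: "h \<in> carrier_vec d"
  have "0\<^sub>v d \<bullet> (A *\<^sub>v 0\<^sub>v d) = 0"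
    using A by (intro scalar_prod_left_zero[of _ d]) auto
  then show "0 \<le> h \<bullet> (A *\<^sub>v h)"
    using A(2) h by (cases "h = 0\<^sub>v d") (auto intro: less_imp_le)
qed

lemma psd_dims: "psd d A \<Longrightarrow> dim_row A = d \<and> dim_col A = d"
  by (auto simp: psd_def)

lemma psdD: "psd d A \<Longrightarrow> dim_vec h = d \<Longrightarrow> 0 \<le> h \<bullet> (A *\<^sub>v h)"
  unfolding psd_def using carrier_vecI[of h d] by blast

lemma sym_bilinear:
  assumes "A \<in> carrier_mat d d" "transpose_mat A = A" "dim_vec x = d" "dim_vec y = d"
  shows "x \<bullet> (A *\<^sub>v y) = y \<bullet> (A *\<^sub>v (x :: real vec))"
proof -
  have "(transpose_mat A *\<^sub>v x) \<bullet> y = x \<bullet> (A *\<^sub>v y)"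
    using assms by (intro transpose_vec_mult_scalar) (auto intro: carrier_vecI)
  then show ?thesis
    using assms by (simp add: scalar_prod_comm)
qed

lemma quadratic_expand:
  assumes "A \<in> carrier_mat d d" "transpose_mat A = A" "dim_vec x = d" "dim_vec y = d"
  shows "(x + c \<cdot>\<^sub>v y) \<bullet> (A *\<^sub>v (x + c \<cdot>\<^sub>v y))
    = x \<bullet> (A *\<^sub>v x) + 2 * c * (x \<bullet> (A *\<^sub>v y)) + c\<^sup>2 * (y \<bullet> (A *\<^sub>v (y :: real vec)))"
proof -
  have d: "dim_row A = d" "dim_col A = d" using assms(1) by auto
  have "(x + c \<cdot>\<^sub>v y) \<bullet> (A *\<^sub>v (x + c \<cdot>\<^sub>v y))
      = x \<bullet> (A *\<^sub>v x) + c * (x \<bullet> (A *\<^sub>v y)) + (c * (y \<bullet> (A *\<^sub>v x)) + c * (c * (y \<bullet> (A *\<^sub>v y))))"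
    using d assms(3,4) by (simp add: mat_vec_simps distrib_left)
  then show ?thesis
    unfolding sym_bilinear[OF assms(1,2,4,3)] by (simp add: power2_eq_square algebra_simps)
qed

lemma scalar_prod_self_nonneg: "0 \<le> v \<bullet> (v :: real vec)"
  by (simp add: scalar_prod_def sum_nonneg)

lemma scalar_prod_self_eq_0:
  fixes v :: "real vec"
  assumes d: "dim_vec v = d"
  shows "v \<bullet> v = 0 \<longleftrightarrow> v = 0\<^sub>v d"
proof
  assume "v \<bullet> v = 0"
  then show "v = 0\<^sub>v d" using d by (intro eq_vecI) (auto simp: scalar_prod_def sum_nonneg_eq_0_iff)
next
  assume "v = 0\<^sub>v d"
  then show "v \<bullet> v = 0" by simp
qed

lemma scalar_prod_self_pos: "dim_vec v = d \<Longrightarrow> v \<noteq> 0\<^sub>v d \<Longrightarrow> 0 < v \<bullet> v" for v :: "real vec"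
  using scalar_prod_self_nonneg[of v] scalar_prod_self_eq_0[of v d] by linarith

section \<open>Cauchy-Schwarz inequalities for semidefinite forms\<close>

text \<open>The form is nonnegative at x + t y for every t, so this quadratic polynomial in t has
  nonpositive discriminant. If its leading coefficient \<open>c\<close> vanishes, it is affine, and
  its slope must be zero.\<close>

lemma psd_Cauchy_Schwarz:
  assumes A: "psd d A" and d: "dim_vec x = d" "dim_vec y = d"
  shows "(x \<bullet> (A *\<^sub>v y))\<^sup>2 \<le> (x \<bullet> (A *\<^sub>v x)) * (y \<bullet> (A *\<^sub>v y))"
proof -
  define a b c where "a = x \<bullet> (A *\<^sub>v x)" and "b = x \<bullet> (A *\<^sub>v y)" and "c = y \<bullet> (A *\<^sub>v y)"
  have q: "0 \<le> a + 2 * t * b + t\<^sup>2 * c" for t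
  proof -
    have "0 \<le> (x + t \<cdot>\<^sub>v y) \<bullet> (A *\<^sub>v (x + t \<cdot>\<^sub>v y))"
      using A d unfolding psd_def by (auto intro!: carrier_vecI)
    then show ?thesis
      using A d unfolding psd_def a_def b_def c_def by (subst (asm) quadratic_expand) auto
  qed
  have c0: "0 \<le> c" using A d by (auto simp: psd_def c_def intro: carrier_vecI)
  show ?thesis
  proof (cases "c = 0")
    case True
    have "b = 0"
    proof (rule ccontr)
      assume "b \<noteq> 0"
      \<comment> \<open>This t makes the affine function a + 2 t b equal to -1.\<close>
      then show False using q[of "- (a + 1) / (2 * b)"] True by (simp add: field_simps)
    qed
    then show ?thesis using True unfolding b_def c_def by simp
  next
    case False
    have "0 \<le> c * (a + 2 * (- b / c) * b + (- b / c)\<^sup>2 * c)"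
      using q[of "- b / c"] c0 by simp
    also have "\<dots> = a * c - b\<^sup>2" using False by (simp add: field_simps power2_eq_square)
    finally show ?thesis unfolding a_def b_def c_def by simp
  qed
qed

text \<open>Cauchy-Schwarz between \<open>A x\<close> and x bounds the fourth power of the Euclidean
  norm of \<open>A x\<close> by a multiple of the form at x.\<close>

lemma psd_quadratic_0:
  assumes "psd d A" "dim_vec x = d" "x \<bullet> (A *\<^sub>v x) = 0"
  shows "A *\<^sub>v x = 0\<^sub>v d"
proof -
  have dA: "dim_row A = d" "dim_col A = d" using assms(1) psd_dims by auto
  have "((A *\<^sub>v x) \<bullet> (A *\<^sub>v x))\<^sup>2 \<le> 0"
    using psd_Cauchy_Schwarz[OF assms(1), of "A *\<^sub>v x" x] assms dA by simp
  then show ?thesis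
    using scalar_prod_self_eq_0[of "A *\<^sub>v x" d] dA by simp
qed

text \<open>Polarization: \<open>4 x\<^sup>T B y\<close> is the difference of the values of \<open>B\<close> at \<open>x + y\<close> and \<open>x - y\<close>.\<close>

lemma two_sided_Cauchy_Schwarz:
  assumes A: "psd d A" and B: "B \<in> carrier_mat d d" "transpose_mat B = B"
    and le: "\<And>h. h \<in> carrier_vec d \<Longrightarrow> \<bar>h \<bullet> (B *\<^sub>v h)\<bar> \<le> c * (h \<bullet> (A *\<^sub>v h))"
    and d: "dim_vec x = d" "dim_vec y = d" and c: "0 \<le> c"
  shows "\<bar>x \<bullet> (B *\<^sub>v y)\<bar> \<le> c * (sqrt (x \<bullet> (A *\<^sub>v x)) * sqrt (y \<bullet> (A *\<^sub>v y)))"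
proof -
  define a b where "a = x \<bullet> (A *\<^sub>v x)" and "b = y \<bullet> (A *\<^sub>v y)"
  define m where "m = x \<bullet> (B *\<^sub>v y)"
  have Am: "A \<in> carrier_mat d d" "transpose_mat A = A" using A by (auto simp: psd_def)
  have a0: "0 \<le> a" "0 \<le> b" using A d by (auto simp: psd_def a_def b_def intro: carrier_vecI)
  have key: "2 * \<bar>t * m\<bar> \<le> c * (a + t\<^sup>2 * b)" for t
  proof -
    have h: "\<bar>(x + s \<cdot>\<^sub>v y) \<bullet> (B *\<^sub>v (x + s \<cdot>\<^sub>v y))\<bar> \<le> c * ((x + s \<cdot>\<^sub>v y) \<bullet> (A *\<^sub>v (x + s \<cdot>\<^sub>v y)))" for s
      using d by (intro le carrier_vecI) auto
    note h1 = h[of t, unfolded quadratic_expand[OF Am d] quadratic_expand[OF B d]]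
    note h2 = h[of "-t", unfolded quadratic_expand[OF Am d] quadratic_expand[OF B d]]
    define n p q where "n = x \<bullet> (A *\<^sub>v y)" and "p = x \<bullet> (B *\<^sub>v x)" and "q = y \<bullet> (B *\<^sub>v y)"
    have "c * (2 * (a + t\<^sup>2 * b)) = c * (a + 2 * t * n + t\<^sup>2 * b) + c * (a + 2 * (-t) * n + (-t)\<^sup>2 * b)"
      by (simp add: algebra_simps)
    moreover have "4 * t * m = (p + 2 * t * m + t\<^sup>2 * q) - (p + 2 * (-t) * m + (-t)\<^sup>2 * q)" by simp
    ultimately have "\<bar>4 * t * m\<bar> \<le> c * (2 * (a + t\<^sup>2 * b))"
      using h1 h2 unfolding a_def b_def m_def n_def p_def q_def by linarith
    moreover have "\<bar>4 * t * m\<bar> = 2 * (2 * \<bar>t * m\<bar>)" by (simp add: abs_mult)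
    ultimately show ?thesis by linarith
  qed
  have sq: "m\<^sup>2 \<le> c\<^sup>2 * (a * b)"
  proof (cases "b = 0")
    case True
    have "m = 0"
    proof (rule ccontr)
      assume m: "m \<noteq> 0"
      \<comment> \<open>With \<open>b = 0\<close> the bound \<open>key\<close> does not grow with t,
        so a large t refutes it.\<close>
      obtain t where "t * m = c * a + 1" using m by (metis nonzero_eq_divide_eq)
      moreover have "0 \<le> c * a" using c a0 by simp
      ultimately show False using key[of t] True by (simp add: mult.commute[of a c])
    qed
    then show ?thesis using a0 True by simp
  next
    case False
    then have b: "b > 0" using a0 by simp
    show ?thesis
    proof (cases "c = 0")
      case True
      then show ?thesis using key[of 1] by simp
    next
      case False
      then have cp: "c > 0" using c by simp
      \<comment> \<open>This t minimises c (a + t^2 b) - 2 t |m|.\<close>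
      have "2 * \<bar>(\<bar>m\<bar> / (c * b)) * m\<bar> \<le> c * (a + (\<bar>m\<bar> / (c * b))\<^sup>2 * b)" by (rule key)
      then have "2 * (m\<^sup>2 / (c * b)) \<le> c * a + m\<^sup>2 / (c * b)"
        using cp b by (simp add: abs_mult power2_eq_square field_simps)
      then have "m\<^sup>2 / (c * b) \<le> c * a" by (simp only: mult_2 add_le_cancel_right)
      then show ?thesis using cp b by (simp add: field_simps power2_eq_square)
    qed
  qed
  have "\<bar>m\<bar> = sqrt (m\<^sup>2)" by simp
  also have "\<dots> \<le> sqrt (c\<^sup>2 * (a * b))" using sq by (rule real_sqrt_le_mono)
  also have "\<dots> = c * (sqrt a * sqrt b)" using c by (simp add: real_sqrt_mult)
  finally show ?thesis unfolding m_def a_def b_def .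
qed

subsection \<open>Inverses\<close>

text \<open>A kernel vector would have value zero under the form, so the determinant is nonzero and
  \<open>mat_inverse\<close> cannot return \<open>None\<close>.\<close>

lemma pd_minv:
  assumes "pd d A"
  shows "minv A \<in> carrier_mat d d \<and> A * minv A = 1\<^sub>m d \<and> minv A * A = 1\<^sub>m d"
proof -
  have A: "A \<in> carrier_mat d d" using assms by (simp add: pd_def)
  have "Determinant.det A \<noteq> 0"
  proof
    assume "Determinant.det A = 0"
    then obtain v where v: "v \<in> carrier_vec d" "v \<noteq> 0\<^sub>v d" "A *\<^sub>v v = 0\<^sub>v d"
      using det_0_iff_vec_prod_zero_field[OF A] by auto
    then have "v \<bullet> (A *\<^sub>v v) = 0" by simp
    with v assms show False by (auto simp: pd_def)
  qed
  then have "A \<in> Units (ring_mat TYPE(real) d undefined)" by (rule det_non_zero_imp_unit[OF A])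
  then obtain B where "mat_inverse A = Some B"
    using mat_inverse(1)[OF A, where b = undefined] by (cases "mat_inverse A") blast+
  with mat_inverse(2)[OF A this] show ?thesis by (simp add: minv_def)
qed

lemma pd_minv_dims: "pd d A \<Longrightarrow> dim_row (minv A) = d \<and> dim_col (minv A) = d"
  using pd_minv by auto

lemma pd_minv_cancel:
  assumes "pd d A" "dim_vec v = d"
  shows "A *\<^sub>v (minv A *\<^sub>v v) = v" "minv A *\<^sub>v (A *\<^sub>v v) = v"
  using pd_minv[OF assms(1)] pd_imp_psd[OF assms(1)] assms(2)
  by (metis assoc_mult_mat_vec carrier_vec_dim_vec one_mult_mat_vec psd_def)+

lemma inverse_unique:
  fixes A :: "real mat"
  assumes "A \<in> carrier_mat d d" "B \<in> carrier_mat d d" "C \<in> carrier_mat d d"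
    and "A * B = 1\<^sub>m d" "A * C = 1\<^sub>m d"
  shows "B = C"
proof -
  have "B * A = 1\<^sub>m d" using mat_mult_left_right_inverse[OF assms(1,2,4)] .
  then have "C = (B * A) * C" using assms(3) by simp
  also have "\<dots> = B * (A * C)" using assms by (simp add: assoc_mult_mat[of _ d d _ d _ d])
  finally show ?thesis using assms by simp
qed

lemma minv_eqI:
  assumes "A \<in> carrier_mat d d" "B \<in> carrier_mat d d" "A * B = 1\<^sub>m d"
  shows "minv A = B"
proof -
  have BA: "B * A = 1\<^sub>m d" using mat_mult_left_right_inverse[OF assms] .
  then have "A \<in> Units (ring_mat TYPE(real) d undefined)"
    using assms unfolding Units_def ring_mat_def by auto
  then obtain C where C: "mat_inverse A = Some C"
    using mat_inverse(1)[OF assms(1), where b = undefined] by (cases "mat_inverse A") blast+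
  with mat_inverse(2)[OF assms(1) C] have "C = B"
    using inverse_unique[OF assms(1) _ assms(2) _ assms(3)] by blast
  then show ?thesis using C by (simp add: minv_def)
qed

lemma pd_minv_pd:
  assumes "pd d A"
  shows "pd d (minv A)"
proof -
  note m = pd_minv[OF assms]
  have A: "A \<in> carrier_mat d d" "transpose_mat A = A" using assms by (auto simp: pd_def)
  have "A * transpose_mat (minv A) = transpose_mat (minv A * A)"
    using m A by (subst transpose_mult[of _ d d _ d]) auto
  also have "\<dots> = 1\<^sub>m d" using m by simp
  finally have sym: "transpose_mat (minv A) = minv A"
    using inverse_unique[OF A(1), of "transpose_mat (minv A)" "minv A"] m by simp
  have "0 < h \<bullet> (minv A *\<^sub>v h)" if h: "h \<in> carrier_vec d" "h \<noteq> 0\<^sub>v d" for h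
  proof -
    let ?y = "minv A *\<^sub>v h"
    have y: "?y \<in> carrier_vec d" using m h by auto
    have Ay: "A *\<^sub>v ?y = h" using pd_minv_cancel[OF assms] h by auto
    have "?y \<noteq> 0\<^sub>v d"
    proof
      assume "?y = 0\<^sub>v d"
      then have "h = A *\<^sub>v 0\<^sub>v d" using Ay by simp
      then show False using h A by auto
    qed
    then have "0 < ?y \<bullet> (A *\<^sub>v ?y)" using assms y by (auto simp: pd_def)
    moreover have "?y \<bullet> h = h \<bullet> ?y" using h m by (intro scalar_prod_comm) auto
    ultimately show ?thesis using Ay by simp
  qed
  then show ?thesis using m sym by (auto simp: pd_def)
qed

text \<open>Cauchy-Schwarz for the form \<open>A\<close> between x and \<open>minv A\<close> applied
  to y.\<close>

lemma pd_dual_Cauchy_Schwarz: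
  assumes A: "pd d A" and d: "dim_vec x = d" "dim_vec y = d"
  shows "(x \<bullet> y)\<^sup>2 \<le> (x \<bullet> (A *\<^sub>v x)) * (y \<bullet> (minv A *\<^sub>v y))"
proof -
  have m: "dim_vec (minv A *\<^sub>v y) = d" using pd_minv[OF A] by auto
  have "(x \<bullet> (A *\<^sub>v (minv A *\<^sub>v y)))\<^sup>2
      \<le> (x \<bullet> (A *\<^sub>v x)) * ((minv A *\<^sub>v y) \<bullet> (A *\<^sub>v (minv A *\<^sub>v y)))"
    by (rule psd_Cauchy_Schwarz[OF pd_imp_psd[OF A] d(1) m])
  then show ?thesis using m d by (simp add: pd_minv_cancel[OF A d(2)] scalar_prod_comm)
qed

text \<open>With y = B^-1 v, dual Cauchy-Schwarz for \<open>A\<close> gives (y . v)^2 <= (y^T A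
  y)(v^T A^-1 v) <= c (y^T B y)(v^T A^-1 v). As y^T B y = y . v, one factor y . v cancels; no matrix
  square root is involved.\<close>

lemma minv_antimono:
  assumes A: "pd d A" and B: "pd d B" and c: "0 < c"
    and le: "\<And>h. h \<in> carrier_vec d \<Longrightarrow> h \<bullet> (A *\<^sub>v h) \<le> c * (h \<bullet> (B *\<^sub>v h))"
    and v: "v \<in> carrier_vec d"
  shows "v \<bullet> (minv B *\<^sub>v v) \<le> c * (v \<bullet> (minv A *\<^sub>v v))"
proof -
  define y where "y = minv B *\<^sub>v v"
  have y: "y \<in> carrier_vec d" unfolding y_def using pd_minv[OF B] v by auto
  have By: "B *\<^sub>v y = v" unfolding y_def using pd_minv_cancel[OF B] v by auto
  have yv: "y \<bullet> (B *\<^sub>v y) = v \<bullet> y" using By y v by (simp add: scalar_prod_comm)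
  have p: "0 \<le> v \<bullet> y" using pd_imp_psd[OF B] y yv by (auto simp: psd_def)
  have q: "0 \<le> v \<bullet> (minv A *\<^sub>v v)" using pd_imp_psd[OF pd_minv_pd[OF A]] v by (auto simp: psd_def)
  have "(y \<bullet> v)\<^sup>2 \<le> (y \<bullet> (A *\<^sub>v y)) * (v \<bullet> (minv A *\<^sub>v v))"
    using pd_dual_Cauchy_Schwarz[OF A] y v by auto
  also have "\<dots> \<le> (c * (v \<bullet> y)) * (v \<bullet> (minv A *\<^sub>v v))"
    using le[OF y] yv q by (intro mult_right_mono) auto
  finally have "(v \<bullet> y) * (v \<bullet> y) \<le> (v \<bullet> y) * (c * (v \<bullet> (minv A *\<^sub>v v)))"
    using y v by (simp add: scalar_prod_comm power2_eq_square algebra_simps)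
  then show ?thesis
    using p q c unfolding y_def[symmetric]
    by (cases "v \<bullet> y = 0") (auto simp: mult_le_cancel_left)
qed

subsection \<open>Traces\<close>

lemma tr_add: "A \<in> carrier_mat d d \<Longrightarrow> B \<in> carrier_mat d d \<Longrightarrow> tr (A + B) = tr A + tr B"
  by (simp add: tr_def sum.distrib)

lemma tr_minus: "A \<in> carrier_mat d d \<Longrightarrow> B \<in> carrier_mat d d \<Longrightarrow> tr (A - B) = tr A - tr B"
  by (simp add: tr_def sum_subtractf)

lemma tr_smult: "A \<in> carrier_mat d d \<Longrightarrow> tr (c \<cdot>\<^sub>m A) = c * tr A"
  by (simp add: tr_def sum_distrib_left)

lemma tr_one: "tr (1\<^sub>m d) = real d"
  by (simp add: tr_def)

lemma tr_mult: "A \<in> carrier_mat d d \<Longrightarrow> B \<in> carrier_mat d d \<Longrightarrow>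
  tr (A * B) = (\<Sum>i<d. \<Sum>j<d. A $$ (i, j) * B $$ (j, i))"
  by (auto simp: tr_def scalar_prod_def atLeast0LessThan intro!: sum.cong)

lemma tr_mult_comm:
  assumes "A \<in> carrier_mat d d" "B \<in> carrier_mat d d"
  shows "tr (A * B) = tr (B * A)"
  unfolding tr_mult[OF assms] tr_mult[OF assms(2,1)]
  by (subst sum.swap) (simp add: mult.commute)

lemma tr_outer_prod: "dim_vec u = d \<Longrightarrow> dim_vec v = d \<Longrightarrow> tr (outer_prod u v) = u \<bullet> v"
  by (simp add: tr_def outer_prod_def scalar_prod_def atLeast0LessThan)

lemma unit_vec_quadratic:
  fixes A :: "real mat"
  assumes "A \<in> carrier_mat d d" "i < d" "j < d"
  shows "unit_vec d i \<bullet> (A *\<^sub>v unit_vec d j) = A $$ (i, j)"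
proof -
  have "A *\<^sub>v unit_vec d j = col A j"
    using assms by (intro eq_vecI) (auto simp: scalar_prod_right_unit)
  then show ?thesis using assms by (simp add: scalar_prod_left_unit)
qed

lemma psd_tr_nonneg: "psd d A \<Longrightarrow> 0 \<le> tr A"
  unfolding tr_def
proof (intro sum_nonneg)
  fix i assume A: "psd d A" and i: "i \<in> {..<dim_row A}"
  then have "A \<in> carrier_mat d d" "i < d" by (auto simp: psd_def)
  with A unit_vec_quadratic[of A d i i] show "0 \<le> A $$ (i, i)" unfolding psd_def by (metis unit_vec_carrier)
qed

lemma mat_eq_zeroI:
  fixes A :: "real mat"
  assumes "A \<in> carrier_mat d d" "\<And>j. j < d \<Longrightarrow> A *\<^sub>v unit_vec d j = 0\<^sub>v d"
  shows "A = 0\<^sub>m d d"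
proof (rule eq_matI)
  fix i j assume "i < dim_row (0\<^sub>m d d)" "j < dim_col (0\<^sub>m d d)"
  then have ij: "i < d" "j < d" by auto
  have "unit_vec d i \<bullet> (A *\<^sub>v unit_vec d j) = 0" using assms(2)[OF ij(2)] ij by simp
  then show "A $$ (i, j) = 0\<^sub>m d d $$ (i, j)"
    using unit_vec_quadratic[OF assms(1) ij] ij by simp
qed (use assms in auto)

lemma mat_eqI_vec:
  assumes "A \<in> carrier_mat d d" "B \<in> carrier_mat d d"
    "\<And>v. dim_vec v = d \<Longrightarrow> A *\<^sub>v v = B *\<^sub>v (v :: real vec)"
  shows "A = B"
proof (rule eq_matI)
  fix i j assume "i < dim_row B" "j < dim_col B"
  then have "i < d" "j < d" using assms by auto
  then show "A $$ (i, j) = B $$ (i, j)"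
    using assms(3)[of "unit_vec d j"] unit_vec_quadratic[OF assms(1), of i j]
      unit_vec_quadratic[OF assms(2), of i j] by simp
qed (use assms in auto)

section \<open>Rank one deflation and traces of products\<close>

text \<open>The Schur complement of \<open>R\<close> along u, which both SR1 and BFGS contain. If
  u^T R u = 0, division by zero makes the subtracted term vanish; for a semidefinite
  \<open>R\<close> this is the right value, because then \<open>R u = 0\<close>.\<close>

definition deflate :: "real mat \<Rightarrow> real vec \<Rightarrow> real mat" where
  "deflate R u = R - (1 / (u \<bullet> (R *\<^sub>v u))) \<cdot>\<^sub>m outer_prod (R *\<^sub>v u) (R *\<^sub>v u)"

lemma transpose_smult: "transpose_mat (c \<cdot>\<^sub>m A) = c \<cdot>\<^sub>m transpose_mat A"
  by (rule eq_matI) auto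

lemma transpose_outer_prod_self [simp]: "transpose_mat (outer_prod u u) = outer_prod u u"
  by (rule eq_matI) (auto simp: outer_prod_def)

lemma outer_prod_carrier [simp]: "dim_vec u = d \<Longrightarrow> dim_vec v = d \<Longrightarrow> outer_prod u v \<in> carrier_mat d d"
  by (auto simp: outer_prod_def)

lemma deflate_mult_vec:
  assumes "psd d R" "dim_vec u = d" "dim_vec v = d"
  shows "deflate R u *\<^sub>v v = R *\<^sub>v v - ((u \<bullet> (R *\<^sub>v v)) / (u \<bullet> (R *\<^sub>v u))) \<cdot>\<^sub>v (R *\<^sub>v u)"
proof -
  have R: "R \<in> carrier_mat d d" "transpose_mat R = R" using assms by (auto simp: psd_def)
  have "(R *\<^sub>v u) \<bullet> v = u \<bullet> (R *\<^sub>v v)"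
    using sym_bilinear[OF R, of u v] assms R by (simp add: scalar_prod_comm)
  then show ?thesis using assms R
    by (simp add: deflate_def mat_vec_simps smult_smult_assoc)
qed

text \<open>The form at h loses (u^T R h)^2 / (u^T R u), which is nonnegative and, by
  Cauchy-Schwarz, at most h^T R h.\<close>

lemma deflate_psd:
  assumes R: "psd d R" and u: "dim_vec u = d"
  shows "psd d (deflate R u)"
    and "h \<in> carrier_vec d \<Longrightarrow> h \<bullet> (deflate R u *\<^sub>v h) \<le> h \<bullet> (R *\<^sub>v h)"
proof -
  have Rc: "R \<in> carrier_mat d d" "transpose_mat R = R" using R by (auto simp: psd_def)
  have q: "h \<bullet> (deflate R u *\<^sub>v h) = h \<bullet> (R *\<^sub>v h) - (u \<bullet> (R *\<^sub>v h))\<^sup>2 / (u \<bullet> (R *\<^sub>v u))"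
    if "dim_vec h = d" for h
    using sym_bilinear[OF Rc, of u h] that u Rc
    by (simp add: deflate_mult_vec[OF R u] mat_vec_simps power2_eq_square)
  have uu: "0 \<le> u \<bullet> (R *\<^sub>v u)" using R u by (auto simp: psd_def intro: carrier_vecI)
  show "h \<bullet> (deflate R u *\<^sub>v h) \<le> h \<bullet> (R *\<^sub>v h)" if "h \<in> carrier_vec d" for h
    using q[of h] that uu by simp
  have "0 \<le> h \<bullet> (deflate R u *\<^sub>v h)" if h: "h \<in> carrier_vec d" for h
  proof (cases "u \<bullet> (R *\<^sub>v u) = 0")
    case True
    then show ?thesis using q[of h] h R by (simp add: psd_def)
  next
    case False
    then show ?thesis
      using q[of h] h u uu psd_Cauchy_Schwarz[OF R, of u h] by (simp add: pos_divide_le_eq mult.commute)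
  qed
  moreover have "transpose_mat (deflate R u) = deflate R u"
    unfolding deflate_def using Rc by (subst transpose_minus[of _ d d]) (auto simp: transpose_smult)
  moreover have "deflate R u \<in> carrier_mat d d" using Rc u by (auto simp: deflate_def)
  ultimately show "psd d (deflate R u)" by (auto simp: psd_def)
qed

lemma outer_prod_mult_mat: "A \<in> carrier_mat d d \<Longrightarrow> dim_vec u = d \<Longrightarrow> dim_vec v = d \<Longrightarrow>
   A * outer_prod u v = outer_prod (A *\<^sub>v u) (v :: real vec)"
  by (rule mat_eqI_vec[of _ d]) (auto simp: mat_vec_simps)

lemma tr_mult_deflate:
  assumes "psd d P" "psd d Q" "dim_vec u = d"
  shows "tr (P * deflate Q u) = tr (P * Q) - ((Q *\<^sub>v u) \<bullet> (P *\<^sub>v (Q *\<^sub>v u))) / (u \<bullet> (Q *\<^sub>v u))"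
proof -
  have c: "P \<in> carrier_mat d d" "Q \<in> carrier_mat d d" using assms by (auto simp: psd_def)
  have "P * deflate Q u = P * Q - (1 / (u \<bullet> (Q *\<^sub>v u))) \<cdot>\<^sub>m outer_prod (P *\<^sub>v (Q *\<^sub>v u)) (Q *\<^sub>v u)"
    unfolding deflate_def using c assms
    by (subst mult_minus_distrib_mat[of _ d d _ d]) (auto simp: mult_smult_distrib[of _ d d _ d] outer_prod_mult_mat[of _ d])
  moreover have "(P *\<^sub>v (Q *\<^sub>v u)) \<bullet> (Q *\<^sub>v u) = (Q *\<^sub>v u) \<bullet> (P *\<^sub>v (Q *\<^sub>v u))"
    using c by (intro scalar_prod_comm) auto
  ultimately show ?thesis
    using c assms by (simp add: tr_minus[of _ d] tr_smult[of _ d] tr_outer_prod[of _ d])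
qed

text \<open>Deflating \<open>Q\<close> along the standard basis vectors one after the other decreases the trace of
  \<open>P * Q\<close> and ends with the zero matrix.\<close>

lemma tr_mult_psd_nonneg:
  assumes P: "psd d P" and Q: "psd d Q"
  shows "0 \<le> tr (P * Q)"
proof -
  define S where "S = rec_nat Q (\<lambda>j R. deflate R (unit_vec d j))"
  have S0: "S 0 = Q" and SS: "S (Suc j) = deflate (S j) (unit_vec d j)" for j
    unfolding S_def by (rule nat.rec)+
  have psdS: "psd d (S j)" for j
  proof (induction j)
    case (Suc j)
    then show ?case unfolding SS by (rule deflate_psd(1)) simp
  qed (simp add: S0 Q)
  \<comment> \<open>The kernel of \<open>deflate R u\<close> contains u and the kernel of R, so a
    basis vector stays annihilated once its turn has come.\<close>
  have kill: "i < j \<Longrightarrow> j \<le> d \<Longrightarrow> S j *\<^sub>v unit_vec d i = 0\<^sub>v d" for i j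
  proof (induction j)
    case (Suc j)
    let ?e = "unit_vec d j"
    have c: "dim_row (S j) = d" using psd_dims[OF psdS] by simp
    define k where "k = (?e \<bullet> (S j *\<^sub>v unit_vec d i)) / (?e \<bullet> (S j *\<^sub>v ?e))"
    have dm: "S (Suc j) *\<^sub>v unit_vec d i = S j *\<^sub>v unit_vec d i - k \<cdot>\<^sub>v (S j *\<^sub>v ?e)"
      unfolding SS k_def by (rule deflate_mult_vec[OF psdS]) simp_all
    show ?case
    proof (cases "i = j")
      case True
      have "k \<cdot>\<^sub>v (S j *\<^sub>v ?e) = S j *\<^sub>v ?e"
      proof (cases "?e \<bullet> (S j *\<^sub>v ?e) = 0")
        case True
        then have "S j *\<^sub>v ?e = 0\<^sub>v d" using psd_quadratic_0[OF psdS, of ?e j] by simp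
        then show ?thesis by (simp only:) (rule eq_vecI, simp_all)
      next
        case False
        then have "k = 1" using \<open>i = j\<close> by (simp add: k_def)
        then show ?thesis by simp
      qed
      then have "S (Suc j) *\<^sub>v unit_vec d i = S j *\<^sub>v ?e - S j *\<^sub>v ?e"
        using dm \<open>i = j\<close> by simp
      also have "\<dots> = 0\<^sub>v d" using c by (intro eq_vecI) simp_all
      finally show ?thesis .
    next
      case False
      then have z: "S j *\<^sub>v unit_vec d i = 0\<^sub>v d" using Suc by simp
      then have "k = 0" unfolding k_def by simp
      have "S (Suc j) *\<^sub>v unit_vec d i = 0\<^sub>v d - 0 \<cdot>\<^sub>v (S j *\<^sub>v ?e)"
        using dm z \<open>k = 0\<close> by simp
      also have "\<dots> = 0\<^sub>v d" using c by (intro eq_vecI) simp_all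
      finally show ?thesis .
    qed
  qed simp
  \<comment> \<open>The trace drops by the form \<open>P\<close> at \<open>S j\<close> applied to
    the basis vector, divided by a value of the form \<open>S j\<close>; both are
    nonnegative.\<close>
  have step: "tr (P * S (Suc j)) \<le> tr (P * S j)" for j
  proof -
    have c: "dim_row (S j) = d" using psd_dims[OF psdS] by simp
    have "0 \<le> ((S j *\<^sub>v unit_vec d j) \<bullet> (P *\<^sub>v (S j *\<^sub>v unit_vec d j))) / (unit_vec d j \<bullet> (S j *\<^sub>v unit_vec d j))"
      by (intro divide_nonneg_nonneg psdD[OF P] psdD[OF psdS]) (simp_all add: c)
    then show ?thesis unfolding SS using tr_mult_deflate[OF P psdS, of "unit_vec d j" j] by simp
  qed
  have "tr (P * S j) \<le> tr (P * Q)" for j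
  proof (induction j)
    case (Suc j)
    then show ?case using step[of j] by linarith
  qed (simp add: S0)
  then have "tr (P * S d) \<le> tr (P * Q)" .
  moreover have "S d = 0\<^sub>m d d"
  proof (rule mat_eq_zeroI)
    show "S d \<in> carrier_mat d d" using psdS[of d] by (simp add: psd_def)
    show "S d *\<^sub>v unit_vec d j = 0\<^sub>v d" if "j < d" for j by (rule kill) (use that in simp_all)
  qed
  moreover have "P * 0\<^sub>m d d = 0\<^sub>m d d" using psd_dims[OF P] by auto
  moreover have "tr (0\<^sub>m d d) = 0" by (simp add: tr_def)
  ultimately show ?thesis by simp
qed

text \<open>In spectral terms, the largest eigenvalue of A^-1/2 R A^-1/2 is at most its trace. Here
  \<open>R\<close> is deflated along h: nonnegativity of tr (A^-1 (deflate R h)) reads (R h)^T A^-1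
  (R h) <= tr (A^-1 R) (h^T R h), and dual Cauchy-Schwarz bounds (h^T R h)^2 by (h^T A h) times the
  left-hand side.\<close>

lemma quadratic_le_tr:
  assumes A: "pd d A" and R: "psd d R" and h: "h \<in> carrier_vec d"
  shows "h \<bullet> (R *\<^sub>v h) \<le> tr (minv A * R) * (h \<bullet> (A *\<^sub>v h))"
proof (cases "h \<bullet> (R *\<^sub>v h) = 0")
  case True
  have "0 \<le> tr (minv A * R)" by (rule tr_mult_psd_nonneg[OF pd_imp_psd[OF pd_minv_pd[OF A]] R])
  moreover have "0 \<le> h \<bullet> (A *\<^sub>v h)" using pd_imp_psd[OF A] h by (auto simp: psd_def)
  ultimately show ?thesis using True by simp
next
  case False
  define r a where "r = h \<bullet> (R *\<^sub>v h)" and "a = (R *\<^sub>v h) \<bullet> (minv A *\<^sub>v (R *\<^sub>v h))"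
  have hd: "dim_vec h = d" using h by auto
  have r: "0 < r" using False R h unfolding psd_def r_def by (metis less_eq_real_def)
  have "0 \<le> tr (minv A * deflate R h)"
    by (rule tr_mult_psd_nonneg[OF pd_imp_psd[OF pd_minv_pd[OF A]] deflate_psd(1)[OF R hd]])
  also have "\<dots> = tr (minv A * R) - a / r"
    unfolding a_def r_def by (rule tr_mult_deflate[OF pd_imp_psd[OF pd_minv_pd[OF A]] R hd])
  finally have t: "a \<le> tr (minv A * R) * r" using r by (simp add: field_simps)
  have h0: "0 \<le> h \<bullet> (A *\<^sub>v h)" using pd_imp_psd[OF A] h by (auto simp: psd_def)
  have "r\<^sup>2 \<le> (h \<bullet> (A *\<^sub>v h)) * a"
    unfolding r_def a_def using pd_dual_Cauchy_Schwarz[OF A hd, of "R *\<^sub>v h"] psd_dims[OF R] by simp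
  also have "\<dots> \<le> (h \<bullet> (A *\<^sub>v h)) * (tr (minv A * R) * r)" using t h0 by (rule mult_left_mono)
  finally have "r * r \<le> r * (tr (minv A * R) * (h \<bullet> (A *\<^sub>v h)))" by (simp add: power2_eq_square algebra_simps)
  then show ?thesis using r unfolding r_def[symmetric] by (simp add: mult_le_cancel_left)
qed

section \<open>Quasi-Newton updates\<close>

lemma loewnerD: "loewner_le d A B \<Longrightarrow> dim_vec h = d \<Longrightarrow> h \<bullet> (A *\<^sub>v h) \<le> h \<bullet> (B *\<^sub>v h)"
  unfolding loewner_le_def using carrier_vecI[of h d] by blast

lemma loewner_iff_psd:
  assumes "A \<in> carrier_mat d d" "transpose_mat A = A" "B \<in> carrier_mat d d" "transpose_mat B = B"
  shows "loewner_le d A B \<longleftrightarrow> psd d (B - A)"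
proof -
  have "h \<bullet> ((B - A) *\<^sub>v h) = h \<bullet> (B *\<^sub>v h) - h \<bullet> (A *\<^sub>v h)" if "h \<in> carrier_vec d" for h
    using assms carrier_vecD[OF that] by (simp add: mat_vec_simps)
  moreover have "transpose_mat (B - A) = B - A"
    using assms by (simp add: transpose_minus)
  ultimately show ?thesis
    using assms unfolding loewner_le_def psd_def by auto
qed

lemma sandwich_outer_prod:
  assumes "A \<in> carrier_mat d d" "transpose_mat A = A" "dim_vec u = d"
  shows "A * outer_prod u u * A = outer_prod (A *\<^sub>v u) (A *\<^sub>v u)"
proof (rule mat_eqI_vec[of _ d])
  fix v :: "real vec" assume v: "dim_vec v = d"
  have "u \<bullet> (A *\<^sub>v v) = (A *\<^sub>v u) \<bullet> v"
    using sym_bilinear[OF assms(1,2,3) v] scalar_prod_comm[of v "A *\<^sub>v u"] assms v by simp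
  then show "A * outer_prod u u * A *\<^sub>v v = outer_prod (A *\<^sub>v u) (A *\<^sub>v u) *\<^sub>v v"
    using assms v by (simp add: mat_vec_simps)
qed (use assms in auto)

text \<open>The case distinction of the update disappears: if \<open>G u = A u\<close>, the
  denominator in \<open>deflate\<close> is zero and nothing is subtracted.\<close>

lemma SR1_update_eq:
  assumes G: "G \<in> carrier_mat d d" and A: "A \<in> carrier_mat d d"
    and R: "transpose_mat (G - A) = G - A" and u: "dim_vec u = d"
  shows "SR1_update G A u = A + deflate (G - A) u"
proof -
  have GA: "G - A \<in> carrier_mat d d" using A by auto
  have Ru: "(G - A) *\<^sub>v u = G *\<^sub>v u - A *\<^sub>v u" using G A u by (simp add: mat_vec_simps)
  have GAA: "A + (G - A - X) = G - X" if "X \<in> carrier_mat d d" for X :: "real mat"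
    using that G A by (intro eq_matI) auto
  have o: "outer_prod ((G - A) *\<^sub>v u) ((G - A) *\<^sub>v u) \<in> carrier_mat d d" using A by auto
  show ?thesis
  proof (cases "G *\<^sub>v u = A *\<^sub>v u")
    case True
    then have z: "(G - A) *\<^sub>v u = 0\<^sub>v d" unfolding Ru using A by (intro eq_vecI) auto
    have "u \<bullet> ((G - A) *\<^sub>v u) = 0" unfolding z by (rule scalar_prod_right_zero[OF carrier_vecI[OF u]])
    then have "deflate (G - A) u = G - A" unfolding deflate_def using G A by (intro eq_matI) auto
    moreover have "A + (G - A) = G" using G A by (intro eq_matI) auto
    ultimately show ?thesis using True by (simp add: SR1_update_def)
  next
    case False
    then show ?thesis
      unfolding SR1_update_def deflate_def sandwich_outer_prod[OF GA R u]
      using o by (subst GAA) auto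
  qed
qed

lemma BFGS_update_eq:
  assumes "G \<in> carrier_mat d d" "transpose_mat G = G" "A \<in> carrier_mat d d" "transpose_mat A = A" "dim_vec u = d"
  shows "BFGS_update G A u = deflate G u + (1 / (u \<bullet> (A *\<^sub>v u))) \<cdot>\<^sub>m outer_prod (A *\<^sub>v u) (A *\<^sub>v u)"
  unfolding BFGS_update_def deflate_def using assms by (simp add: sandwich_outer_prod)

text \<open>The error G - A is deflated, so it stays semidefinite and does not increase in the
  Loewner order.\<close>

lemma SR1_update_sandwich:
  assumes le: "loewner_le d A G" and eta: "loewner_le d G (\<eta> \<cdot>\<^sub>m A)" and u: "dim_vec u = d"
  shows "loewner_le d A (SR1_update G A u)" and "loewner_le d (SR1_update G A u) (\<eta> \<cdot>\<^sub>m A)"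
proof -
  have c: "G \<in> carrier_mat d d" "transpose_mat G = G" "A \<in> carrier_mat d d" "transpose_mat A = A"
    using le by (auto simp: loewner_le_def)
  have R: "psd d (G - A)" using le loewner_iff_psd[OF c(3,4,1,2)] by simp
  have eq: "SR1_update G A u = A + deflate (G - A) u"
    using R c u by (intro SR1_update_eq) (auto simp: psd_def)
  have D: "psd d (deflate (G - A) u)" by (rule deflate_psd[OF R u])
  then have Dc: "deflate (G - A) u \<in> carrier_mat d d" "transpose_mat (deflate (G - A) u) = deflate (G - A) u"
    by (auto simp: psd_def)
  have S: "A + deflate (G - A) u \<in> carrier_mat d d" "transpose_mat (A + deflate (G - A) u) = A + deflate (G - A) u"
    using Dc c by (auto simp: transpose_add)
  have q: "h \<bullet> ((A + deflate (G - A) u) *\<^sub>v h) = h \<bullet> (A *\<^sub>v h) + h \<bullet> (deflate (G - A) u *\<^sub>v h)"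
    if "h \<in> carrier_vec d" for h using carrier_vecD[OF that] c Dc by (simp add: mat_vec_simps)
  show "loewner_le d A (SR1_update G A u)"
    unfolding eq loewner_le_def using q D S c by (auto simp: psd_def)
  have "h \<bullet> ((A + deflate (G - A) u) *\<^sub>v h) \<le> h \<bullet> ((\<eta> \<cdot>\<^sub>m A) *\<^sub>v h)" if h: "h \<in> carrier_vec d" for h
  proof -
    have "h \<bullet> ((G - A) *\<^sub>v h) = h \<bullet> (G *\<^sub>v h) - h \<bullet> (A *\<^sub>v h)"
      using carrier_vecD[OF h] c by (simp add: mat_vec_simps)
    then show ?thesis
      using q[OF h] deflate_psd(2)[OF R u h] loewnerD[OF eta carrier_vecD[OF h]] by linarith
  qed
  then show "loewner_le d (SR1_update G A u) (\<eta> \<cdot>\<^sub>m A)"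
    unfolding eq loewner_le_def using S c eta by (auto simp: transpose_smult)
qed

text \<open>The completion of the square \<open>h\<^sup>T A h - (h\<^sup>T A u)\<^sup>2 / u\<^sup>T A u\<close> is the minimum over \<open>t\<close> of
  the quadratic form \<open>A\<close> at \<open>h - t u\<close>; this is monotone in \<open>A\<close>.\<close>

lemma complete_square:
  assumes A: "pd d A" and u: "dim_vec u = d" "u \<noteq> 0\<^sub>v d" and h: "dim_vec h = d"
  defines "t0 \<equiv> (h \<bullet> (A *\<^sub>v u)) / (u \<bullet> (A *\<^sub>v u))"
  shows "h \<bullet> (A *\<^sub>v h) - (h \<bullet> (A *\<^sub>v u))\<^sup>2 / (u \<bullet> (A *\<^sub>v u))
      \<le> (h + t \<cdot>\<^sub>v u) \<bullet> (A *\<^sub>v (h + t \<cdot>\<^sub>v u))"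
    and "(h + (- t0) \<cdot>\<^sub>v u) \<bullet> (A *\<^sub>v (h + (- t0) \<cdot>\<^sub>v u))
      = h \<bullet> (A *\<^sub>v h) - (h \<bullet> (A *\<^sub>v u))\<^sup>2 / (u \<bullet> (A *\<^sub>v u))"
proof -
  have Ac: "A \<in> carrier_mat d d" "transpose_mat A = A" using A by (auto simp: pd_def)
  define a b c where "a = h \<bullet> (A *\<^sub>v h)" and "b = h \<bullet> (A *\<^sub>v u)" and "c = u \<bullet> (A *\<^sub>v u)"
  have c: "c > 0" using A u carrier_vecI[OF u(1)] unfolding pd_def c_def by blast
  have "0 \<le> (b / c + t)\<^sup>2 * c" using c by simp
  also have "\<dots> = b\<^sup>2 / c + 2 * t * b + t\<^sup>2 * c" using c by (simp add: field_simps power2_eq_square)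
  finally have "a - b\<^sup>2 / c \<le> a + 2 * t * b + t\<^sup>2 * c" by linarith
  then show "h \<bullet> (A *\<^sub>v h) - (h \<bullet> (A *\<^sub>v u))\<^sup>2 / (u \<bullet> (A *\<^sub>v u))
      \<le> (h + t \<cdot>\<^sub>v u) \<bullet> (A *\<^sub>v (h + t \<cdot>\<^sub>v u))"
    unfolding quadratic_expand[OF Ac h u(1)] a_def b_def c_def .
  have "a + 2 * (- (b / c)) * b + (- (b / c))\<^sup>2 * c = a - b\<^sup>2 / c"
    using c by (simp add: field_simps power2_eq_square)
  then show "(h + (- t0) \<cdot>\<^sub>v u) \<bullet> (A *\<^sub>v (h + (- t0) \<cdot>\<^sub>v u))
      = h \<bullet> (A *\<^sub>v h) - (h \<bullet> (A *\<^sub>v u))\<^sup>2 / (u \<bullet> (A *\<^sub>v u))"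
    unfolding quadratic_expand[OF Ac h u(1)] t0_def a_def b_def c_def .
qed

lemma pd_of_loewner:
  assumes "pd d A" "loewner_le d A G"
  shows "pd d G"
  using assms unfolding pd_def loewner_le_def by (auto intro: less_le_trans)

text \<open>The form of the update at h is the minimum over t of the form \<open>G\<close> at h + t
  u, plus (h^T A u)^2 / (u^T A u). The form \<open>A\<close> is the sum of its own minimum and the
  same correction. Monotonicity of the minimum gives the lower bound; the upper bound also needs 1
  <= \<eta>, because the correction occurs with coefficient 1 and not \<eta>.\<close>

lemma BFGS_update_sandwich:
  assumes A: "pd d A" and le: "loewner_le d A G" and eta: "loewner_le d G (\<eta> \<cdot>\<^sub>m A)" and \<eta>: "1 \<le> \<eta>"
    and u: "dim_vec u = d" "u \<noteq> 0\<^sub>v d"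
  shows "loewner_le d A (BFGS_update G A u)" and "loewner_le d (BFGS_update G A u) (\<eta> \<cdot>\<^sub>m A)"
proof -
  have c: "G \<in> carrier_mat d d" "transpose_mat G = G" "A \<in> carrier_mat d d" "transpose_mat A = A"
    using le by (auto simp: loewner_le_def)
  have G: "pd d G" by (rule pd_of_loewner[OF A le])
  define \<alpha> where "\<alpha> = u \<bullet> (A *\<^sub>v u)"
  have \<alpha>: "\<alpha> > 0" using A u carrier_vecI[OF u(1)] unfolding pd_def \<alpha>_def by blast
  have eq: "BFGS_update G A u = deflate G u + (1 / \<alpha>) \<cdot>\<^sub>m outer_prod (A *\<^sub>v u) (A *\<^sub>v u)"
    unfolding \<alpha>_def by (rule BFGS_update_eq) (use c u in auto)
  have D: "psd d (deflate G u)" by (rule deflate_psd[OF pd_imp_psd[OF G] u(1)])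
  then have Dc: "deflate G u \<in> carrier_mat d d" "transpose_mat (deflate G u) = deflate G u"
    by (auto simp: psd_def)
  let ?S = "deflate G u + (1 / \<alpha>) \<cdot>\<^sub>m outer_prod (A *\<^sub>v u) (A *\<^sub>v u)"
  have o: "(1 / \<alpha>) \<cdot>\<^sub>m outer_prod (A *\<^sub>v u) (A *\<^sub>v u) \<in> carrier_mat d d" using c by auto
  have S: "?S \<in> carrier_mat d d" "transpose_mat ?S = ?S"
    using Dc o c by (auto simp: transpose_add[OF Dc(1) o] transpose_smult)
  have q: "h \<bullet> (?S *\<^sub>v h) = (h \<bullet> (G *\<^sub>v h) - (h \<bullet> (G *\<^sub>v u))\<^sup>2 / (u \<bullet> (G *\<^sub>v u))) + (h \<bullet> (A *\<^sub>v u))\<^sup>2 / \<alpha>"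
    if h: "dim_vec h = d" for h
  proof -
    have "h \<bullet> (?S *\<^sub>v h) = h \<bullet> (deflate G u *\<^sub>v h) + h \<bullet> (((1 / \<alpha>) \<cdot>\<^sub>m outer_prod (A *\<^sub>v u) (A *\<^sub>v u)) *\<^sub>v h)"
      using Dc c h by (simp add: mat_vec_simps)
    moreover have "h \<bullet> (((1 / \<alpha>) \<cdot>\<^sub>m outer_prod (A *\<^sub>v u) (A *\<^sub>v u)) *\<^sub>v h) = (h \<bullet> (A *\<^sub>v u))\<^sup>2 / \<alpha>"
      using c h scalar_prod_comm[of "A *\<^sub>v u" h] by (simp add: mat_vec_simps power2_eq_square)
    moreover have "h \<bullet> (deflate G u *\<^sub>v h) = h \<bullet> (G *\<^sub>v h) - (h \<bullet> (G *\<^sub>v u))\<^sup>2 / (u \<bullet> (G *\<^sub>v u))"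
      unfolding deflate_mult_vec[OF pd_imp_psd[OF G] u(1) h] sym_bilinear[OF c(1,2) u(1) h]
      using c h by (simp add: mat_vec_simps power2_eq_square)
    ultimately show ?thesis by simp
  qed
  have lower: "h \<bullet> (A *\<^sub>v h) \<le> h \<bullet> (?S *\<^sub>v h)" if h: "dim_vec h = d" for h
  proof -
    \<comment> \<open>The minimiser for \<open>G\<close>: there the form \<open>A\<close> is at
      least its own minimum and at most the minimum of \<open>G\<close>. The upper bound below uses
      the minimiser for \<open>A\<close> in the same way.\<close>
    let ?t = "(h \<bullet> (G *\<^sub>v u)) / (u \<bullet> (G *\<^sub>v u))"
    let ?w = "h + (- ?t) \<cdot>\<^sub>v u"
    have "h \<bullet> (A *\<^sub>v h) - (h \<bullet> (A *\<^sub>v u))\<^sup>2 / \<alpha> \<le> ?w \<bullet> (A *\<^sub>v ?w)"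
      unfolding \<alpha>_def by (rule complete_square(1)[OF A u h])
    also have "\<dots> \<le> ?w \<bullet> (G *\<^sub>v ?w)" by (rule loewnerD[OF le]) (use h u in simp)
    also have "\<dots> = h \<bullet> (G *\<^sub>v h) - (h \<bullet> (G *\<^sub>v u))\<^sup>2 / (u \<bullet> (G *\<^sub>v u))"
      by (rule complete_square(2)[OF G u h])
    finally show ?thesis using q[OF h] by linarith
  qed
  have upper: "h \<bullet> (?S *\<^sub>v h) \<le> h \<bullet> ((\<eta> \<cdot>\<^sub>m A) *\<^sub>v h)" if h: "dim_vec h = d" for h
  proof -
    let ?t = "(h \<bullet> (A *\<^sub>v u)) / (u \<bullet> (A *\<^sub>v u))"
    let ?w = "h + (- ?t) \<cdot>\<^sub>v u"
    have sm: "v \<bullet> ((\<eta> \<cdot>\<^sub>m A) *\<^sub>v v) = \<eta> * (v \<bullet> (A *\<^sub>v v))" if "dim_vec v = d" for v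
      using c that by (simp add: mat_vec_simps)
    have "h \<bullet> (G *\<^sub>v h) - (h \<bullet> (G *\<^sub>v u))\<^sup>2 / (u \<bullet> (G *\<^sub>v u)) \<le> ?w \<bullet> (G *\<^sub>v ?w)"
      by (rule complete_square(1)[OF G u h])
    also have "\<dots> \<le> ?w \<bullet> ((\<eta> \<cdot>\<^sub>m A) *\<^sub>v ?w)" by (rule loewnerD[OF eta]) (use h u in simp)
    also have "\<dots> = \<eta> * (?w \<bullet> (A *\<^sub>v ?w))" by (rule sm) (use h u in simp)
    also have "\<dots> = \<eta> * (h \<bullet> (A *\<^sub>v h) - (h \<bullet> (A *\<^sub>v u))\<^sup>2 / \<alpha>)"
      unfolding complete_square(2)[OF A u h] \<alpha>_def ..
    finally have "h \<bullet> (?S *\<^sub>v h) \<le> \<eta> * (h \<bullet> (A *\<^sub>v h)) - (\<eta> - 1) * ((h \<bullet> (A *\<^sub>v u))\<^sup>2 / \<alpha>)"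
      unfolding q[OF h] right_diff_distrib left_diff_distrib by linarith
    moreover have "0 \<le> (\<eta> - 1) * ((h \<bullet> (A *\<^sub>v u))\<^sup>2 / \<alpha>)" using \<eta> \<alpha> by simp
    ultimately show ?thesis using sm[OF h] by linarith
  qed
  show "loewner_le d A (BFGS_update G A u)" "loewner_le d (BFGS_update G A u) (\<eta> \<cdot>\<^sub>m A)"
    unfolding eq loewner_le_def using S c lower upper by (auto simp: transpose_smult)
qed

section \<open>Decrease of the error trace in one update\<close>

text \<open>With R = G - A the trace drops by |R u|^2 / (u^T R u), and |R u| >= u^T R u for a unit
  vector u.\<close>

lemma SR1_tr_decrease:
  assumes le: "loewner_le d A G" and u: "dim_vec u = d" "u \<bullet> u = 1"
  shows "tr (SR1_update G A u - A) \<le> tr (G - A) - u \<bullet> ((G - A) *\<^sub>v u)"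
proof -
  have c: "G \<in> carrier_mat d d" "transpose_mat G = G" "A \<in> carrier_mat d d" "transpose_mat A = A"
    using le by (auto simp: loewner_le_def)
  define R where "R = G - A"
  have R: "psd d R" unfolding R_def using le loewner_iff_psd[OF c(3,4,1,2)] by simp
  have Rc: "R \<in> carrier_mat d d" using R by (simp add: psd_def)
  have I: "psd d (1\<^sub>m d)" unfolding psd_def by (auto intro: scalar_prod_self_nonneg)
  have "SR1_update G A u = A + deflate R u"
    unfolding R_def using R c u by (intro SR1_update_eq) (auto simp: psd_def R_def)
  then have "SR1_update G A u - A = deflate R u"
    using deflate_psd(1)[OF R u(1)] c by (intro eq_matI) (auto simp: psd_def)
  moreover have "tr (deflate R u) = tr R - ((R *\<^sub>v u) \<bullet> (R *\<^sub>v u)) / (u \<bullet> (R *\<^sub>v u))"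
  proof -
    have "tr (1\<^sub>m d * deflate R u) = tr (1\<^sub>m d * R) - ((R *\<^sub>v u) \<bullet> (1\<^sub>m d *\<^sub>v (R *\<^sub>v u))) / (u \<bullet> (R *\<^sub>v u))"
      by (rule tr_mult_deflate[OF I R u(1)])
    moreover have "1\<^sub>m d * deflate R u = deflate R u" "1\<^sub>m d * R = R"
      using deflate_psd(1)[OF R u(1)] Rc by (auto simp: psd_def)
    moreover have "1\<^sub>m d *\<^sub>v (R *\<^sub>v u) = R *\<^sub>v u" using Rc by (intro one_mult_vec) auto
    ultimately show ?thesis by simp
  qed
  moreover have "u \<bullet> (R *\<^sub>v u) \<le> ((R *\<^sub>v u) \<bullet> (R *\<^sub>v u)) / (u \<bullet> (R *\<^sub>v u))"
  proof (cases "u \<bullet> (R *\<^sub>v u) = 0")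
    case False
    then have p: "0 < u \<bullet> (R *\<^sub>v u)" using psdD[OF R u(1)] by simp
    have "(u \<bullet> (1\<^sub>m d *\<^sub>v (R *\<^sub>v u)))\<^sup>2 \<le> (u \<bullet> (1\<^sub>m d *\<^sub>v u)) * ((R *\<^sub>v u) \<bullet> (1\<^sub>m d *\<^sub>v (R *\<^sub>v u)))"
      by (rule psd_Cauchy_Schwarz[OF I u(1)]) (use Rc in auto)
    moreover have "1\<^sub>m d *\<^sub>v (R *\<^sub>v u) = R *\<^sub>v u" "1\<^sub>m d *\<^sub>v u = u"
      using Rc u by (auto intro: one_mult_vec)
    ultimately have "(u \<bullet> (R *\<^sub>v u))\<^sup>2 \<le> (R *\<^sub>v u) \<bullet> (R *\<^sub>v u)" using u by simp
    then show ?thesis using p by (simp add: pos_le_divide_eq power2_eq_square)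
  qed simp
  ultimately show ?thesis unfolding R_def[symmetric] by simp
qed

lemma factor_inverse:
  assumes F: "F \<in> carrier_mat d d" and G: "G \<in> carrier_mat d d"
    and inv: "transpose_mat F * F * G = 1\<^sub>m d"
  shows "G * (transpose_mat F * F) = 1\<^sub>m d" "F * G * transpose_mat F = 1\<^sub>m d"
    "minv F = G * transpose_mat F"
proof -
  have Ft: "transpose_mat F \<in> carrier_mat d d" using F by simp
  show 1: "G * (transpose_mat F * F) = 1\<^sub>m d"
    by (rule mat_mult_left_right_inverse[OF _ G inv]) (use F in auto)
  have GF: "G * transpose_mat F \<in> carrier_mat d d" using G Ft by simp
  have "(G * transpose_mat F) * F = 1\<^sub>m d"
    using 1 assoc_mult_mat[OF G Ft F] by simp
  then have 2: "F * (G * transpose_mat F) = 1\<^sub>m d"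
    by (rule mat_mult_left_right_inverse[OF GF F])
  then show "F * G * transpose_mat F = 1\<^sub>m d" using assoc_mult_mat[OF F G Ft] by simp
  show "minv F = G * transpose_mat F" by (rule minv_eqI[OF F GF 2])
qed

text \<open>When F^T F = G^-1 and G is symmetric, F^-1 = G F^T, so this is F^-T A^-1 F^-1, the
  matrix maximised by the greedy BFGS rule, written without the inverse of \<open>F\<close>.\<close>

definition BFGS_gain :: "real mat \<Rightarrow> real mat \<Rightarrow> real mat \<Rightarrow> real mat" where
  "BFGS_gain F G A = F * G * minv A * (G * transpose_mat F)"

lemma BFGS_gain_carrier:
  "F \<in> carrier_mat d d \<Longrightarrow> G \<in> carrier_mat d d \<Longrightarrow> pd d A \<Longrightarrow> BFGS_gain F G A \<in> carrier_mat d d"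
  unfolding BFGS_gain_def using pd_minv by auto

text \<open>Cyclicity of the trace brings the two factors together into G (F^T F G) = G.\<close>

lemma tr_BFGS_gain:
  assumes F: "F \<in> carrier_mat d d" and G: "G \<in> carrier_mat d d" and A: "pd d A"
    and inv: "transpose_mat F * F * G = 1\<^sub>m d"
  shows "tr (BFGS_gain F G A) = tr (minv A * G)"
proof -
  have B: "minv A \<in> carrier_mat d d" using pd_minv[OF A] by simp
  have Ft: "transpose_mat F \<in> carrier_mat d d" using F by simp
  have FG: "F * G \<in> carrier_mat d d" "G * transpose_mat F \<in> carrier_mat d d" using F G by auto
  have "tr (BFGS_gain F G A) = tr (F * G * (minv A * (G * transpose_mat F)))"
    unfolding BFGS_gain_def using assoc_mult_mat[OF FG(1) B FG(2)] by simp
  also have "\<dots> = tr (minv A * (G * transpose_mat F) * (F * G))"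
    using FG B by (intro tr_mult_comm[of _ d]) auto
  also have "minv A * (G * transpose_mat F) * (F * G) = minv A * ((G * transpose_mat F) * (F * G))"
    by (rule assoc_mult_mat[OF B FG(2) FG(1)])
  also have "(G * transpose_mat F) * (F * G) = G * (transpose_mat F * F * G)"
  proof -
    have "(G * transpose_mat F) * (F * G) = G * (transpose_mat F * (F * G))"
      by (rule assoc_mult_mat[OF G Ft FG(1)])
    also have "transpose_mat F * (F * G) = transpose_mat F * F * G"
      using assoc_mult_mat[OF Ft F G] by simp
    finally show ?thesis .
  qed
  finally show ?thesis using G inv by simp
qed

lemma BFGS_gain_quadratic:
  assumes F: "F \<in> carrier_mat d d" and G: "G \<in> carrier_mat d d" "transpose_mat G = G" and A: "pd d A"
    and s: "dim_vec s = d"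
  defines "u \<equiv> transpose_mat F *\<^sub>v s"
  shows "s \<bullet> (BFGS_gain F G A *\<^sub>v s) = (G *\<^sub>v u) \<bullet> (minv A *\<^sub>v (G *\<^sub>v u))"
proof -
  have B: "minv A \<in> carrier_mat d d" using pd_minv[OF A] by simp
  have "BFGS_gain F G A *\<^sub>v s = F *\<^sub>v (G *\<^sub>v (minv A *\<^sub>v (G *\<^sub>v u)))"
    unfolding BFGS_gain_def u_def using F G B s by (simp add: mat_vec_simps)
  moreover have "s \<bullet> (F *\<^sub>v v) = u \<bullet> v" if "dim_vec v = d" for v
    unfolding u_def using transpose_vec_mult_scalar[OF F carrier_vecI[OF that] carrier_vecI[OF s]] by simp
  moreover have "u \<bullet> (G *\<^sub>v v) = (G *\<^sub>v u) \<bullet> v" if "dim_vec v = d" for v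
  proof -
    have "u \<bullet> (G *\<^sub>v v) = v \<bullet> (G *\<^sub>v u)" by (rule sym_bilinear[OF G _ that]) (use F in \<open>simp add: u_def\<close>)
    then show ?thesis using scalar_prod_comm[of v "G *\<^sub>v u"] G that by simp
  qed
  ultimately show ?thesis using F G B by simp
qed

text \<open>F G F^T is the identity. A unit vector s therefore yields a direction u with u^T G u =
  1, which normalises the denominator of the BFGS update.\<close>

lemma factor_direction:
  fixes F :: "real mat"
  assumes F: "F \<in> carrier_mat d d" and G: "G \<in> carrier_mat d d"
    and inv: "transpose_mat F * F * G = 1\<^sub>m d" and s: "dim_vec s = d"
  defines "u \<equiv> transpose_mat F *\<^sub>v s"
  shows "u \<bullet> (G *\<^sub>v u) = s \<bullet> s"
proof -
  have "u \<bullet> (G *\<^sub>v u) = s \<bullet> (F *\<^sub>v (G *\<^sub>v u))"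
    using transpose_vec_mult_scalar[OF F, of "G *\<^sub>v u" s] G s unfolding u_def
    by (metis carrier_vecI dim_mult_mat_vec carrier_matD(1))
  also have "F *\<^sub>v (G *\<^sub>v u) = (F * G * transpose_mat F) *\<^sub>v s"
    unfolding u_def using F G s by (simp add: mat_vec_simps)
  finally show ?thesis using factor_inverse(2)[OF F G inv] s by (simp add: one_mult_vec)
qed

text \<open>Since u^T G u = 1, deflation removes exactly the gain form at s. The restored rank one
  term contributes tr (A^-1 A u u^T A) / (u^T A u) = 1.\<close>

lemma BFGS_tr_decrease:
  assumes F: "F \<in> carrier_mat d d" and A: "pd d A" and le: "loewner_le d A G"
    and inv: "transpose_mat F * F * G = 1\<^sub>m d" and s: "dim_vec s = d" "s \<bullet> s = 1"
  shows "tr (minv A * BFGS_update G A (transpose_mat F *\<^sub>v s)) = tr (minv A * G) - s \<bullet> (BFGS_gain F G A *\<^sub>v s) + 1"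
proof -
  define u where "u = transpose_mat F *\<^sub>v s"
  have u: "dim_vec u = d" using F by (simp add: u_def)
  have c: "G \<in> carrier_mat d d" "transpose_mat G = G" "A \<in> carrier_mat d d" "transpose_mat A = A"
    using le by (auto simp: loewner_le_def)
  have G: "pd d G" by (rule pd_of_loewner[OF A le])
  have B: "minv A \<in> carrier_mat d d" "psd d (minv A)" using pd_minv_pd[OF A] by (auto simp: pd_def pd_imp_psd)
  have uGu: "u \<bullet> (G *\<^sub>v u) = 1" unfolding u_def factor_direction[OF F c(1) inv s(1)] by (rule s(2))
  have "u \<noteq> 0\<^sub>v d" using uGu c by auto
  then have \<alpha>: "u \<bullet> (A *\<^sub>v u) > 0" using A carrier_vecI[OF u] by (auto simp: pd_def)
  have Au: "dim_vec (A *\<^sub>v u) = d" using c by simp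
  have "tr (minv A * BFGS_update G A u) = tr (minv A * deflate G u) + tr (minv A * ((1 / (u \<bullet> (A *\<^sub>v u))) \<cdot>\<^sub>m outer_prod (A *\<^sub>v u) (A *\<^sub>v u)))"
    unfolding BFGS_update_eq[OF c u]
    using B c deflate_psd(1)[OF pd_imp_psd[OF G] u]
    by (subst mult_add_distrib_mat[of _ d d _ d]) (auto simp: psd_def tr_add[of _ d])
  also have "minv A * ((1 / (u \<bullet> (A *\<^sub>v u))) \<cdot>\<^sub>m outer_prod (A *\<^sub>v u) (A *\<^sub>v u))
      = (1 / (u \<bullet> (A *\<^sub>v u))) \<cdot>\<^sub>m outer_prod u (A *\<^sub>v u)"
    using mult_smult_distrib[OF B(1) outer_prod_carrier[OF Au Au]] outer_prod_mult_mat[OF B(1) Au Au]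
      pd_minv_cancel(2)[OF A u] by simp
  also have "tr \<dots> = 1"
    using \<alpha> tr_smult[OF outer_prod_carrier[OF u Au]] tr_outer_prod[OF u Au] by simp
  also have "tr (minv A * deflate G u) = tr (minv A * G) - s \<bullet> (BFGS_gain F G A *\<^sub>v s)"
    unfolding tr_mult_deflate[OF B(2) pd_imp_psd[OF G] u] uGu
    using BFGS_gain_quadratic[OF F c(1,2) A s(1)] by (simp add: u_def)
  finally show ?thesis unfolding u_def by simp
qed

text \<open>The product is applied to an arbitrary y. The updated factor maps \<open>w\<close>, the
  updated Hessian estimate applied to y, to F G y plus a multiple of s, and its transpose maps that
  vector back to y.\<close>

lemma BFGS_factor_update:
  assumes F: "F \<in> carrier_mat d d" and A: "pd d A" and G: "pd d G"
    and inv: "transpose_mat F * F * G = 1\<^sub>m d" and s: "dim_vec s = d" "s \<bullet> s = 1"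
  defines "u \<equiv> transpose_mat F *\<^sub>v s"
  defines "\<alpha> \<equiv> u \<bullet> (A *\<^sub>v u)"
  defines "F' \<equiv> F - (1 / \<alpha>) \<cdot>\<^sub>m outer_prod (F *\<^sub>v (A *\<^sub>v u) - (sqrt \<alpha> / vnorm s) \<cdot>\<^sub>v s) u"
  shows "F' \<in> carrier_mat d d" "transpose_mat F' * F' * BFGS_update G A u = 1\<^sub>m d"
proof -
  have c: "G \<in> carrier_mat d d" "transpose_mat G = G" "A \<in> carrier_mat d d" "transpose_mat A = A"
    using A G by (auto simp: pd_def)
  have dims: "dim_row F = d" "dim_col F = d" "dim_row G = d" "dim_col G = d" "dim_row A = d" "dim_col A = d"
    using F c by auto
  have u: "dim_vec u = d" using F by (simp add: u_def)
  have uGu: "u \<bullet> (G *\<^sub>v u) = 1" unfolding u_def factor_direction[OF F c(1) inv s(1)] by (rule s(2))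
  have "u \<noteq> 0\<^sub>v d" using uGu c by auto
  then have \<alpha>: "\<alpha> > 0" using A carrier_vecI[OF u] unfolding pd_def \<alpha>_def by blast
  define v where "v = sqrt \<alpha> \<cdot>\<^sub>v s"
  define p where "p = F *\<^sub>v (A *\<^sub>v u) - v"
  have vd: "dim_vec v = d" and pd: "dim_vec p = d" using F s by (simp_all add: v_def p_def)
  have F'_eq: "F' = F - (1 / \<alpha>) \<cdot>\<^sub>m outer_prod p u"
    unfolding F'_def p_def v_def vnorm_def s(2) by simp
  show F'c: "F' \<in> carrier_mat d d"
    unfolding F'_eq using F pd u by auto
  have F't_eq: "transpose_mat F' = transpose_mat F - (1 / \<alpha>) \<cdot>\<^sub>m outer_prod u p"
    unfolding F'_eq using F pd u by (intro eq_matI) (auto simp: outer_prod_def)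
  have Ft: "transpose_mat F *\<^sub>v (F *\<^sub>v (G *\<^sub>v y)) = y" if "dim_vec y = d" for y
  proof -
    have "transpose_mat F *\<^sub>v (F *\<^sub>v (G *\<^sub>v y)) = (transpose_mat F * F * G) *\<^sub>v y"
      using dims that by (simp add: mat_vec_simps)
    then show ?thesis unfolding inv using that by (simp add: one_mult_vec)
  qed
  have FGu: "F *\<^sub>v (G *\<^sub>v u) = s"
  proof -
    have "F *\<^sub>v (G *\<^sub>v u) = (F * G * transpose_mat F) *\<^sub>v s"
      unfolding u_def using dims s by (simp add: mat_vec_simps)
    then show ?thesis unfolding factor_inverse(2)[OF F c(1) inv] using s by (simp add: one_mult_vec)
  qed
  have adj: "(F *\<^sub>v x) \<bullet> z = x \<bullet> (transpose_mat F *\<^sub>v z)" if "dim_vec x = d" "dim_vec z = d" for x z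
    using transpose_vec_mult_scalar[OF F carrier_vecI[OF that(1)] carrier_vecI[OF that(2)]]
      scalar_prod_comm[of "F *\<^sub>v x" z] scalar_prod_comm[of x "transpose_mat F *\<^sub>v z"] dims that by simp
  have "transpose_mat F' * F' * BFGS_update G A u *\<^sub>v y = 1\<^sub>m d *\<^sub>v y" if y: "dim_vec y = d" for y
  proof -
    define g a where "g = u \<bullet> (G *\<^sub>v y)" and "a = u \<bullet> (A *\<^sub>v y)"
    \<comment> \<open>The coefficient of s in \<open>F' w\<close>: deflation contributes -g, and F A
      u - p = \<open>sqrt \<alpha>\<close> s, taken with coefficient \<open>a / \<alpha>\<close>,
      contributes the rest.\<close>
    define k where "k = a / sqrt \<alpha> - g"
    define w where "w = BFGS_update G A u *\<^sub>v y"
    have Auy: "(A *\<^sub>v u) \<bullet> y = a"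
      using sym_bilinear[OF c(3,4) u y] scalar_prod_comm[of "A *\<^sub>v u" y] dims y by (simp add: a_def)
    have w: "w = (G *\<^sub>v y - g \<cdot>\<^sub>v (G *\<^sub>v u)) + (a / \<alpha>) \<cdot>\<^sub>v (A *\<^sub>v u)"
    proof -
      have "w = deflate G u *\<^sub>v y + ((1 / \<alpha>) \<cdot>\<^sub>m outer_prod (A *\<^sub>v u) (A *\<^sub>v u)) *\<^sub>v y"
        unfolding w_def BFGS_update_eq[OF c u] \<alpha>_def[symmetric]
        using psd_dims[OF deflate_psd(1)[OF pd_imp_psd[OF G] u]] dims y by (simp add: mult_mat_vec_add_l)
      moreover have "((1 / \<alpha>) \<cdot>\<^sub>m outer_prod (A *\<^sub>v u) (A *\<^sub>v u)) *\<^sub>v y = (a / \<alpha>) \<cdot>\<^sub>v (A *\<^sub>v u)"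
        using dims y Auy by (simp add: mat_vec_simps smult_smult_assoc)
      ultimately show ?thesis
        using deflate_mult_vec[OF pd_imp_psd[OF G] u y] uGu by (simp add: g_def)
    qed
    have wd: "dim_vec w = d" unfolding w using dims by simp
    have uw: "u \<bullet> w = a"
      unfolding w using dims u y uGu \<alpha> by (simp add: mat_vec_simps g_def[symmetric] \<alpha>_def[symmetric])
    have "F' *\<^sub>v w = F *\<^sub>v w - (1 / \<alpha>) \<cdot>\<^sub>v (a \<cdot>\<^sub>v p)"
      unfolding F'_eq using dims wd pd u uw by (simp add: mat_vec_simps)
    also have "F *\<^sub>v w = (F *\<^sub>v (G *\<^sub>v y) - g \<cdot>\<^sub>v s) + (a / \<alpha>) \<cdot>\<^sub>v (F *\<^sub>v (A *\<^sub>v u))"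
      unfolding w using dims u y FGu by (simp add: mat_vec_simps)
    also have "F *\<^sub>v (A *\<^sub>v u) = p + sqrt \<alpha> \<cdot>\<^sub>v s"
      unfolding p_def v_def using dims s by (intro eq_vecI) auto
    also have "(F *\<^sub>v (G *\<^sub>v y) - g \<cdot>\<^sub>v s) + (a / \<alpha>) \<cdot>\<^sub>v (p + sqrt \<alpha> \<cdot>\<^sub>v s) - (1 / \<alpha>) \<cdot>\<^sub>v (a \<cdot>\<^sub>v p)
        = F *\<^sub>v (G *\<^sub>v y) + k \<cdot>\<^sub>v s"
    proof (rule eq_vecI)
      fix i assume "i < dim_vec (F *\<^sub>v (G *\<^sub>v y) + k \<cdot>\<^sub>v s)"
      then have i: "i < d" using s dims by simp
      have "sqrt \<alpha> * sqrt \<alpha> = \<alpha>" using \<alpha> by simp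
      then have "(a / \<alpha>) * sqrt \<alpha> = a / sqrt \<alpha>" using \<alpha> by (simp add: field_simps)
      then have k: "k * s $ i = (a / \<alpha>) * (sqrt \<alpha> * s $ i) - g * s $ i"
        by (simp add: k_def left_diff_distrib flip: mult.assoc)
      have "((F *\<^sub>v (G *\<^sub>v y) - g \<cdot>\<^sub>v s) + (a / \<alpha>) \<cdot>\<^sub>v (p + sqrt \<alpha> \<cdot>\<^sub>v s) - (1 / \<alpha>) \<cdot>\<^sub>v (a \<cdot>\<^sub>v p)) $ i
        = (F *\<^sub>v (G *\<^sub>v y)) $ i - g * s $ i + (a / \<alpha>) * (p $ i + sqrt \<alpha> * s $ i) - (1 / \<alpha>) * (a * p $ i)"
        using i s pd dims by simp
      also have "\<dots> = (F *\<^sub>v (G *\<^sub>v y)) $ i + k * s $ i"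
        unfolding k by (simp add: algebra_simps)
      finally show "((F *\<^sub>v (G *\<^sub>v y) - g \<cdot>\<^sub>v s) + (a / \<alpha>) \<cdot>\<^sub>v (p + sqrt \<alpha> \<cdot>\<^sub>v s) - (1 / \<alpha>) \<cdot>\<^sub>v (a \<cdot>\<^sub>v p)) $ i
          = (F *\<^sub>v (G *\<^sub>v y) + k \<cdot>\<^sub>v s) $ i" using i s dims by simp
    qed (use s pd dims in simp)
    finally have z: "F' *\<^sub>v w = F *\<^sub>v (G *\<^sub>v y) + k \<cdot>\<^sub>v s" .
    let ?z = "F *\<^sub>v (G *\<^sub>v y) + k \<cdot>\<^sub>v s"
    have zd: "dim_vec ?z = d" using s dims by simp
    have Fz: "transpose_mat F *\<^sub>v ?z = y + k \<cdot>\<^sub>v u"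
      using dims s y Ft[OF y] by (simp add: mat_vec_simps u_def)
    have "v \<bullet> ?z = sqrt \<alpha> * (g + k)"
    proof -
      have "s \<bullet> (F *\<^sub>v (G *\<^sub>v y)) = u \<bullet> (G *\<^sub>v y)"
        unfolding u_def using transpose_vec_mult_scalar[OF F _ carrier_vecI[OF s(1)], of "G *\<^sub>v y"]
        using dims by (metis carrier_vecI dim_mult_mat_vec)
      then show ?thesis unfolding v_def using s dims by (simp add: mat_vec_simps g_def algebra_simps)
    qed
    also have "\<dots> = a" using \<alpha> by (simp add: k_def)
    finally have vz: "v \<bullet> ?z = a" .
    have "(F *\<^sub>v (A *\<^sub>v u)) \<bullet> ?z = (A *\<^sub>v u) \<bullet> (y + k \<cdot>\<^sub>v u)"
      using adj[of "A *\<^sub>v u" ?z] zd dims Fz by simp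
    also have "\<dots> = a + k * \<alpha>"
      using dims u y Auy scalar_prod_comm[of "A *\<^sub>v u" u] by (simp add: mat_vec_simps \<alpha>_def)
    \<comment> \<open>This is the value for which the rank one term of the transposed factor cancels
      the summand k u of F^T applied to \<open>?z\<close>.\<close>
    finally have pz: "p \<bullet> ?z = k * \<alpha>"
      unfolding p_def using dims s zd vd vz by (simp add: scalar_prod_minus_l)
    have "transpose_mat F' *\<^sub>v ?z = transpose_mat F *\<^sub>v ?z - (1 / \<alpha>) \<cdot>\<^sub>v ((k * \<alpha>) \<cdot>\<^sub>v u)"
    proof -
      have "transpose_mat F' *\<^sub>v ?z = transpose_mat F *\<^sub>v ?z - ((1 / \<alpha>) \<cdot>\<^sub>m outer_prod u p) *\<^sub>v ?z"
        unfolding F't_eq by (rule mult_mat_vec_minus_l) (use dims pd u zd in simp_all)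
      moreover have "((1 / \<alpha>) \<cdot>\<^sub>m outer_prod u p) *\<^sub>v ?z = (1 / \<alpha>) \<cdot>\<^sub>v ((k * \<alpha>) \<cdot>\<^sub>v u)"
      proof -
        have "((1 / \<alpha>) \<cdot>\<^sub>m outer_prod u p) *\<^sub>v ?z = (1 / \<alpha>) \<cdot>\<^sub>v (outer_prod u p *\<^sub>v ?z)"
          by (rule mult_mat_vec_smult_l) (use pd zd in simp)
        also have "outer_prod u p *\<^sub>v ?z = (p \<bullet> ?z) \<cdot>\<^sub>v u"
          by (rule outer_prod_mult_vec) (use pd zd in simp)
        finally show ?thesis unfolding pz .
      qed
      ultimately show ?thesis by simp
    qed
    also have "\<dots> = y" unfolding Fz using y u \<alpha> by (intro eq_vecI) auto
    finally have "transpose_mat F' *\<^sub>v (F' *\<^sub>v w) = y" unfolding z .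
    moreover have "dim_row (BFGS_update G A u) = d" "dim_col (BFGS_update G A u) = d"
      using psd_dims[OF deflate_psd(1)[OF pd_imp_psd[OF G] u]] dims
      by (simp_all add: BFGS_update_eq[OF c u])
    moreover have "dim_row F' = d" "dim_col F' = d" using F'c by auto
    ultimately show ?thesis using y by (simp add: mat_vec_simps w_def)
  qed
  moreover have "BFGS_update G A u \<in> carrier_mat d d"
    using deflate_psd(1)[OF pd_imp_psd[OF G] u] dims unfolding BFGS_update_eq[OF c u] psd_def by auto
  ultimately show "transpose_mat F' * F' * BFGS_update G A u = 1\<^sub>m d"
    using F'c by (intro mat_eqI_vec[of _ d]) auto
qed

section \<open>Newton decrement under approximate Newton steps\<close>

lemma vnorm_nonneg [simp]: "0 \<le> vnorm v"
  by (simp add: vnorm_def scalar_prod_self_nonneg)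

lemma vnorm_smult: "vnorm (c \<cdot>\<^sub>v v) = \<bar>c\<bar> * vnorm v"
  by (simp add: vnorm_def real_sqrt_mult mult.assoc[symmetric])

lemma scalar_prod_le_vnorm:
  assumes "dim_vec x = d" "dim_vec y = d"
  shows "\<bar>x \<bullet> y\<bar> \<le> vnorm x * vnorm y"
proof -
  have I: "psd d (1\<^sub>m d)" unfolding psd_def by (auto intro: scalar_prod_self_nonneg)
  have "(x \<bullet> y)\<^sup>2 \<le> (x \<bullet> x) * (y \<bullet> y)"
    using psd_Cauchy_Schwarz[OF I assms] assms by (simp add: one_mult_vec)
  then have "sqrt ((x \<bullet> y)\<^sup>2) \<le> sqrt ((x \<bullet> x) * (y \<bullet> y))" by (rule real_sqrt_le_mono)
  then show ?thesis by (simp add: vnorm_def real_sqrt_mult)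
qed

section \<open>The objective function and one approximate Newton step\<close>

locale objective =
  fixes d :: nat and f :: "real vec \<Rightarrow> real" and M \<mu> L :: real
  assumes d2: "2 \<le> d" and M: "0 < M" and \<mu>: "0 < \<mu>" and L: "0 < L"
    and diff: "twice_differentiable d f" and ssc: "strongly_self_concordant d M f"
    and convex: "strongly_convex d \<mu> f" and smth: "smooth d L f"
begin

abbreviation "H \<equiv> hess d f"
abbreviation "g \<equiv> grad d f"
abbreviation "nd \<equiv> newton_decrement d f"

lemma hess_jacobian: "x \<in> carrier_vec d \<Longrightarrow> has_jacobian d g x (H x)"
  using diff someI_ex[of "has_jacobian d g x"] unfolding twice_differentiable_def hess_def by simp

lemma grad_carrier:
  assumes "x \<in> carrier_vec d"
  shows "g x \<in> carrier_vec d"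
proof -
  have "has_gradient d f x (g x)"
    using diff assms someI_ex[of "has_gradient d f x"] unfolding twice_differentiable_def grad_def by simp
  then show ?thesis by (simp add: has_gradient_def)
qed

lemma hess_lower: "x \<in> carrier_vec d \<Longrightarrow> loewner_le d (\<mu> \<cdot>\<^sub>m 1\<^sub>m d) (H x)"
  using convex by (simp add: strongly_convex_def)

lemma hess_upper: "x \<in> carrier_vec d \<Longrightarrow> loewner_le d (H x) (L \<cdot>\<^sub>m 1\<^sub>m d)"
  using smth by (simp add: smooth_def)

lemma scaled_one_pd: "0 < c \<Longrightarrow> pd d (c \<cdot>\<^sub>m 1\<^sub>m d)"
  unfolding pd_def
proof (intro conjI ballI impI)
  fix h :: "real vec" assume c: "0 < c" and h: "h \<in> carrier_vec d" "h \<noteq> 0\<^sub>v d"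
  then show "0 < h \<bullet> (c \<cdot>\<^sub>m 1\<^sub>m d *\<^sub>v h)"
    using scalar_prod_self_pos[of h d] carrier_vecD[OF h(1)] by (simp add: mat_vec_simps)
qed (auto simp: transpose_smult)

lemma hess_pd: "x \<in> carrier_vec d \<Longrightarrow> pd d (H x)"
  by (rule pd_of_loewner[OF scaled_one_pd[OF \<mu>] hess_lower])

lemma hess_dims: "x \<in> carrier_vec d \<Longrightarrow> dim_row (H x) = d \<and> dim_col (H x) = d"
  using psd_dims[OF pd_imp_psd[OF hess_pd]] by simp

lemma hess_bounds:
  assumes "x \<in> carrier_vec d" "dim_vec h = d"
  shows "\<mu> * (h \<bullet> h) \<le> h \<bullet> (H x *\<^sub>v h)" "h \<bullet> (H x *\<^sub>v h) \<le> L * (h \<bullet> h)"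
  using loewnerD[OF hess_lower[OF assms(1)] assms(2)] loewnerD[OF hess_upper[OF assms(1)] assms(2)] assms(2)
  by (simp_all add: mat_vec_simps)

lemma \<mu>_le_L: "\<mu> \<le> L"
proof -
  have "\<mu> * (unit_vec d 0 \<bullet> unit_vec d 0) \<le> L * (unit_vec d 0 \<bullet> unit_vec d 0)"
    using hess_bounds[of "0\<^sub>v d" "unit_vec d 0"] by simp
  then show ?thesis using d2 by (simp add: scalar_prod_right_unit)
qed

lemma local_norm_nonneg [simp]: "x \<in> carrier_vec d \<Longrightarrow> dim_vec h = d \<Longrightarrow> 0 \<le> local_norm d f x h"
  by (simp add: local_norm_def psdD[OF pd_imp_psd[OF hess_pd]])

lemma local_norm_smult:
  assumes "x \<in> carrier_vec d" "dim_vec h = d"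
  shows "local_norm d f x (c \<cdot>\<^sub>v h) = \<bar>c\<bar> * local_norm d f x h"
  using assms hess_dims[OF assms(1)]
  by (simp add: local_norm_def mat_vec_simps real_sqrt_mult flip: mult.assoc)

lemma hess_compare:
  assumes "x \<in> carrier_vec d" "y \<in> carrier_vec d" "z \<in> carrier_vec d" "w \<in> carrier_vec d" "dim_vec h = d"
  shows "h \<bullet> (H y *\<^sub>v h) \<le> h \<bullet> (H x *\<^sub>v h) + M * local_norm d f z (y - x) * (h \<bullet> (H w *\<^sub>v h))"
proof -
  have "h \<bullet> ((H y - H x) *\<^sub>v h) \<le> h \<bullet> (((M * local_norm d f z (y - x)) \<cdot>\<^sub>m H w) *\<^sub>v h)"
    using ssc assms(1-4) unfolding strongly_self_concordant_def by (intro loewnerD[OF _ assms(5)]) blast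
  then show ?thesis using hess_dims assms by (simp add: mat_vec_simps)
qed

text \<open>For fixed w the map t |-> w . g (x + t h) is a real function of one variable,
  differentiable because the gradient has a Jacobian everywhere. The intermediate t depends on
  w.\<close>

lemma grad_mean_value:
  assumes x: "x \<in> carrier_vec d" and h: "h \<in> carrier_vec d" and w: "w \<in> carrier_vec d"
  shows "\<exists>t\<in>{0<..<1}. w \<bullet> g (x + h) - w \<bullet> g x = w \<bullet> (H (x + t \<cdot>\<^sub>v h) *\<^sub>v h)"
proof -
  define \<phi> where "\<phi> t = w \<bullet> g (x + t \<cdot>\<^sub>v h)" for t
  have hd: "dim_vec h = d" and xd: "dim_vec x = d" and wd: "dim_vec w = d" using h x w by auto
  have der: "(\<phi> has_real_derivative w \<bullet> (H (x + t \<cdot>\<^sub>v h) *\<^sub>v h)) (at t)" for t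
  proof -
    define y where "y = x + t \<cdot>\<^sub>v h"
    have y: "y \<in> carrier_vec d" using x h by (simp add: y_def)
    have gd: "dim_vec (g z) = d" if "z \<in> carrier_vec d" for z using grad_carrier[OF that] by auto
    have "(\<phi> has_derivative (\<lambda>s. (w \<bullet> (H y *\<^sub>v h)) * s)) (at t)"
      unfolding has_derivative_at_alt
    proof (intro conjI allI impI)
      show "bounded_linear ((*) (w \<bullet> (H y *\<^sub>v h)))" by (rule bounded_linear_mult_right)
      fix e :: real assume e: "0 < e"
      \<comment> \<open>The summand 1, here and in the radius
        \<open>\<delta> / (vnorm h + 1)\<close>, keeps the denominators positive when h or w is
        zero.\<close>
      define K where "K = vnorm w * vnorm h + 1"
      have K: "K > 0" unfolding K_def by (simp add: add_nonneg_pos)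
      obtain \<delta> where \<delta>: "\<delta> > 0" and lin: "\<And>k. k \<in> carrier_vec d \<Longrightarrow> vnorm k < \<delta> \<Longrightarrow>
          vnorm (g (y + k) - g y - H y *\<^sub>v k) \<le> e / K * vnorm k"
        using hess_jacobian[OF y] e K unfolding has_jacobian_def by (metis divide_pos_pos)
      show "\<exists>\<delta>>0. \<forall>s. norm (s - t) < \<delta> \<longrightarrow>
          norm (\<phi> s - \<phi> t - w \<bullet> (H y *\<^sub>v h) * (s - t)) \<le> e * norm (s - t)"
      proof (intro exI[of _ "\<delta> / (vnorm h + 1)"] conjI allI impI)
        have h1: "vnorm h + 1 > 0" by (simp add: add_nonneg_pos)
        then show "\<delta> / (vnorm h + 1) > 0" using \<delta> by simp
        fix s assume s: "norm (s - t) < \<delta> / (vnorm h + 1)"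
        let ?k = "(s - t) \<cdot>\<^sub>v h"
        have k: "?k \<in> carrier_vec d" using h by simp
        have "vnorm ?k \<le> \<bar>s - t\<bar> * (vnorm h + 1)" unfolding vnorm_smult by (intro mult_left_mono) auto
        also have "\<dots> < \<delta>" using s h1 by (simp add: pos_less_divide_eq)
        finally have b: "vnorm (g (y + ?k) - g y - H y *\<^sub>v ?k) \<le> e / K * vnorm ?k" by (rule lin[OF k])
        have yk: "y + ?k = x + s \<cdot>\<^sub>v h"
          unfolding y_def using xd hd by (intro eq_vecI) (auto simp: algebra_simps)
        have "\<phi> s - \<phi> t - w \<bullet> (H y *\<^sub>v h) * (s - t) = w \<bullet> (g (y + ?k) - g y - H y *\<^sub>v ?k)"
          unfolding \<phi>_def yk[symmetric] unfolding y_def[symmetric]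
          using gd[of y] gd[of "y + ?k"] y k hess_dims[OF y] wd hd by (simp add: mat_vec_simps)
        also have "\<bar>\<dots>\<bar> \<le> vnorm w * (e / K * vnorm ?k)"
          using scalar_prod_le_vnorm[OF wd, of "g (y + ?k) - g y - H y *\<^sub>v ?k"] b hess_dims[OF y]
          by (smt (verit) mult_left_mono vnorm_nonneg index_minus_vec(2) dim_mult_mat_vec)
        also have "\<dots> = e * \<bar>s - t\<bar> * ((vnorm w * vnorm h) / K)"
          unfolding vnorm_smult by simp
        also have "\<dots> \<le> e * \<bar>s - t\<bar> * 1"
          using e K unfolding K_def by (intro mult_left_mono) auto
        finally show "norm (\<phi> s - \<phi> t - w \<bullet> (H y *\<^sub>v h) * (s - t)) \<le> e * norm (s - t)" by simp
      qed
    qed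
    then show ?thesis unfolding has_field_derivative_def y_def .
  qed
  have "\<exists>t>0. t < 1 \<and> \<phi> 1 - \<phi> 0 = (1 - 0) * (w \<bullet> (H (x + t \<cdot>\<^sub>v h) *\<^sub>v h))"
    by (rule MVT2) (use der in auto)
  moreover have "x + 1 \<cdot>\<^sub>v h = x + h" by simp
  moreover have "x + 0 \<cdot>\<^sub>v h = x" using xd hd by (intro eq_vecI) auto
  ultimately show ?thesis by (auto simp: \<phi>_def)
qed

lemma nd_nonneg: "x \<in> carrier_vec d \<Longrightarrow> 0 \<le> nd x"
  unfolding newton_decrement_def
  using psdD[OF pd_imp_psd[OF pd_minv_pd[OF hess_pd]]] grad_carrier by auto

lemma nd_sq: "x \<in> carrier_vec d \<Longrightarrow> (nd x)\<^sup>2 = g x \<bullet> (minv (H x) *\<^sub>v g x)"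
  unfolding newton_decrement_def
  using psdD[OF pd_imp_psd[OF pd_minv_pd[OF hess_pd]], of x "g x"] carrier_vecD[OF grad_carrier, of x] by simp

context
  fixes x :: "real vec" and G :: "real mat"
  assumes x: "x \<in> carrier_vec d" and HG: "loewner_le d (H x) G"
begin

definition next_pt :: "real vec" where "next_pt = x - minv G *\<^sub>v g x"

lemma G_pd: "pd d G" by (rule pd_of_loewner[OF hess_pd[OF x] HG])

lemma next_pt_carrier: "next_pt \<in> carrier_vec d"
  unfolding next_pt_def using x grad_carrier[OF x] pd_minv[OF G_pd] by auto

lemma next_pt_diff: "next_pt - x = (- 1) \<cdot>\<^sub>v (minv G *\<^sub>v g x)"
  unfolding next_pt_def using x pd_minv[OF G_pd] by (intro eq_vecI) auto

text \<open>For p = G^-1 g the bound H <= G is used twice: p^T H p <= p^T G p = g^T G^-1 g <= g^T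
  H^-1 g.\<close>

lemma step_length_le: "local_norm d f x (next_pt - x) \<le> nd x"
proof -
  let ?p = "minv G *\<^sub>v g x"
  have gd: "dim_vec (g x) = d" using grad_carrier[OF x] by auto
  have pd: "dim_vec ?p = d" using pd_minv[OF G_pd] by auto
  have "?p \<bullet> (H x *\<^sub>v ?p) \<le> ?p \<bullet> (G *\<^sub>v ?p)" by (rule loewnerD[OF HG pd])
  also have "\<dots> = g x \<bullet> (minv G *\<^sub>v g x)"
    using pd_minv_cancel(1)[OF G_pd gd] scalar_prod_comm[of ?p "g x"] pd gd by simp
  also have "\<dots> \<le> 1 * (g x \<bullet> (minv (H x) *\<^sub>v g x))"
    using loewnerD[OF HG] carrier_vecD
    by (intro minv_antimono[OF hess_pd[OF x] G_pd _ _ grad_carrier[OF x]]) auto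
  finally have "?p \<bullet> (H x *\<^sub>v ?p) \<le> g x \<bullet> (minv (H x) *\<^sub>v g x)" by simp
  then have "local_norm d f x ?p \<le> nd x"
    unfolding local_norm_def newton_decrement_def by (rule real_sqrt_le_mono)
  then show ?thesis unfolding next_pt_diff using local_norm_smult[OF x pd, of "-1"] by simp
qed

text \<open>Strong self-concordance with the reference Hessian at an end point of the step: at
  \<open>x\<close> for the first and third bound, at \<open>next_pt\<close> for the second.
  Measuring the step at \<open>x\<close> in all three makes the factor the one by which the method
  scales.\<close>

lemma hess_next:
  assumes "dim_vec h = d"
  defines "s \<equiv> M * local_norm d f x (next_pt - x)"
  shows "h \<bullet> (H next_pt *\<^sub>v h) \<le> (1 + s) * (h \<bullet> (H x *\<^sub>v h))"
    "h \<bullet> (H x *\<^sub>v h) \<le> (1 + s) * (h \<bullet> (H next_pt *\<^sub>v h))"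
    "(1 - s) * (h \<bullet> (H x *\<^sub>v h)) \<le> h \<bullet> (H next_pt *\<^sub>v h)"
proof -
  note y = next_pt_carrier
  have "x - next_pt = (- 1) \<cdot>\<^sub>v (next_pt - x)" using x y by (intro eq_vecI) auto
  then have sym: "local_norm d f x (x - next_pt) = local_norm d f x (next_pt - x)"
    using local_norm_smult[OF x, of "next_pt - x" "-1"] x y by simp
  show "h \<bullet> (H next_pt *\<^sub>v h) \<le> (1 + s) * (h \<bullet> (H x *\<^sub>v h))"
    using hess_compare[OF x y x x assms(1)] by (simp add: s_def distrib_right)
  show "h \<bullet> (H x *\<^sub>v h) \<le> (1 + s) * (h \<bullet> (H next_pt *\<^sub>v h))"
    using hess_compare[OF y x x y assms(1)] by (simp add: s_def sym distrib_right)
  show "(1 - s) * (h \<bullet> (H x *\<^sub>v h)) \<le> h \<bullet> (H next_pt *\<^sub>v h)"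
    using hess_compare[OF y x x x assms(1)] by (simp add: s_def sym left_diff_distrib)
qed

text \<open>With y the next point and w = H(y)^-1 g(y), the number w . g(y) is the square of the new
  decrement. The mean value theorem and the step -G^-1 g(x) turn it into (J w) . (J^-1 - G^-1) g(x).
  The difference of inverses lies between -s J^-1 and (1 - 1/(\<eta> (1 + s))) J^-1, so the
  two-sided Cauchy-Schwarz inequality in the form J^-1 applies.\<close>

lemma nd_next:
  assumes Gu: "loewner_le d G (\<eta> \<cdot>\<^sub>m H x)" and \<eta>: "0 < \<eta>" and s: "M * nd x \<le> s"
  shows "nd next_pt \<le> (1 + s) * max s (1 - 1 / (\<eta> * (1 + s))) * nd x"
proof -
  let ?y = "next_pt" and ?p = "minv G *\<^sub>v g x"
  define h where "h = ?y - x"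
  define w where "w = minv (H ?y) *\<^sub>v g ?y"
  note y = next_pt_carrier
  have gd: "dim_vec (g x) = d" "dim_vec (g ?y) = d" using grad_carrier x y by auto
  have pd: "dim_vec ?p = d" using pd_minv[OF G_pd] by auto
  have h: "h \<in> carrier_vec d" using x y by (simp add: h_def)
  have w: "w \<in> carrier_vec d" unfolding w_def using pd_minv_dims[OF hess_pd[OF y]] by (intro carrier_vecI) simp
  have xh: "x + h = ?y" unfolding h_def using x y by (intro eq_vecI) auto
  have s0: "0 \<le> s" using s M nd_nonneg[OF x] by (smt (verit) mult_nonneg_nonneg)
  obtain t where t: "t \<in> {0<..<1}" and mv: "w \<bullet> g ?y - w \<bullet> g x = w \<bullet> (H (x + t \<cdot>\<^sub>v h) *\<^sub>v h)"
    using grad_mean_value[OF x h w] unfolding xh by blast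
  define \<xi> where "\<xi> = x + t \<cdot>\<^sub>v h"
  have \<xi>: "\<xi> \<in> carrier_vec d" using x h by (simp add: \<xi>_def)
  define J where "J = H \<xi>"
  have J: "pd d J" unfolding J_def by (rule hess_pd[OF \<xi>])
  have Jc: "J \<in> carrier_mat d d" "transpose_mat J = J" using J by (auto simp: pd_def)
  have hr: "M * local_norm d f x h \<le> s"
    using step_length_le s M unfolding h_def by (smt (verit) mult_left_mono)
  have near: "M * local_norm d f x (c \<cdot>\<^sub>v h) \<le> s" if "\<bar>c\<bar> \<le> 1" for c
  proof -
    have "\<bar>c\<bar> * local_norm d f x h \<le> 1 * local_norm d f x h"
      using that local_norm_nonneg[OF x, of h] carrier_vecD[OF h] by (intro mult_right_mono) auto
    then show ?thesis using hr M local_norm_smult[OF x, of h c] carrier_vecD[OF h]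
      by (smt (verit) mult_left_mono)
  qed
  have d1: "\<xi> - x = t \<cdot>\<^sub>v h" "x - \<xi> = (- t) \<cdot>\<^sub>v h" "\<xi> - ?y = (t - 1) \<cdot>\<^sub>v h"
    unfolding \<xi>_def xh[symmetric] using x h by (auto intro!: eq_vecI simp: algebra_simps)
  \<comment> \<open>The points x, \<open>\<xi>\<close> and \<open>?y\<close> lie on one segment, so
    all their differences are multiples of h by at most 1 in absolute value, and the bound s on the
    whole step serves for each pair.\<close>
  have cmp: "v \<bullet> (H a *\<^sub>v v) \<le> (1 + s) * (v \<bullet> (H b *\<^sub>v v))"
    if ab: "a \<in> carrier_vec d" "b \<in> carrier_vec d" "a - b = c \<cdot>\<^sub>v h" "\<bar>c\<bar> \<le> 1" and v: "dim_vec v = d" for a b c v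
  proof -
    have "M * local_norm d f x (a - b) * (v \<bullet> (H b *\<^sub>v v)) \<le> s * (v \<bullet> (H b *\<^sub>v v))"
      unfolding ab(3) by (rule mult_right_mono[OF near[OF ab(4)] psdD[OF pd_imp_psd[OF hess_pd[OF ab(2)]] v]])
    then show ?thesis using hess_compare[OF ab(2,1) x ab(2) v] by (simp add: distrib_right)
  qed
  have Jx: "v \<bullet> (J *\<^sub>v v) \<le> (1 + s) * (v \<bullet> (H x *\<^sub>v v))" "v \<bullet> (H x *\<^sub>v v) \<le> (1 + s) * (v \<bullet> (J *\<^sub>v v))"
    "v \<bullet> (J *\<^sub>v v) \<le> (1 + s) * (v \<bullet> (H ?y *\<^sub>v v))" if "dim_vec v = d" for v
    unfolding J_def using cmp[OF \<xi> x d1(1) _ that] cmp[OF x \<xi> d1(2) _ that] cmp[OF \<xi> y d1(3) _ that] t by auto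
  define c where "c = max s (1 - 1 / (\<eta> * (1 + s)))"
  have c0: "0 \<le> c" using s0 by (simp add: c_def)
  let ?Ji = "minv J" and ?Gi = "minv G"
  have Ji: "pd d ?Ji" and Gi: "pd d ?Gi" using J G_pd by (auto intro: pd_minv_pd)
  have Jid: "dim_row ?Ji = d" "dim_col ?Ji = d" "dim_row ?Gi = d" "dim_col ?Gi = d"
    using psd_dims[OF pd_imp_psd[OF Ji]] psd_dims[OF pd_imp_psd[OF Gi]] by auto
  define B where "B = ?Ji - ?Gi"
  have Bc: "B \<in> carrier_mat d d" "transpose_mat B = B"
    using Ji Gi unfolding B_def pd_def by (auto simp: transpose_minus)
  \<comment> \<open>J <= (1 + s) H(x) <= (1 + s) G and G <= \<eta> H(x) <= \<eta> (1 + s) J; taking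
    inverses reverses both.\<close>
  have Bb: "\<bar>v \<bullet> (B *\<^sub>v v)\<bar> \<le> c * (v \<bullet> (?Ji *\<^sub>v v))" if v: "v \<in> carrier_vec d" for v
  proof -
    have vd: "dim_vec v = d" using v by simp
    define a b where "a = v \<bullet> (?Ji *\<^sub>v v)" and "b = v \<bullet> (?Gi *\<^sub>v v)"
    have B: "v \<bullet> (B *\<^sub>v v) = a - b" unfolding B_def a_def b_def using Jid vd by (simp add: mat_vec_simps)
    have a0: "0 \<le> a" unfolding a_def by (rule psdD[OF pd_imp_psd[OF Ji] vd])
    have "b \<le> (1 + s) * a" unfolding a_def b_def
    proof (rule minv_antimono[OF J G_pd _ _ v])
      show "u \<bullet> (J *\<^sub>v u) \<le> (1 + s) * (u \<bullet> (G *\<^sub>v u))" if "u \<in> carrier_vec d" for u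
        using Jx(1)[of u] loewnerD[OF HG, of u] that s0 carrier_vecD[OF that] by (smt (verit) mult_left_mono)
    qed (use s0 in simp)
    moreover
    have "a \<le> (\<eta> * (1 + s)) * b" unfolding a_def b_def
    proof (rule minv_antimono[OF G_pd J _ _ v])
      show "u \<bullet> (G *\<^sub>v u) \<le> \<eta> * (1 + s) * (u \<bullet> (J *\<^sub>v u))" if "u \<in> carrier_vec d" for u
      proof -
        have "u \<bullet> (G *\<^sub>v u) \<le> \<eta> * (u \<bullet> (H x *\<^sub>v u))"
          using loewnerD[OF Gu, of u] carrier_vecD[OF that] hess_dims[OF x] by (simp add: mat_vec_simps)
        also have "\<dots> \<le> \<eta> * ((1 + s) * (u \<bullet> (J *\<^sub>v u)))"
          using Jx(2)[of u] carrier_vecD[OF that] \<eta> by (intro mult_left_mono) auto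
        finally show ?thesis by simp
      qed
    qed (use s0 \<eta> in simp)
    then have "a / (\<eta> * (1 + s)) \<le> b"
      using s0 \<eta> by (simp add: pos_divide_le_eq mult.commute)
    ultimately have "a - b \<le> (1 - 1 / (\<eta> * (1 + s))) * a" "b - a \<le> s * a"
      by (simp_all add: algebra_simps)
    moreover have "(1 - 1 / (\<eta> * (1 + s))) * a \<le> c * a" "s * a \<le> c * a"
      using a0 by (auto intro: mult_right_mono simp: c_def)
    ultimately show ?thesis unfolding B a_def[symmetric] by linarith
  qed
  have Jw: "dim_vec (J *\<^sub>v w) = d" using Jc by simp
  have wd: "dim_vec w = d" using w by simp
  have hp: "h = (- 1) \<cdot>\<^sub>v ?p" unfolding h_def by (rule next_pt_diff)
  have "w \<bullet> g ?y = w \<bullet> g x + w \<bullet> (J *\<^sub>v h)" using mv unfolding J_def \<xi>_def by simp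
  also have "w \<bullet> (J *\<^sub>v h) = - (w \<bullet> (J *\<^sub>v ?p))"
    unfolding hp using Jc pd wd by (simp add: mat_vec_simps)
  also have "w \<bullet> g x = w \<bullet> (J *\<^sub>v (?Ji *\<^sub>v g x))" using pd_minv_cancel(1)[OF J gd(1)] by simp
  also have "w \<bullet> (J *\<^sub>v (?Ji *\<^sub>v g x)) = (?Ji *\<^sub>v g x) \<bullet> (J *\<^sub>v w)"
    by (rule sym_bilinear[OF Jc wd]) (simp add: Jid)
  also have "w \<bullet> (J *\<^sub>v ?p) = ?p \<bullet> (J *\<^sub>v w)" by (rule sym_bilinear[OF Jc wd pd])
  also have "(?Ji *\<^sub>v g x) \<bullet> (J *\<^sub>v w) + - (?p \<bullet> (J *\<^sub>v w)) = (B *\<^sub>v g x) \<bullet> (J *\<^sub>v w)"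
    unfolding B_def using Jid gd Jw by (simp add: mat_vec_simps)
  also have "\<dots> = (J *\<^sub>v w) \<bullet> (B *\<^sub>v g x)" by (rule scalar_prod_comm) (use Jc Bc in simp)
  also have "\<dots> \<le> c * (sqrt ((J *\<^sub>v w) \<bullet> (?Ji *\<^sub>v (J *\<^sub>v w))) * sqrt (g x \<bullet> (?Ji *\<^sub>v g x)))"
    using two_sided_Cauchy_Schwarz[OF pd_imp_psd[OF Ji] Bc Bb Jw gd(1) c0] by simp
  \<comment> \<open>Replacing J by the Hessian at y in the first norm and by the Hessian at x in the
    second costs a factor \<open>sqrt (1 + s)\<close> each; together they are the prefactor 1 + s of
    the claim.\<close>
  also have "\<dots> \<le> c * ((sqrt (1 + s) * nd ?y) * (sqrt (1 + s) * nd x))"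
  proof (intro mult_left_mono mult_mono c0)
    have "(J *\<^sub>v w) \<bullet> (?Ji *\<^sub>v (J *\<^sub>v w)) = w \<bullet> (J *\<^sub>v w)"
      using pd_minv_cancel(2)[OF J wd] scalar_prod_comm[of "J *\<^sub>v w" w] Jw wd by simp
    also have "\<dots> \<le> (1 + s) * (w \<bullet> (H ?y *\<^sub>v w))" by (rule Jx(3)[OF wd])
    also have "w \<bullet> (H ?y *\<^sub>v w) = (nd ?y)\<^sup>2"
    proof -
      have "H ?y *\<^sub>v w = g ?y" unfolding w_def by (rule pd_minv_cancel(1)[OF hess_pd[OF y] gd(2)])
      then show ?thesis using nd_sq[OF y] scalar_prod_comm[of w "g ?y"] wd gd by (simp add: w_def)
    qed
    finally have "sqrt ((J *\<^sub>v w) \<bullet> (?Ji *\<^sub>v (J *\<^sub>v w))) \<le> sqrt ((1 + s) * (nd ?y)\<^sup>2)" by (rule real_sqrt_le_mono)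
    then show "sqrt ((J *\<^sub>v w) \<bullet> (?Ji *\<^sub>v (J *\<^sub>v w))) \<le> sqrt (1 + s) * nd ?y"
      using nd_nonneg[OF y] by (simp add: real_sqrt_mult)
    have "g x \<bullet> (?Ji *\<^sub>v g x) \<le> (1 + s) * (g x \<bullet> (minv (H x) *\<^sub>v g x))"
      by (rule minv_antimono[OF hess_pd[OF x] J _ _ grad_carrier[OF x]]) (use Jx(2) s0 in auto)
    also have "\<dots> = (1 + s) * (nd x)\<^sup>2" using nd_sq[OF x] by simp
    finally have "sqrt (g x \<bullet> (?Ji *\<^sub>v g x)) \<le> sqrt ((1 + s) * (nd x)\<^sup>2)" by (rule real_sqrt_le_mono)
    then show "sqrt (g x \<bullet> (?Ji *\<^sub>v g x)) \<le> sqrt (1 + s) * nd x"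
      using nd_nonneg[OF x] by (simp add: real_sqrt_mult)
    show "0 \<le> sqrt (g x \<bullet> (?Ji *\<^sub>v g x))" using psdD[OF pd_imp_psd[OF Ji] gd(1)] by simp
    show "0 \<le> sqrt (1 + s) * nd ?y" using nd_nonneg[OF y] s0 by simp
  qed
  also have "\<dots> = nd ?y * ((sqrt (1 + s) * sqrt (1 + s)) * c * nd x)" by (simp only: mult_ac)
  also have "sqrt (1 + s) * sqrt (1 + s) = 1 + s" using s0 by simp
  finally have "w \<bullet> g ?y \<le> nd ?y * ((1 + s) * c * nd x)" .
  moreover have "w \<bullet> g ?y = nd ?y * nd ?y"
    using nd_sq[OF y] scalar_prod_comm[of w "g ?y"] wd gd by (simp add: w_def power2_eq_square)
  ultimately have "nd ?y * nd ?y \<le> nd ?y * ((1 + s) * c * nd x)" by simp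
  moreover have "0 \<le> (1 + s) * c * nd x" using s0 c0 nd_nonneg[OF x] by simp
  ultimately show ?thesis
    unfolding c_def[symmetric] using nd_nonneg[OF y]
    by (cases "nd ?y = 0") (auto simp: mult_le_cancel_left)
qed

end

end

section \<open>Invariants of a run\<close>

lemma tr_mono: "loewner_le d A B \<Longrightarrow> tr A \<le> tr B"
  using psd_tr_nonneg[of d "B - A"] loewner_iff_psd[of A d B] tr_minus[of B d A]
  by (auto simp: loewner_le_def)

lemma tr_mult_mono:
  assumes "loewner_le d P P'" "psd d Q"
  shows "tr (P * Q) \<le> tr (P' * Q)" "tr (Q * P) \<le> tr (Q * P')"
proof -
  have c: "P \<in> carrier_mat d d" "P' \<in> carrier_mat d d" "Q \<in> carrier_mat d d"
    using assms by (auto simp: loewner_le_def psd_def)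
  have "psd d (P' - P)" using assms(1) loewner_iff_psd[of P d P'] by (auto simp: loewner_le_def)
  then have "0 \<le> tr ((P' - P) * Q)" using assms(2) by (rule tr_mult_psd_nonneg)
  also have "(P' - P) * Q = P' * Q - P * Q" using c by (intro minus_mult_distrib_mat) auto
  also have "tr (P' * Q - P * Q) = tr (P' * Q) - tr (P * Q)" using c by (intro tr_minus[of _ d]) auto
  finally show "tr (P * Q) \<le> tr (P' * Q)" by simp
  then show "tr (Q * P) \<le> tr (Q * P')" using tr_mult_comm c by metis
qed

text \<open>As ln (3/2) <= 1/2, s <= 1/(8 \<kappa>). The second argument of the maximum then yields
  1 + s - 1/\<eta> <= 1 + 1/(8 \<kappa>) - 2/(3 \<kappa>) = 1 - 13/(24 \<kappa>), just enough; the
  first yields at most 9/64, while the target is at least 1/2.\<close>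

lemma contraction_factor:
  fixes s \<eta> \<kappa> :: real
  assumes \<kappa>: "1 \<le> \<kappa>" and s: "0 \<le> s" "s \<le> ln (3 / 2) / (4 * \<kappa>)" and \<eta>: "0 < \<eta>" "\<eta> \<le> 3 / 2 * \<kappa>"
  shows "(1 + s) * max s (1 - 1 / (\<eta> * (1 + s))) \<le> 1 - 1 / (2 * \<kappa>)"
proof -
  have "ln (3 / 2 :: real) \<le> 1 / 2" using ln_le_minus_one[of "3 / 2 :: real"] by simp
  then have "ln (3 / 2) / (4 * \<kappa>) \<le> (1 / 2) / (4 * \<kappa>)" using \<kappa> by (intro divide_right_mono) auto
  then have s8: "s \<le> 1 / (8 * \<kappa>)" using s by simp
  have "1 / (8 * \<kappa>) \<le> 1 / 8" using \<kappa> by (simp add: field_simps)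
  then have s1: "s \<le> 1 / 8" using s8 by simp
  have "(1 + s) * s \<le> (1 + 1 / 8) * (1 / 8)" using s s1 by (intro mult_mono) auto
  moreover have "1 / (2 * \<kappa>) \<le> 1 / 2" using \<kappa> by (simp add: field_simps)
  ultimately have 1: "(1 + s) * s \<le> 1 - 1 / (2 * \<kappa>)" by simp
  have "(1 + s) * (1 - 1 / (\<eta> * (1 + s))) = 1 + s - (1 + s) / (\<eta> * (1 + s))"
    by (simp add: right_diff_distrib)
  also have "(1 + s) / (\<eta> * (1 + s)) = 1 / \<eta>" using s by simp
  finally have "(1 + s) * (1 - 1 / (\<eta> * (1 + s))) = 1 + s - 1 / \<eta>" .
  moreover have "1 / (3 / 2 * \<kappa>) \<le> 1 / \<eta>" using \<eta> by (intro divide_left_mono) auto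
  moreover have "1 / (8 * \<kappa>) - 1 / (3 / 2 * \<kappa>) \<le> - (1 / (2 * \<kappa>))" using \<kappa> by (simp add: field_simps)
  ultimately have 2: "(1 + s) * (1 - 1 / (\<eta> * (1 + s))) \<le> 1 - 1 / (2 * \<kappa>)" using s8 by linarith
  show ?thesis using 1 2 by (simp add: max_def)
qed

lemma geometric_partial_sum_le:
  fixes q :: real
  assumes "0 \<le> q" "q < 1"
  shows "(\<Sum>i<k. q ^ i) \<le> 1 / (1 - q)"
  using assms by (simp add: sum_gp_strict divide_right_mono)

locale qn_problem = objective +
  fixes \<kappa> :: real and x0 :: "real vec" and rule :: qn_rule
  assumes \<kappa>: "\<kappa> = L / \<mu>" and x0: "x0 \<in> carrier_vec d" and start: "M * nd x0 \<le> ln (3 / 2) / (4 * \<kappa>)"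
begin

lemma \<kappa>_ge_1: "1 \<le> \<kappa>"
  using \<mu>_le_L \<mu> by (simp add: \<kappa>)

lemma d_kappa_ge_2: "2 \<le> real d * \<kappa>"
  using mult_mono[of 2 "real d" 1 \<kappa>] d2 \<kappa>_ge_1 by simp

definition rate :: real where "rate = 1 - 1 / (2 * \<kappa>)"

lemma rate: "1 / 2 \<le> rate" "rate < 1" "1 / (1 - rate) = 2 * \<kappa>"
  using \<kappa>_ge_1 by (auto simp: rate_def field_simps)

end

section \<open>Deterministic analysis of one trajectory\<close>

text \<open>Common ground of the greedy and random methods: the directions are only assumed to have
  length one. Greedy directions satisfy this always, random ones almost surely.\<close>

locale qn_trajectory = qn_problem +
  fixes F0 :: "real mat" and x :: "nat \<Rightarrow> real vec" and G F :: "nat \<Rightarrow> real mat" and s :: "nat \<Rightarrow> real vec"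
  assumes F0: "F0 \<in> carrier_mat d d" "transpose_mat F0 * F0 = minv (L \<cdot>\<^sub>m 1\<^sub>m d)"
    and run: "qn_run rule d f M x0 (L \<cdot>\<^sub>m 1\<^sub>m d) F0 x G F s"
    and unit: "\<And>k. s k \<in> carrier_vec d" "\<And>k. s k \<bullet> s k = 1"
begin

definition lam :: "nat \<Rightarrow> real" where "lam k = nd (x k)"
text \<open>The guaranteed ratio in H <= G <= eta H. It starts at \<kappa>, because L I <= \<kappa>
  H, and a step multiplies it by at most (1 + M lam)^2, which is bounded by an exponential so that
  the product becomes a sum.\<close>

definition eta :: "nat \<Rightarrow> real" where "eta k = \<kappa> * exp (2 * (\<Sum>i<k. M * lam i))"
definition c :: "nat \<Rightarrow> real" where "c k = qn_scale d f M x k"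
definition A :: "nat \<Rightarrow> real mat" where "A k = H (x (Suc k))"
definition Gt :: "nat \<Rightarrow> real mat" where "Gt k = c k \<cdot>\<^sub>m G k"
definition Ft :: "nat \<Rightarrow> real mat" where "Ft k = (1 / sqrt (c k)) \<cdot>\<^sub>m F k"

lemma init: "x 0 = x0" "G 0 = L \<cdot>\<^sub>m 1\<^sub>m d" "F 0 = F0"
  using run by (auto simp: qn_run_def)

lemma x_Suc: "x (Suc k) = next_pt (x k) (G k)" if "x k \<in> carrier_vec d" "loewner_le d (H (x k)) (G k)"
  using run by (simp add: qn_run_def next_pt_def[OF that])

lemma SR1_Suc: "rule = SR1 \<Longrightarrow> G (Suc k) = SR1_update (Gt k) (A k) (s k)"
  using run by (simp add: qn_run_def qn_update_def Let_def scaled_G_def Gt_def c_def A_def)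

lemma BFGS_Suc:
  fixes k
  assumes "rule = BFGS"
  defines "u \<equiv> transpose_mat (Ft k) *\<^sub>v s k"
  shows "G (Suc k) = BFGS_update (Gt k) (A k) u"
    and "F (Suc k) = Ft k - (1 / (u \<bullet> (A k *\<^sub>v u))) \<cdot>\<^sub>m
      outer_prod (Ft k *\<^sub>v (A k *\<^sub>v u) - (sqrt (u \<bullet> (A k *\<^sub>v u)) / vnorm (s k)) \<cdot>\<^sub>v s k) u"
  using run assms(1) unfolding u_def
  by (simp_all add: qn_run_def qn_update_def Let_def scaled_G_def scaled_F_def Gt_def Ft_def c_def A_def)

text \<open>The claims support each other and need a joint induction: linear decay of the decrements
  so far keeps \<open>eta\<close> below 3/2 \<kappa>, and this bound yields the next step of linear
  decay. The factor clause is conditional because an SR1 run leaves \<open>F\<close> arbitrary after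
  the start.\<close>

definition good :: "nat \<Rightarrow> bool" where
  "good k \<longleftrightarrow> x k \<in> carrier_vec d \<and> loewner_le d (H (x k)) (G k) \<and> loewner_le d (G k) (eta k \<cdot>\<^sub>m H (x k))
    \<and> (rule = BFGS \<longrightarrow> F k \<in> carrier_mat d d \<and> transpose_mat (F k) * F k * G k = 1\<^sub>m d)
    \<and> (\<forall>j\<le>k. 0 \<le> lam j \<and> lam j \<le> rate ^ j * lam 0)"

lemma good_0: "good 0"
proof -
  have x: "x 0 \<in> carrier_vec d" using init x0 by simp
  have "h \<bullet> (L \<cdot>\<^sub>m 1\<^sub>m d *\<^sub>v h) \<le> h \<bullet> (\<kappa> \<cdot>\<^sub>m H (x 0) *\<^sub>v h)" if "h \<in> carrier_vec d" for h
  proof -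
    have "\<kappa> * (\<mu> * (h \<bullet> h)) \<le> \<kappa> * (h \<bullet> (H (x 0) *\<^sub>v h))"
      using hess_bounds(1)[OF x, of h] \<kappa>_ge_1 that by (intro mult_left_mono) auto
    then show ?thesis using that hess_dims[OF x] \<mu> by (simp add: mat_vec_simps \<kappa>)
  qed
  then have "loewner_le d (G 0) (eta 0 \<cdot>\<^sub>m H (x 0))"
    using hess_pd[OF x] unfolding loewner_le_def init eta_def
    by (auto simp: pd_def transpose_smult)
  moreover have "transpose_mat F0 * F0 * (L \<cdot>\<^sub>m 1\<^sub>m d) = 1\<^sub>m d"
    unfolding F0 using pd_minv[OF scaled_one_pd[OF L]] by simp
  ultimately show ?thesis
    using x hess_upper[OF x] F0 nd_nonneg[OF x] by (simp add: good_def init lam_def)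
qed

lemma lam_small:
  assumes "good k" "j \<le> k"
  shows "0 \<le> M * lam j" "M * lam j \<le> ln (3 / 2) / (4 * \<kappa>)"
proof -
  have l: "0 \<le> lam j" "lam j \<le> rate ^ j * lam 0" "0 \<le> lam 0" using assms by (auto simp: good_def)
  then show "0 \<le> M * lam j" using M by simp
  have "rate ^ j * lam 0 \<le> 1 * lam 0" using rate l by (intro mult_right_mono power_le_one) auto
  then have "M * lam j \<le> M * lam 0" using l M by (intro mult_left_mono) auto
  then show "M * lam j \<le> ln (3 / 2) / (4 * \<kappa>)" using start by (simp add: lam_def init)
qed

text \<open>The geometric series with ratio 1 - 1/(2 \<kappa>) sums to 2 \<kappa>, which cancels
  against the 4 \<kappa> of the starting condition. The value ln (3/2) / 2 is what makes exp (2 *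
  sum) at most 3/2. Since the sum stops below j, knowledge up to k covers j = k + 1.\<close>

lemma sum_lam:
  assumes "good k" "j \<le> Suc k"
  shows "(\<Sum>i<j. M * lam i) \<le> ln (3 / 2) / 2"
proof -
  have l0: "0 \<le> lam 0" using assms(1) by (auto simp: good_def)
  have "(\<Sum>i<j. M * lam i) \<le> (\<Sum>i<j. (M * lam 0) * rate ^ i)"
    using assms M by (intro sum_mono) (auto simp: good_def mult.commute)
  also have "\<dots> = (M * lam 0) * (\<Sum>i<j. rate ^ i)" by (simp add: sum_distrib_left)
  also have "\<dots> \<le> (M * lam 0) * (2 * \<kappa>)"
    using geometric_partial_sum_le[of rate j] rate l0 M by (intro mult_left_mono) auto
  also have "\<dots> \<le> (ln (3 / 2) / (4 * \<kappa>)) * (2 * \<kappa>)"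
    using start \<kappa>_ge_1 by (intro mult_right_mono) (auto simp: lam_def init)
  also have "\<dots> = ln (3 / 2) / 2" using \<kappa>_ge_1 by simp
  finally show ?thesis .
qed

lemma eta_bounds:
  assumes "good k" "j \<le> Suc k"
  shows "\<kappa> \<le> eta j" "1 \<le> eta j" "eta j \<le> 3 / 2 * \<kappa>"
proof -
  have "exp (2 * (\<Sum>i<j. M * lam i)) \<le> exp (ln (3 / 2))" using sum_lam[OF assms] by (subst exp_le_cancel_iff) linarith
  also have "\<dots> = 3 / 2" by (subst exp_ln) auto
  finally have "\<kappa> * exp (2 * (\<Sum>i<j. M * lam i)) \<le> \<kappa> * (3 / 2)" using \<kappa>_ge_1 by (intro mult_left_mono) auto
  then show "eta j \<le> 3 / 2 * \<kappa>" by (simp add: eta_def)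
  have "0 \<le> M * lam i" if "i < j" for i using assms M that by (auto simp: good_def)
  then have "0 \<le> (\<Sum>i<j. M * lam i)" by (intro sum_nonneg) auto
  then have "\<kappa> * 1 \<le> \<kappa> * exp (2 * (\<Sum>i<j. M * lam i))" using \<kappa>_ge_1 by (intro mult_left_mono) auto
  then show "\<kappa> \<le> eta j" by (simp add: eta_def)
  then show "1 \<le> eta j" using \<kappa>_ge_1 by simp
qed

context
  fixes k
  assumes k: "good k"
begin

lemma x_carrier: "x k \<in> carrier_vec d" and hess_le_G: "loewner_le d (H (x k)) (G k)"
  and G_le_eta: "loewner_le d (G k) (eta k \<cdot>\<^sub>m H (x k))"
  and factor_inv: "rule = BFGS \<Longrightarrow> F k \<in> carrier_mat d d \<and> transpose_mat (F k) * F k * G k = 1\<^sub>m d"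
  using k unfolding good_def by blast+

lemma x_Suc_next: "x (Suc k) = next_pt (x k) (G k)" by (rule x_Suc[OF x_carrier hess_le_G])

lemma x_Suc_carrier: "x (Suc k) \<in> carrier_vec d"
  unfolding x_Suc_next by (rule next_pt_carrier[OF x_carrier hess_le_G])

lemma c_bounds: "1 \<le> c k" "c k \<le> 1 + M * lam k"
proof -
  have "dim_vec (x (Suc k) - x k) = d" using carrier_vecD[OF x_carrier] by simp
  then have "0 \<le> local_norm d f (x k) (x (Suc k) - x k)" by (rule local_norm_nonneg[OF x_carrier])
  then show "1 \<le> c k" using M by (simp add: c_def qn_scale_def)
  have "M * local_norm d f (x k) (x (Suc k) - x k) \<le> M * lam k"
    using step_length_le[OF x_carrier hess_le_G] M unfolding x_Suc_next lam_def by (intro mult_left_mono) auto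
  then show "c k \<le> 1 + M * lam k" by (simp add: c_def qn_scale_def)
qed

lemma A_pd: "pd d (A k)" unfolding A_def by (rule hess_pd[OF x_Suc_carrier])

lemma Gk_pd: "pd d (G k)" by (rule pd_of_loewner[OF hess_pd[OF x_carrier] hess_le_G])

lemma Gk_dims: "G k \<in> carrier_mat d d" "dim_row (G k) = d" "dim_col (G k) = d" "transpose_mat (G k) = G k"
  using Gk_pd by (auto simp: pd_def)

lemma A_dims: "A k \<in> carrier_mat d d" "dim_row (A k) = d" "dim_col (A k) = d" "transpose_mat (A k) = A k"
  using A_pd by (auto simp: pd_def)

lemma Gt_carrier: "Gt k \<in> carrier_mat d d" "transpose_mat (Gt k) = Gt k"
  using Gk_dims by (auto simp: Gt_def transpose_smult)

lemma Gt_quadratic: "dim_vec h = d \<Longrightarrow> h \<bullet> (Gt k *\<^sub>v h) = c k * (h \<bullet> (G k *\<^sub>v h))"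
  using Gk_dims by (simp add: Gt_def mat_vec_simps)

lemma A_compare:
  assumes "dim_vec h = d"
  shows "h \<bullet> (A k *\<^sub>v h) \<le> c k * (h \<bullet> (H (x k) *\<^sub>v h))" "h \<bullet> (H (x k) *\<^sub>v h) \<le> c k * (h \<bullet> (A k *\<^sub>v h))"
    "(2 - c k) * (h \<bullet> (H (x k) *\<^sub>v h)) \<le> h \<bullet> (A k *\<^sub>v h)"
  using hess_next[OF x_carrier hess_le_G assms] unfolding A_def c_def qn_scale_def x_Suc_next by (simp_all add: algebra_simps)

text \<open>The purpose of the scaling by 1 + M r: moving to the next point can raise the Hessian by
  at most this factor, so the scaled estimate dominates the new Hessian.\<close>

lemma A_le_Gt: "loewner_le d (A k) (Gt k)"
  unfolding loewner_le_def
proof (intro conjI ballI)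
  fix h :: "real vec" assume "h \<in> carrier_vec d"
  then have hd: "dim_vec h = d" by simp
  have "c k * (h \<bullet> (H (x k) *\<^sub>v h)) \<le> c k * (h \<bullet> (G k *\<^sub>v h))"
    using loewnerD[OF hess_le_G hd] c_bounds by (intro mult_left_mono) auto
  then show "h \<bullet> (A k *\<^sub>v h) \<le> h \<bullet> (Gt k *\<^sub>v h)"
    using A_compare(1)[OF hd] Gt_quadratic[OF hd] by linarith
qed (use A_dims Gt_carrier in auto)

lemma Gt_pd: "pd d (Gt k)" by (rule pd_of_loewner[OF A_pd A_le_Gt])

text \<open>One factor \<open>c k\<close> comes from the scaling, the other from replacing the
  Hessian at the old point by \<open>A k\<close>; each is at most exp (M lam).\<close>

lemma Gt_le: "loewner_le d (Gt k) (eta (Suc k) \<cdot>\<^sub>m A k)"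
  unfolding loewner_le_def
proof (intro conjI ballI)
  fix h :: "real vec" assume "h \<in> carrier_vec d"
  then have hd: "dim_vec h = d" by simp
  define q where "q = h \<bullet> (A k *\<^sub>v h)"
  have q0: "0 \<le> q" unfolding q_def by (rule psdD[OF pd_imp_psd[OF A_pd] hd])
  have e0: "0 \<le> eta k" using eta_bounds(2)[OF k, of k] by simp
  have "h \<bullet> (Gt k *\<^sub>v h) \<le> c k * (eta k * (h \<bullet> (H (x k) *\<^sub>v h)))"
    using loewnerD[OF G_le_eta hd] c_bounds hd hess_dims[OF x_carrier] unfolding Gt_quadratic[OF hd]
    by (intro mult_left_mono) (auto simp: mat_vec_simps)
  also have "\<dots> \<le> c k * (eta k * (c k * q))"
    using A_compare(2)[OF hd] c_bounds e0 unfolding q_def by (intro mult_left_mono) auto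
  also have "\<dots> = (c k * c k) * (eta k * q)" by simp
  also have "\<dots> \<le> (exp (M * lam k) * exp (M * lam k)) * (eta k * q)"
  proof (intro mult_right_mono mult_mono)
    show "c k \<le> exp (M * lam k)" using c_bounds exp_ge_add_one_self[of "M * lam k"] by linarith
    then show "c k \<le> exp (M * lam k)" .
  qed (use c_bounds e0 q0 in auto)
  also have "\<dots> = eta (Suc k) * q" by (simp add: eta_def exp_add[symmetric] algebra_simps)
  finally show "h \<bullet> (Gt k *\<^sub>v h) \<le> h \<bullet> (eta (Suc k) \<cdot>\<^sub>m A k *\<^sub>v h)"
    using hd A_dims by (simp add: mat_vec_simps q_def)
qed (use A_dims Gt_carrier in \<open>auto simp: transpose_smult\<close>)

lemma Ft_facts:
  assumes "rule = BFGS"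
  shows "Ft k \<in> carrier_mat d d" "transpose_mat (Ft k) * Ft k * Gt k = 1\<^sub>m d"
proof -
  have F: "F k \<in> carrier_mat d d" "transpose_mat (F k) * F k * G k = 1\<^sub>m d" using factor_inv[OF assms] by auto
  show "Ft k \<in> carrier_mat d d" using F by (simp add: Ft_def)
  have c0: "c k > 0" using c_bounds by linarith
  have T: "transpose_mat (F k) \<in> carrier_mat d d" using F by simp
  have "transpose_mat (Ft k) * Ft k = (1 / c k) \<cdot>\<^sub>m (transpose_mat (F k) * F k)"
  proof -
    define a where "a = 1 / sqrt (c k)"
    have a: "a * a = 1 / c k" using c0 by (simp add: a_def)
    have TF: "transpose_mat (F k) * F k \<in> carrier_mat d d" using F by simp
    have "transpose_mat (Ft k) * Ft k = a \<cdot>\<^sub>m transpose_mat (F k) * (a \<cdot>\<^sub>m F k)"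
      by (simp add: Ft_def a_def transpose_smult)
    also have "\<dots> = a \<cdot>\<^sub>m (transpose_mat (F k) * (a \<cdot>\<^sub>m F k))"
      by (rule mult_smult_assoc_mat[OF T, of _ d]) (use F in simp)
    also have "transpose_mat (F k) * (a \<cdot>\<^sub>m F k) = a \<cdot>\<^sub>m (transpose_mat (F k) * F k)"
      by (rule mult_smult_distrib[OF T F(1)])
    also have "a \<cdot>\<^sub>m (a \<cdot>\<^sub>m (transpose_mat (F k) * F k)) = (1 / c k) \<cdot>\<^sub>m (transpose_mat (F k) * F k)"
      using TF by (intro eq_matI) (auto simp: a simp flip: mult.assoc)
    finally show ?thesis .
  qed
  moreover have "(1 / c k) \<cdot>\<^sub>m (transpose_mat (F k) * F k) * Gt k = transpose_mat (F k) * F k * G k"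
  proof -
    have TF: "transpose_mat (F k) * F k \<in> carrier_mat d d" using F by simp
    have "(1 / c k) \<cdot>\<^sub>m (transpose_mat (F k) * F k) * Gt k = (1 / c k) \<cdot>\<^sub>m (transpose_mat (F k) * F k * Gt k)"
      by (rule mult_smult_assoc_mat[OF TF Gt_carrier(1)])
    also have "transpose_mat (F k) * F k * Gt k = c k \<cdot>\<^sub>m (transpose_mat (F k) * F k * G k)"
      unfolding Gt_def by (rule mult_smult_distrib[OF TF Gk_dims(1)])
    finally show ?thesis using c0 by (intro eq_matI) auto
  qed
  ultimately show "transpose_mat (Ft k) * Ft k * Gt k = 1\<^sub>m d" using F by simp
qed

lemma s_dims: "dim_vec (s k) = d" using unit(1)[of k] by auto

lemma u_nonzero:
  assumes B: "rule = BFGS"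
  shows "transpose_mat (Ft k) *\<^sub>v s k \<noteq> 0\<^sub>v d"
proof
  let ?u = "transpose_mat (Ft k) *\<^sub>v s k"
  assume z: "?u = 0\<^sub>v d"
  have "?u \<bullet> (Gt k *\<^sub>v ?u) = 1"
    unfolding factor_direction[OF Ft_facts(1)[OF B] Gt_carrier(1) Ft_facts(2)[OF B] s_dims] by (rule unit(2))
  moreover have "0\<^sub>v d \<bullet> (Gt k *\<^sub>v 0\<^sub>v d) = 0"
    using Gt_carrier(1) by (intro scalar_prod_left_zero[of _ d]) auto
  ultimately show False unfolding z by simp
qed

lemma lam_Suc_rate: "lam (Suc k) \<le> rate * lam k"
proof -
  have l: "0 \<le> M * lam k" "M * lam k \<le> ln (3 / 2) / (4 * \<kappa>)" using lam_small[OF k, of k] by auto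
  have e: "0 < eta k" "eta k \<le> 3 / 2 * \<kappa>" using eta_bounds[OF k, of k] by auto
  have "lam (Suc k) \<le> (1 + M * lam k) * max (M * lam k) (1 - 1 / (eta k * (1 + M * lam k))) * lam k"
    unfolding lam_def x_Suc_next by (rule nd_next[OF x_carrier hess_le_G G_le_eta e(1)]) simp
  also have "\<dots> \<le> rate * lam k"
    unfolding rate_def using contraction_factor[OF \<kappa>_ge_1 l e] k by (intro mult_right_mono) (auto simp: good_def)
  finally show ?thesis .
qed

lemma good_Suc: "good (Suc k)"
proof -
  have le: "loewner_le d (A k) (G (Suc k)) \<and> loewner_le d (G (Suc k)) (eta (Suc k) \<cdot>\<^sub>m A k)"
  proof (cases rule)
    case SR1
    show ?thesis unfolding SR1_Suc[OF SR1] using SR1_update_sandwich[OF A_le_Gt Gt_le s_dims] by simp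
  next
    case BFGS
    have "dim_vec (transpose_mat (Ft k) *\<^sub>v s k) = d" using Ft_facts(1)[OF BFGS] by simp
    then show ?thesis
      unfolding BFGS_Suc[OF BFGS]
      using BFGS_update_sandwich[OF A_pd A_le_Gt Gt_le eta_bounds(2)[OF k] _ u_nonzero[OF BFGS]] by simp
  qed
  moreover have "F (Suc k) \<in> carrier_mat d d \<and> transpose_mat (F (Suc k)) * F (Suc k) * G (Suc k) = 1\<^sub>m d"
    if B: "rule = BFGS"
    using BFGS_factor_update[OF Ft_facts(1)[OF B] A_pd Gt_pd Ft_facts(2)[OF B] s_dims unit(2)[of k]]
    unfolding BFGS_Suc[OF B] by (rule conjI)
  moreover have "0 \<le> lam j \<and> lam j \<le> rate ^ j * lam 0" if "j \<le> Suc k" for j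
  proof (cases "j = Suc k")
    case True
    have "0 \<le> lam (Suc k)" unfolding lam_def by (rule nd_nonneg[OF x_Suc_carrier])
    moreover have "rate * lam k \<le> rate * (rate ^ k * lam 0)"
      using k rate unfolding good_def by (intro mult_left_mono) auto
    then have "lam (Suc k) \<le> rate * (rate ^ k * lam 0)" using lam_Suc_rate by linarith
    ultimately show ?thesis using True by simp
  next
    case False
    then show ?thesis using k that by (simp add: good_def)
  qed
  ultimately show ?thesis
    using x_Suc_carrier unfolding good_def A_def by (intro conjI impI allI) auto
qed

end

lemma good: "good k"
  by (induction k) (simp_all add: good_0 good_Suc)

lemma lam_nonneg: "0 \<le> lam k" and lam_rate: "lam k \<le> rate ^ k * lam 0"
  using good[of k] by (auto simp: good_def)

section \<open>The error measure and the potential\<close>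

definition theta :: "nat \<Rightarrow> real" where
  "theta k = (case rule of SR1 \<Rightarrow> tr (G k - H (x k)) / \<mu> | BFGS \<Rightarrow> tr (minv (H (x k)) * G k) - real d)"

definition thetat :: "nat \<Rightarrow> real" where
  "thetat k = (case rule of SR1 \<Rightarrow> tr (Gt k - A k) / \<mu> | BFGS \<Rightarrow> tr (minv (A k) * Gt k) - real d)"

text \<open>Normalised so that for both rules the trace of \<open>Q k\<close> is
  \<open>thetat k\<close> and an update with unit direction s lowers \<open>thetat k\<close> by at
  least s^T Q s. For BFGS the subtracted identity accounts both for the restored trace 1 and for the
  -d in \<open>thetat\<close>.\<close>

definition Q :: "nat \<Rightarrow> real mat" where
  "Q k = (case rule of SR1 \<Rightarrow> (1 / \<mu>) \<cdot>\<^sub>m (Gt k - A k) | BFGS \<Rightarrow> BFGS_gain (Ft k) (Gt k) (A k) - 1\<^sub>m d)"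

lemma SR1_simps:
  assumes "rule = SR1"
  shows "theta k = tr (G k - H (x k)) / \<mu>" "thetat k = tr (Gt k - A k) / \<mu>"
    "Q k = (1 / \<mu>) \<cdot>\<^sub>m (Gt k - A k)"
  unfolding theta_def thetat_def Q_def by (simp_all add: assms)

lemma BFGS_simps:
  assumes "rule = BFGS"
  shows "theta k = tr (minv (H (x k)) * G k) - real d" "thetat k = tr (minv (A k) * Gt k) - real d"
    "Q k = BFGS_gain (Ft k) (Gt k) (A k) - 1\<^sub>m d"
  unfolding theta_def thetat_def Q_def by (simp_all add: assms)

lemma Q_carrier: "Q k \<in> carrier_mat d d"
proof (cases rule)
  case SR1
  show ?thesis unfolding SR1_simps[OF SR1] by (intro smult_carrier_mat minus_carrier_mat A_dims good)
next
  case BFGS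
  show ?thesis unfolding BFGS_simps[OF BFGS] by (intro minus_carrier_mat one_carrier_mat)
qed

lemma Q_quadratic_SR1:
  assumes "rule = SR1" "dim_vec v = d"
  shows "v \<bullet> (Q k *\<^sub>v v) = (v \<bullet> ((Gt k - A k) *\<^sub>v v)) / \<mu>"
  unfolding SR1_simps[OF assms(1)] using A_dims[OF good[of k]] assms(2) by (simp add: mult_mat_vec_smult_l)

lemma Q_quadratic_BFGS:
  assumes "rule = BFGS" "dim_vec v = d"
  shows "v \<bullet> (Q k *\<^sub>v v) = v \<bullet> (BFGS_gain (Ft k) (Gt k) (A k) *\<^sub>v v) - v \<bullet> v"
proof -
  have "BFGS_gain (Ft k) (Gt k) (A k) \<in> carrier_mat d d"
    by (rule BFGS_gain_carrier[OF Ft_facts(1)[OF good assms(1)] Gt_carrier(1)[OF good] A_pd[OF good]])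
  then show ?thesis unfolding BFGS_simps[OF assms(1)] using assms(2) by (simp add: mat_vec_simps)
qed

lemma tr_Q: "tr (Q k) = thetat k"
proof (cases rule)
  case SR1
  show ?thesis
    unfolding SR1_simps[OF SR1] tr_smult[OF minus_carrier_mat[OF A_dims(1)[OF good]]] by simp
next
  case BFGS
  note F = Ft_facts[OF good BFGS]
  have "BFGS_gain (Ft k) (Gt k) (A k) \<in> carrier_mat d d"
    by (rule BFGS_gain_carrier[OF F(1) Gt_carrier(1)[OF good] A_pd[OF good]])
  then show ?thesis
    unfolding BFGS_simps[OF BFGS]
    using tr_BFGS_gain[OF F(1) Gt_carrier(1)[OF good] A_pd[OF good] F(2)]
    by (simp add: tr_minus[of _ d] tr_one)
qed

lemma theta_Suc: "theta (Suc k) \<le> thetat k - s k \<bullet> (Q k *\<^sub>v s k)"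
proof (cases rule)
  case SR1
  have "tr (SR1_update (Gt k) (A k) (s k) - A k) / \<mu> \<le> (tr (Gt k - A k) - s k \<bullet> ((Gt k - A k) *\<^sub>v s k)) / \<mu>"
    using SR1_tr_decrease[OF A_le_Gt[OF good] s_dims[OF good] unit(2)] \<mu> by (intro divide_right_mono) auto
  then show ?thesis
    unfolding Q_quadratic_SR1[OF SR1 s_dims[OF good]]
    unfolding SR1_simps[OF SR1] SR1_Suc[OF SR1] A_def[symmetric]
    by (simp add: diff_divide_distrib)
next
  case BFGS
  note F = Ft_facts[OF good BFGS]
  show ?thesis
    unfolding Q_quadratic_BFGS[OF BFGS s_dims[OF good]]
    unfolding BFGS_simps[OF BFGS] BFGS_Suc(1)[OF BFGS] A_def[symmetric]
      BFGS_tr_decrease[OF F(1) A_pd[OF good] A_le_Gt[OF good] F(2) s_dims[OF good] unit(2)] unit(2)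
    by simp
qed

lemma tr_hess: "tr (H (x k)) \<le> real d * L" "0 \<le> tr (H (x k))"
proof -
  have "tr (H (x k)) \<le> tr (L \<cdot>\<^sub>m 1\<^sub>m d)" by (rule tr_mono[OF hess_upper[OF x_carrier[OF good]]])
  also have "\<dots> = real d * L" using tr_smult[of "1\<^sub>m d" d L] by (simp add: tr_one)
  finally show "tr (H (x k)) \<le> real d * L" .
  show "0 \<le> tr (H (x k))" by (rule psd_tr_nonneg[OF pd_imp_psd[OF hess_pd[OF x_carrier[OF good]]]])
qed

lemma hess_carrier: "H (x k) \<in> carrier_mat d d" "transpose_mat (H (x k)) = H (x k)"
  using hess_pd[OF x_carrier[OF good]] by (auto simp: pd_def)

lemma theta_nonneg: "0 \<le> theta k"
proof (cases rule)
  case SR1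
  have "tr (H (x k)) \<le> tr (G k)" by (rule tr_mono[OF hess_le_G[OF good]])
  then show ?thesis unfolding SR1_simps[OF SR1] using \<mu> tr_minus[OF Gk_dims(1)[OF good] hess_carrier(1)] by simp
next
  case BFGS
  have "tr (minv (H (x k)) * H (x k)) \<le> tr (minv (H (x k)) * G k)"
    by (rule tr_mult_mono(2)[OF hess_le_G[OF good] pd_imp_psd[OF pd_minv_pd[OF hess_pd[OF x_carrier[OF good]]]]])
  then show ?thesis unfolding BFGS_simps[OF BFGS] using pd_minv[OF hess_pd[OF x_carrier[OF good]]] by (simp add: tr_one)
qed

text \<open>A crude consequence of G <= eta H with eta <= 3/2 \<kappa>, common to both rules; it
  enters the iteration count only through a logarithm.\<close>

lemma theta_upper: "theta k \<le> 3 / 2 * real d * \<kappa>\<^sup>2"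
proof -
  have e: "1 \<le> eta k" "eta k \<le> 3 / 2 * \<kappa>" using eta_bounds[OF good[of k], of k] by auto
  have "theta k \<le> eta k * real d * \<kappa>"
  proof (cases rule)
    case SR1
    have "tr (G k) \<le> tr (eta k \<cdot>\<^sub>m H (x k))" by (rule tr_mono[OF G_le_eta[OF good]])
    then have "tr (G k) \<le> eta k * tr (H (x k))" using tr_smult[OF hess_carrier(1)] by simp
    also have "\<dots> \<le> eta k * (real d * L)" using tr_hess e by (intro mult_left_mono) auto
    finally have "tr (G k) - tr (H (x k)) \<le> eta k * (real d * L)" using tr_hess(2)[of k] by linarith
    then have "theta k \<le> eta k * (real d * L) / \<mu>"
      unfolding SR1_simps[OF SR1] using \<mu> tr_minus[OF Gk_dims(1)[OF good] hess_carrier(1)] by (simp add: divide_right_mono)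
    then show ?thesis by (simp add: \<kappa>)
  next
    case BFGS
    have P: "psd d (minv (H (x k)))" by (rule pd_imp_psd[OF pd_minv_pd[OF hess_pd[OF x_carrier[OF good]]]])
    have "tr (minv (H (x k)) * G k) \<le> tr (minv (H (x k)) * (eta k \<cdot>\<^sub>m H (x k)))"
      by (rule tr_mult_mono(2)[OF G_le_eta[OF good] P])
    also have "minv (H (x k)) * (eta k \<cdot>\<^sub>m H (x k)) = eta k \<cdot>\<^sub>m 1\<^sub>m d"
      using mult_smult_distrib[of "minv (H (x k))" d d "H (x k)" d] hess_carrier P pd_minv[OF hess_pd[OF x_carrier[OF good]]]
      by (simp add: psd_def)
    also have "tr (eta k \<cdot>\<^sub>m 1\<^sub>m d) = eta k * real d" using tr_smult[of "1\<^sub>m d" d] by (simp add: tr_one)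
    finally have "theta k \<le> eta k * real d" unfolding BFGS_simps[OF BFGS] by simp
    also have "\<dots> \<le> eta k * real d * \<kappa>" using \<kappa>_ge_1 e mult_left_mono[of 1 \<kappa> "eta k * real d"] by simp
    finally show ?thesis .
  qed
  also have "\<dots> \<le> 3 / 2 * \<kappa> * real d * \<kappa>" using e \<kappa>_ge_1 by (intro mult_right_mono) auto
  finally show ?thesis by (simp add: power2_eq_square algebra_simps)
qed

text \<open>A semidefinite form is bounded by its trace relative to a reference form:
  \<open>\<mu> I\<close> for SR1, followed by \<open>\<mu> I <= H\<close>, and \<open>H\<close>
  itself for BFGS.\<close>

lemma G_le_theta: "loewner_le d (G k) ((1 + theta k) \<cdot>\<^sub>m H (x k))"
  unfolding loewner_le_def
proof (intro conjI ballI)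
  fix h :: "real vec" assume h: "h \<in> carrier_vec d"
  then have hd: "dim_vec h = d" by simp
  note Gd = Gk_dims[OF good[of k]]
  have R: "psd d (G k - H (x k))" using hess_le_G[OF good[of k]] loewner_iff_psd[OF hess_carrier Gd(1,4)] by simp
  have Rq: "h \<bullet> ((G k - H (x k)) *\<^sub>v h) = h \<bullet> (G k *\<^sub>v h) - h \<bullet> (H (x k) *\<^sub>v h)"
    using hd Gd hess_dims[OF x_carrier[OF good]] by (simp add: mat_vec_simps)
  have "h \<bullet> ((G k - H (x k)) *\<^sub>v h) \<le> theta k * (h \<bullet> (H (x k) *\<^sub>v h))"
  proof (cases rule)
    case SR1
    have mi: "minv (\<mu> \<cdot>\<^sub>m 1\<^sub>m d) = (1 / \<mu>) \<cdot>\<^sub>m 1\<^sub>m d"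
    proof (rule minv_eqI)
      show "\<mu> \<cdot>\<^sub>m 1\<^sub>m d * ((1 / \<mu>) \<cdot>\<^sub>m 1\<^sub>m d) = 1\<^sub>m d"
        using \<mu> by (intro mat_eqI_vec[of _ d]) (auto simp: mat_vec_simps smult_smult_assoc)
    qed auto
    have Rc: "G k - H (x k) \<in> carrier_mat d d" using R by (simp add: psd_def)
    have "tr (minv (\<mu> \<cdot>\<^sub>m 1\<^sub>m d) * (G k - H (x k))) = theta k"
      unfolding mi SR1_simps[OF SR1] mult_smult_assoc_mat[OF one_carrier_mat Rc] left_mult_one_mat[OF Rc] tr_smult[OF Rc]
      by simp
    then have "h \<bullet> ((G k - H (x k)) *\<^sub>v h) \<le> theta k * (h \<bullet> (\<mu> \<cdot>\<^sub>m 1\<^sub>m d *\<^sub>v h))"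
      using quadratic_le_tr[OF scaled_one_pd[OF \<mu>] R h] by simp
    also have "\<dots> \<le> theta k * (h \<bullet> (H (x k) *\<^sub>v h))"
      by (intro mult_left_mono theta_nonneg loewnerD[OF hess_lower[OF x_carrier[OF good]] hd])
    finally show ?thesis .
  next
    case BFGS
    note P = pd_minv[OF hess_pd[OF x_carrier[OF good[of k]]]]
    have "minv (H (x k)) * (G k - H (x k)) = minv (H (x k)) * G k - minv (H (x k)) * H (x k)"
      using P Gd hess_carrier by (intro mult_minus_distrib_mat) auto
    then have "tr (minv (H (x k)) * (G k - H (x k))) = theta k"
      unfolding BFGS_simps[OF BFGS] using P Gd tr_minus[OF mult_carrier_mat[of "minv (H (x k))" d d "G k" d] one_carrier_mat] by (simp add: tr_one)
    then show ?thesis using quadratic_le_tr[OF hess_pd[OF x_carrier[OF good[of k]]] R h] by simp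
  qed
  then show "h \<bullet> (G k *\<^sub>v h) \<le> h \<bullet> ((1 + theta k) \<cdot>\<^sub>m H (x k) *\<^sub>v h)"
    using Rq hd hess_dims[OF x_carrier[OF good]] by (simp add: mat_vec_simps algebra_simps)
qed (use Gk_dims[OF good[of k]] hess_carrier in \<open>auto simp: transpose_smult\<close>)

lemma Mlam_le_1: "0 \<le> M * lam k" "M * lam k \<le> 1 / (8 * \<kappa>)" "M * lam k \<le> 1"
proof -
  show "0 \<le> M * lam k" by (rule lam_small(1)[OF good[of k]]) simp
  have "M * lam k \<le> ln (3 / 2) / (4 * \<kappa>)" by (rule lam_small(2)[OF good[of k]]) simp
  also have "\<dots> \<le> (1 / 2) / (4 * \<kappa>)"
    using ln_le_minus_one[of "3 / 2 :: real"] \<kappa>_ge_1 by (intro divide_right_mono) auto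
  finally show 1: "M * lam k \<le> 1 / (8 * \<kappa>)" by simp
  have "1 / (8 * \<kappa>) \<le> 1" using \<kappa>_ge_1 by (simp add: field_simps)
  with 1 show "M * lam k \<le> 1" by simp
qed

text \<open>The one-step bound with \<eta> = 1 + theta and a = M lam: the arguments of the maximum
  give (1 + a) a <= 2 a and 1 + a - 1/(1 + theta) <= a + theta.\<close>

lemma lam_Suc_theta: "lam (Suc k) \<le> (theta k + 2 * (M * lam k)) * lam k"
proof -
  define a where "a = M * lam k"
  have a: "0 \<le> a" "a \<le> 1" using Mlam_le_1[of k] by (auto simp: a_def)
  have t: "0 \<le> theta k" by (rule theta_nonneg)
  have "lam (Suc k) \<le> (1 + a) * max a (1 - 1 / ((1 + theta k) * (1 + a))) * lam k"
    unfolding lam_def x_Suc_next[OF good]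
    by (rule nd_next[OF x_carrier[OF good] hess_le_G[OF good] G_le_theta]) (use t in \<open>auto simp: a_def lam_def\<close>)
  also have "\<dots> \<le> (theta k + 2 * a) * lam k"
  proof (intro mult_right_mono lam_nonneg)
    have "(1 + a) * a \<le> 2 * a" using a by (intro mult_right_mono) auto
    moreover have "(1 + a) * (1 - 1 / ((1 + theta k) * (1 + a))) \<le> a + theta k"
    proof -
      have "(1 + a) * (1 - 1 / ((1 + theta k) * (1 + a))) = 1 + a - (1 + a) / ((1 + theta k) * (1 + a))"
        by (simp add: right_diff_distrib)
      also have "(1 + a) / ((1 + theta k) * (1 + a)) = 1 / (1 + theta k)" using a by simp
      finally have eq: "(1 + a) * (1 - 1 / ((1 + theta k) * (1 + a))) = 1 + a - 1 / (1 + theta k)" .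
      have "(1 - theta k) * (1 + theta k) = 1 - theta k * theta k" by (simp add: algebra_simps)
      then have "(1 - theta k) * (1 + theta k) \<le> 1" by simp
      then have "1 - theta k \<le> 1 / (1 + theta k)" using t by (subst pos_le_divide_eq) auto
      then show ?thesis unfolding eq by simp
    qed
    ultimately show "(1 + a) * max a (1 - 1 / ((1 + theta k) * (1 + a))) \<le> theta k + 2 * a"
      using a t by (simp add: max_def)
  qed
  finally show ?thesis unfolding a_def .
qed

text \<open>The second summand is the worst additive growth of theta when \<open>G\<close> is
  rescaled and the Hessian moves. With it included, the growth in a step becomes purely
  multiplicative.\<close>

definition rho :: "nat \<Rightarrow> real" where "rho k = theta k + 2 * (real d * \<kappa>) * (M * lam k)"

lemma rho_nonneg: "0 \<le> rho k"
  using theta_nonneg[of k] Mlam_le_1(1)[of k] \<kappa>_ge_1 by (simp add: rho_def)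

lemma theta_lam_le_rho: "theta k + 2 * (M * lam k) \<le> rho k"
proof -
  have "1 * (M * lam k) \<le> (real d * \<kappa>) * (M * lam k)" using d_kappa_ge_2 Mlam_le_1(1)[of k] by (intro mult_right_mono) auto
  then show ?thesis by (simp add: rho_def)
qed

lemma lam_Suc_rho: "lam (Suc k) \<le> rho k * lam k"
  using lam_Suc_theta[of k] mult_right_mono[OF theta_lam_le_rho lam_nonneg, of k k] by linarith

lemma rho_upper: "rho k \<le> 2 * real d * \<kappa>\<^sup>2"
proof -
  have "2 * (real d * \<kappa>) * (M * lam k) \<le> 2 * (real d * \<kappa>) * (1 / (8 * \<kappa>))"
    using Mlam_le_1(2)[of k] \<kappa>_ge_1 by (intro mult_left_mono) auto
  also have "\<dots> = real d / 4" using \<kappa>_ge_1 by simp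
  also have "\<dots> \<le> real d / 2 * \<kappa>\<^sup>2"
  proof -
    have "real d / 4 * 1 \<le> real d / 2 * \<kappa>\<^sup>2" using \<kappa>_ge_1 by (intro mult_mono) auto
    then show ?thesis by simp
  qed
  finally show ?thesis using theta_upper[of k] by (simp add: rho_def)
qed

text \<open>Let e = c - 1 <= M lam. For SR1, A >= (1 - e) H gives tr (Gt - A) <= (1 + e) tr (G - H)
  + 2 e tr H, and tr H <= d L. For BFGS, A^-1 <= (1 + e) H^-1 gives tr (A^-1 Gt) <= (1 + e)^2 (theta
  + d), from which d is subtracted. Both fit under one bound in e, which is finally increased from e
  to M lam.\<close>

lemma thetat_le: "thetat k \<le> (1 + M * lam k)\<^sup>2 * rho k"
proof -
  define e where "e = c k - 1"
  define a where "a = M * lam k"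
  have e: "0 \<le> e" "e \<le> a" using c_bounds[OF good[of k]] by (auto simp: e_def a_def)
  have ck: "c k = 1 + e" by (simp add: e_def)
  note Gd = Gk_dims[OF good[of k]] and Ad = A_dims[OF good[of k]]
  have "thetat k \<le> (1 + e)\<^sup>2 * (theta k + 2 * (real d * \<kappa>) * e)"
  proof (cases rule)
    case SR1
    have le: "loewner_le d ((1 - e) \<cdot>\<^sub>m H (x k)) (A k)"
      unfolding loewner_le_def
    proof (intro conjI ballI)
      fix h :: "real vec" assume "h \<in> carrier_vec d"
      then have hd: "dim_vec h = d" by simp
      show "h \<bullet> ((1 - e) \<cdot>\<^sub>m H (x k) *\<^sub>v h) \<le> h \<bullet> (A k *\<^sub>v h)"
        using A_compare(3)[OF good hd, of k] hd hess_dims[OF x_carrier[OF good]] by (simp add: e_def mat_vec_simps)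
    qed (use Ad hess_carrier in \<open>auto simp: transpose_smult\<close>)
    have "(1 - e) * tr (H (x k)) \<le> tr (A k)" using tr_mono[OF le] tr_smult[OF hess_carrier(1)] by simp
    moreover have "tr (Gt k - A k) = (1 + e) * tr (G k) - tr (A k)"
    proof -
      have "tr (Gt k) = (1 + e) * tr (G k)" unfolding Gt_def ck by (rule tr_smult[OF Gd(1)])
      then show ?thesis using tr_minus[OF Gt_carrier(1)[OF good[of k]] Ad(1)] by simp
    qed
    ultimately have "tr (Gt k - A k) \<le> (1 + e) * (tr (G k) - tr (H (x k))) + 2 * e * tr (H (x k))"
      by (simp add: algebra_simps)
    also have "\<dots> \<le> (1 + e) * (tr (G k) - tr (H (x k))) + 2 * e * (real d * L)"
      using e tr_hess(1)[of k] by (intro add_left_mono mult_left_mono) auto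
    finally have "thetat k \<le> ((1 + e) * (tr (G k) - tr (H (x k))) + 2 * e * (real d * L)) / \<mu>"
      unfolding SR1_simps[OF SR1] using \<mu> by (simp add: divide_right_mono)
    also have "\<dots> = (1 + e) * theta k + 2 * (real d * \<kappa>) * e"
      unfolding SR1_simps[OF SR1] using tr_minus[OF Gd(1) hess_carrier(1)] by (simp add: \<kappa> add_divide_distrib)
    also have "\<dots> \<le> (1 + e)\<^sup>2 * theta k + (1 + e)\<^sup>2 * (2 * (real d * \<kappa>) * e)"
    proof (intro add_mono)
      have "1 \<le> (1 + e)\<^sup>2" using e by simp
      then show "2 * (real d * \<kappa>) * e \<le> (1 + e)\<^sup>2 * (2 * (real d * \<kappa>) * e)"
        using mult_right_mono[of 1 "(1 + e)\<^sup>2" "2 * (real d * \<kappa>) * e"] e \<kappa>_ge_1 by simp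
      have "1 + e \<le> (1 + e)\<^sup>2" using e by (simp add: power2_eq_square)
      then show "(1 + e) * theta k \<le> (1 + e)\<^sup>2 * theta k" by (rule mult_right_mono) (rule theta_nonneg)
    qed
    finally show ?thesis by (simp add: algebra_simps)
  next
    case BFGS
    note P = pd_minv_pd[OF hess_pd[OF x_carrier[OF good[of k]]]] and P' = pd_minv_pd[OF A_pd[OF good[of k]]]
    have Pc: "minv (H (x k)) \<in> carrier_mat d d" "transpose_mat (minv (H (x k))) = minv (H (x k))"
      "minv (A k) \<in> carrier_mat d d" "transpose_mat (minv (A k)) = minv (A k)"
      using P P' by (auto simp: pd_def)
    have "loewner_le d (minv (A k)) ((1 + e) \<cdot>\<^sub>m minv (H (x k)))"
      unfolding loewner_le_def
    proof (intro conjI ballI)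
      fix h :: "real vec" assume h: "h \<in> carrier_vec d"
      have "h \<bullet> (minv (A k) *\<^sub>v h) \<le> (1 + e) * (h \<bullet> (minv (H (x k)) *\<^sub>v h))"
        by (rule minv_antimono[OF hess_pd[OF x_carrier[OF good]] A_pd[OF good] _ _ h])
          (use e A_compare(2)[OF good, of _ k] in \<open>auto simp: ck\<close>)
      then show "h \<bullet> (minv (A k) *\<^sub>v h) \<le> h \<bullet> ((1 + e) \<cdot>\<^sub>m minv (H (x k)) *\<^sub>v h)"
        using h Pc by (simp add: mat_vec_simps)
    qed (use Pc in \<open>auto simp: transpose_smult\<close>)
    then have "tr (minv (A k) * G k) \<le> tr ((1 + e) \<cdot>\<^sub>m minv (H (x k)) * G k)"
      by (rule tr_mult_mono(1)[OF _ pd_imp_psd[OF Gk_pd[OF good]]])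
    also have "\<dots> = (1 + e) * (theta k + real d)"
      unfolding BFGS_simps[OF BFGS] using Pc Gd mult_smult_assoc_mat[of "minv (H (x k))" d d "G k" d]
      by (simp add: tr_smult[of _ d])
    finally have "(1 + e) * tr (minv (A k) * G k) \<le> (1 + e) * ((1 + e) * (theta k + real d))"
      using e by (intro mult_left_mono) auto
    moreover have "tr (minv (A k) * Gt k) = (1 + e) * tr (minv (A k) * G k)"
      unfolding Gt_def ck using Pc Gd mult_smult_distrib[of "minv (A k)" d d "G k" d]
      by (simp add: tr_smult[of _ d])
    ultimately have "thetat k \<le> (1 + e) * ((1 + e) * (theta k + real d)) - real d"
      unfolding BFGS_simps[OF BFGS] by simp
    also have "\<dots> = (1 + e)\<^sup>2 * theta k + real d * (2 * e + e * e)"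
      by (simp add: power2_eq_square algebra_simps)
    \<comment> \<open>The factors d and 2 e + e^2 are enlarged to d \<kappa> and (1 + e)^2 2 e, the
      shape reached in the SR1 case.\<close>
    also have "\<dots> \<le> (1 + e)\<^sup>2 * theta k + (real d * \<kappa>) * ((1 + e)\<^sup>2 * (2 * e))"
    proof (intro add_left_mono mult_mono)
      have "(1 + e)\<^sup>2 * (2 * e) = 2 * e + e * e + (3 * e * e + 2 * e * e * e)"
        by (simp add: power2_eq_square algebra_simps)
      then show "2 * e + e * e \<le> (1 + e)\<^sup>2 * (2 * e)" using e by simp
      show "real d \<le> real d * \<kappa>" using \<kappa>_ge_1 by (simp add: mult_le_cancel_left1)
    qed (use e \<kappa>_ge_1 in auto)
    finally show ?thesis by (simp add: algebra_simps)
  qed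
  also have "\<dots> \<le> (1 + a)\<^sup>2 * (theta k + 2 * (real d * \<kappa>) * a)"
  proof (rule mult_mono)
    show "(1 + e)\<^sup>2 \<le> (1 + a)\<^sup>2" using e by (intro power_mono) auto
    have "2 * (real d * \<kappa>) * e \<le> 2 * (real d * \<kappa>) * a" using e d_kappa_ge_2 by (intro mult_left_mono) auto
    then show "theta k + 2 * (real d * \<kappa>) * e \<le> theta k + 2 * (real d * \<kappa>) * a" by simp
    show "0 \<le> theta k + 2 * (real d * \<kappa>) * e" using theta_nonneg[of k] e \<kappa>_ge_1 by simp
  qed simp
  finally show ?thesis unfolding rho_def a_def .
qed

text \<open>The left-hand side bounds the (conditional expectation of the) value of \<open>rho (Suc k)\<close>.\<close>

lemma rho_step:
  "(1 - 1 / real d) * thetat k + 2 * (real d * \<kappa>) * (M * lam (Suc k))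
    \<le> (1 - 1 / real d) * exp (6 * (real d * \<kappa>) * (M * lam k)) * rho k"
proof -
  define a D q where "a = M * lam k" and "D = real d * \<kappa>" and "q = 1 - 1 / real d"
  have a: "0 \<le> a" unfolding a_def by (rule Mlam_le_1)
  have D: "2 \<le> D" unfolding D_def by (rule d_kappa_ge_2)
  have q: "1 / 2 \<le> q" using d2 by (simp add: q_def field_simps)
  have r: "0 \<le> rho k" by (rule rho_nonneg)
  have "M * lam (Suc k) \<le> M * ((theta k + 2 * (M * lam k)) * lam k)"
    using lam_Suc_theta[of k] M by (intro mult_left_mono) auto
  also have "\<dots> = a * (theta k + 2 * (M * lam k))" by (simp add: a_def)
  also have "\<dots> \<le> a * rho k" using theta_lam_le_rho a by (rule mult_left_mono)
  finally have "2 * D * (M * lam (Suc k)) \<le> 2 * D * (a * rho k)" using D by (intro mult_left_mono) auto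
  moreover have "q * thetat k \<le> q * ((1 + a)\<^sup>2 * rho k)"
    using thetat_le[of k] q unfolding a_def by (intro mult_left_mono) auto
  ultimately have "q * thetat k + 2 * D * (M * lam (Suc k)) \<le> (q * (1 + a)\<^sup>2 + 2 * D * a) * rho k"
    by (simp add: algebra_simps)
  also have "\<dots> \<le> (q * exp (6 * D * a)) * rho k"
  proof (rule mult_right_mono[OF _ r])
    \<comment> \<open>Here d >= 2 enters through q >= 1/2: the new second summand of rho can be
      absorbed into a multiple of q.\<close>
    have "2 * D * a \<le> q * (4 * D * a)" using mult_right_mono[OF q, of "4 * D * a"] D a by simp
    also have "\<dots> \<le> q * ((1 + a)\<^sup>2 * (4 * D * a))"
    proof (rule mult_left_mono)
      have "1 * (4 * D * a) \<le> (1 + a)\<^sup>2 * (4 * D * a)" using a D by (intro mult_right_mono) auto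
      then show "4 * D * a \<le> (1 + a)\<^sup>2 * (4 * D * a)" by simp
    qed (use q in simp)
    finally have "q * (1 + a)\<^sup>2 + 2 * D * a \<le> q * ((1 + a)\<^sup>2 * (1 + 4 * D * a))"
      by (simp add: algebra_simps)
    also have "\<dots> \<le> q * (exp (2 * a) * exp (4 * D * a))"
    proof (intro mult_left_mono mult_mono)
      have "(1 + a)\<^sup>2 \<le> (exp a)\<^sup>2" using exp_ge_add_one_self[of a] a by (intro power_mono) auto
      then show "(1 + a)\<^sup>2 \<le> exp (2 * a)" by (simp add: exp_double)
      show "1 + 4 * D * a \<le> exp (4 * D * a)" by (rule exp_ge_add_one_self)
    qed (use q D a in auto)
    \<comment> \<open>The constant 6 is 4 from the absorbed summand plus 2 from (1 + a)^2, the
      latter enlarged by D >= 1.\<close>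
    also have "\<dots> \<le> q * exp (6 * D * a)"
    proof (rule mult_left_mono)
      have "2 * a \<le> 2 * (D * a)" using mult_right_mono[of 1 D a] D a by simp
      then show "exp (2 * a) * exp (4 * D * a) \<le> exp (6 * D * a)" by (simp add: exp_add[symmetric])
    qed (use q in simp)
    finally show "q * (1 + a)\<^sup>2 + 2 * D * a \<le> q * exp (6 * D * a)" .
  qed
  finally show ?thesis unfolding a_def D_def q_def .
qed

text \<open>Multiplying the bounds lam (j + 1) <= rho j * lam j adds up the exponents 0 + 1 + ... +
  (k - 1). The base of the induction is the linear rate over the first k0 steps. The integer
  division is exact, as the next numerator exceeds k (k - 1) by 2 k.\<close>

lemma superlinear:
  assumes q: "0 \<le> q" and r: "\<And>j. rho (k0 + j) \<le> (1 / 2) * q ^ j"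
  shows "lam (k0 + k) \<le> q ^ (k * (k - 1) div 2) * (1 / 2) ^ k * rate ^ k0 * lam 0"
proof (induction k)
  case 0
  then show ?case using lam_rate[of k0] by simp
next
  case (Suc k)
  have e: "k + k * (k - 1) div 2 = Suc k * (Suc k - 1) div 2"
  proof (cases k)
    case (Suc m)
    have "Suc k * (Suc k - 1) = k * (k - 1) + k * 2" by (simp add: Suc algebra_simps)
    then show ?thesis by simp
  qed simp
  have "lam (k0 + Suc k) \<le> rho (k0 + k) * lam (k0 + k)" using lam_Suc_rho[of "k0 + k"] by simp
  also have "\<dots> \<le> ((1 / 2) * q ^ k) * (q ^ (k * (k - 1) div 2) * (1 / 2) ^ k * rate ^ k0 * lam 0)"
    by (intro mult_mono r Suc lam_nonneg) (use q in simp)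
  also have "\<dots> = q ^ (k + k * (k - 1) div 2) * (1 / 2) ^ Suc k * rate ^ k0 * lam 0"
    by (simp add: power_add)
  finally show ?case unfolding e .
qed

end

section \<open>Greedy methods\<close>

context qn_problem
begin

text \<open>The exponent 6 d \<kappa> M lam with lam replaced by its linear-rate bound: 6 d \<kappa>
  * rate^i / (8 \<kappa>). It does not depend on the trajectory, so it can be taken out of
  expectations later.\<close>

definition b :: "nat \<Rightarrow> real" where "b i = 3 / 4 * real d * rate ^ i"

text \<open>The geometric tail is at most 3/4 d rate^k1 * 2 \<kappa>, hence at most 3/8 by the
  assumption on k1, and 1/2 <= ln 2 leaves room.\<close>

lemma sum_b_le:
  assumes "rate ^ k1 \<le> 1 / (4 * (real d * \<kappa>))"
  shows "exp (\<Sum>i<j. b (k1 + i)) \<le> 2"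
proof -
  have "(\<Sum>i<j. b (k1 + i)) = 3 / 4 * real d * rate ^ k1 * (\<Sum>i<j. rate ^ i)"
    by (simp add: b_def power_add sum_distrib_left mult.assoc)
  also have "\<dots> \<le> 3 / 4 * real d * rate ^ k1 * (2 * \<kappa>)"
    using geometric_partial_sum_le[of rate j] rate by (intro mult_left_mono) auto
  also have "\<dots> = 3 / 2 * (real d * \<kappa>) * rate ^ k1" by simp
  also have "\<dots> \<le> 3 / 2 * (real d * \<kappa>) * (1 / (4 * (real d * \<kappa>)))"
    using assms d_kappa_ge_2 by (intro mult_left_mono) auto
  also have "\<dots> \<le> 1 / 2" using d_kappa_ge_2 by simp
  also have "\<dots> \<le> ln 2" using ln_one_minus_pos_upper_bound[of "1 / 2 :: real"] by (simp add: ln_div)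
  finally show ?thesis by (subst (asm) ln_ge_iff) simp_all
qed

lemma rate_power_le:
  assumes "2 * \<kappa> * ln (4 * (real d * \<kappa>)) \<le> real k1"
  shows "rate ^ k1 \<le> 1 / (4 * (real d * \<kappa>))"
proof -
  have "rate \<le> exp (- (1 / (2 * \<kappa>)))" using exp_ge_add_one_self[of "- (1 / (2 * \<kappa>))"] by (simp add: rate_def)
  then have "rate ^ k1 \<le> exp (- (1 / (2 * \<kappa>))) ^ k1" using rate by (intro power_mono) auto
  also have "\<dots> = exp (- (real k1 / (2 * \<kappa>)))" by (simp flip: exp_of_nat_mult)
  also have "\<dots> \<le> exp (- ln (4 * (real d * \<kappa>)))"
    using assms \<kappa>_ge_1 by (simp add: pos_le_divide_eq mult.commute)
  also have "\<dots> = 1 / (4 * (real d * \<kappa>))" using d_kappa_ge_2 by (simp add: exp_minus inverse_eq_divide)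
  finally show ?thesis .
qed

end

text \<open>From 1 - 1/n <= exp (-1/n). The instances n = d and n = d + 1 serve the greedy and the
  random rate.\<close>

lemma power_le_inverse:
  fixes n :: real
  assumes "1 \<le> n" "0 < t" "n * ln t \<le> real j"
  shows "(1 - 1 / n) ^ j * t \<le> 1"
proof -
  have "1 - 1 / n \<le> exp (- (1 / n))" using exp_ge_add_one_self[of "- (1 / n)"] by simp
  then have "(1 - 1 / n) ^ j \<le> exp (- (1 / n)) ^ j" using assms by (intro power_mono) auto
  also have "\<dots> = exp (- (real j / n))" by (simp flip: exp_of_nat_mult)
  also have "\<dots> \<le> exp (- ln t)"
    using assms by (simp add: pos_le_divide_eq mult.commute)
  also have "\<dots> = 1 / t" using assms by (simp add: exp_minus inverse_eq_divide)
  finally show ?thesis using assms by (simp add: pos_le_divide_eq)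
qed

lemma ln_pow_le: "0 < z \<Longrightarrow> z \<le> y ^ m \<Longrightarrow> 0 < y \<Longrightarrow> ln z \<le> real m * ln (y :: real)"
  using ln_le_cancel_iff[of z "y ^ m"] by (simp add: ln_realpow)

context qn_trajectory
begin

lemma rho_step_b:
  "(1 - 1 / real d) * thetat k + 2 * (real d * \<kappa>) * (M * lam (Suc k)) \<le> (1 - 1 / real d) * exp (b k) * rho k"
proof -
  have "6 * (real d * \<kappa>) * (M * lam k) \<le> 6 * (real d * \<kappa>) * (1 / (8 * \<kappa>) * rate ^ k)"
  proof (rule mult_left_mono)
    have "M * lam k \<le> M * (rate ^ k * lam 0)" using lam_rate M by (intro mult_left_mono) auto
    also have "\<dots> = (M * lam 0) * rate ^ k" by simp
    also have "\<dots> \<le> (1 / (8 * \<kappa>)) * rate ^ k"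
      using Mlam_le_1(2)[of 0] rate by (intro mult_right_mono) auto
    finally show "M * lam k \<le> 1 / (8 * \<kappa>) * rate ^ k" .
  qed (use d_kappa_ge_2 in simp)
  also have "\<dots> = b k" using \<kappa>_ge_1 by (simp add: b_def)
  finally have "exp (6 * (real d * \<kappa>) * (M * lam k)) \<le> exp (b k)" by simp
  then have "(1 - 1 / real d) * exp (6 * (real d * \<kappa>) * (M * lam k)) * rho k \<le> (1 - 1 / real d) * exp (b k) * rho k"
    using d2 rho_nonneg by (intro mult_right_mono mult_left_mono) auto
  then show ?thesis using rho_step[of k] by linarith
qed

text \<open>The largest diagonal entry is at least the average of all d of them. For BFGS the rule
  maximises the gain matrix, which differs from \<open>Q k\<close> by the identity, a constant on
  unit vectors.\<close>

lemma greedy_direction: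
  assumes "greedy_directions rule d f M x G F s"
  shows "tr (Q k) / real d \<le> s k \<bullet> (Q k *\<^sub>v s k)"
proof -
  have max: "e \<bullet> (Q k *\<^sub>v e) \<le> s k \<bullet> (Q k *\<^sub>v s k)" if e: "e \<in> std_basis d" for e
  proof -
    have ed: "dim_vec e = d" and e1: "e \<bullet> e = 1" using e by (auto simp: std_basis_def)
    show ?thesis
    proof (cases rule)
      case SR1
      have "is_arg_max (\<lambda>v. v \<bullet> ((Gt k - A k) *\<^sub>v v)) (\<lambda>v. v \<in> std_basis d) (s k)"
        using assms unfolding greedy_directions_def
        by (simp add: SR1 Let_def scaled_G_def Gt_def c_def A_def)
      then have "e \<bullet> ((Gt k - A k) *\<^sub>v e) \<le> s k \<bullet> ((Gt k - A k) *\<^sub>v s k)"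
        using e by (auto simp: is_arg_max_def not_less)
      then show ?thesis
        unfolding Q_quadratic_SR1[OF SR1 ed] Q_quadratic_SR1[OF SR1 s_dims[OF good]] using \<mu> by (simp add: divide_right_mono)
    next
      case BFGS
      note Ff = Ft_facts[OF good[of k] BFGS]
      have mF: "minv (Ft k) = Gt k * transpose_mat (Ft k)" by (rule factor_inverse(3)[OF Ff(1) Gt_carrier(1)[OF good] Ff(2)])
      have tF: "transpose_mat (minv (Ft k)) = Ft k * Gt k"
        unfolding mF using Gt_carrier[OF good[of k]] Ff(1) by (subst transpose_mult[of _ d d _ d]) auto
      have "is_arg_max (\<lambda>v. v \<bullet> (transpose_mat (minv (Ft k)) * minv (A k) * minv (Ft k) *\<^sub>v v)) (\<lambda>v. v \<in> std_basis d) (s k)"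
        using assms unfolding greedy_directions_def
        by (simp add: BFGS Let_def scaled_G_def scaled_F_def Gt_def Ft_def c_def A_def)
      then have "is_arg_max (\<lambda>v. v \<bullet> (BFGS_gain (Ft k) (Gt k) (A k) *\<^sub>v v)) (\<lambda>v. v \<in> std_basis d) (s k)"
        unfolding tF unfolding mF BFGS_gain_def .
      then have "e \<bullet> (BFGS_gain (Ft k) (Gt k) (A k) *\<^sub>v e) \<le> s k \<bullet> (BFGS_gain (Ft k) (Gt k) (A k) *\<^sub>v s k)"
        using e by (auto simp: is_arg_max_def not_less)
      then show ?thesis
        unfolding Q_quadratic_BFGS[OF BFGS ed] Q_quadratic_BFGS[OF BFGS s_dims[OF good]] e1 unit(2) by simp
    qed
  qed
  have "tr (Q k) = (\<Sum>i<d. unit_vec d i \<bullet> (Q k *\<^sub>v unit_vec d i))"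
    using Q_carrier[of k] by (simp add: tr_def unit_vec_quadratic)
  also have "\<dots> \<le> (\<Sum>i<d. s k \<bullet> (Q k *\<^sub>v s k))"
    by (intro sum_mono max) (auto simp: std_basis_def)
  finally show ?thesis using d2 by (simp add: pos_divide_le_eq mult.commute)
qed

lemma greedy_rho:
  assumes "greedy_directions rule d f M x G F s"
  shows "rho (k1 + j) \<le> (1 - 1 / real d) ^ j * exp (\<Sum>i<j. b (k1 + i)) * rho k1"
proof (induction j)
  case (Suc j)
  let ?k = "k1 + j" and ?q = "1 - 1 / real d"
  have "theta (Suc ?k) \<le> thetat ?k - thetat ?k / real d"
    using theta_Suc[of ?k] greedy_direction[OF assms, of ?k] unfolding tr_Q by linarith
  also have "\<dots> = ?q * thetat ?k" by (simp add: algebra_simps)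
  finally have "rho (Suc ?k) \<le> ?q * exp (b ?k) * rho ?k" using rho_step_b[of ?k] unfolding rho_def[of "Suc ?k"] by linarith
  also have "\<dots> \<le> ?q * exp (b ?k) * (?q ^ j * exp (\<Sum>i<j. b (k1 + i)) * rho k1)"
    using Suc d2 by (intro mult_left_mono) auto
  also have "\<dots> = ?q ^ Suc j * exp (\<Sum>i<Suc j. b (k1 + i)) * rho k1" by (simp add: exp_add)
  finally show ?case by simp
qed simp

text \<open>After k1 steps the accumulated exponentials stay below 2 and rho is at most 2 d
  \<kappa>^2; j1 is chosen so that (1 - 1/d)^j1 brings their product 4 d \<kappa>^2 below 1/2,
  whence the 8 in the logarithm.\<close>

lemma greedy_superlinear:
  assumes greedy: "greedy_directions rule d f M x G F s"
    and k1: "2 * \<kappa> * ln (4 * (real d * \<kappa>)) \<le> real k1"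
    and j1: "real d * ln (8 * real d * \<kappa>\<^sup>2) \<le> real j1"
  shows "nd (x (k1 + j1 + k)) \<le> (1 - 1 / real d) ^ (k * (k - 1) div 2) * (1 / 2) ^ k * rate ^ (k1 + j1) * nd x0"
proof -
  let ?q = "1 - 1 / real d"
  have q: "0 \<le> ?q" using d2 by simp
  have "rho (k1 + j1 + j) \<le> 1 / 2 * ?q ^ j" for j
  proof -
    have "rho (k1 + j1 + j) \<le> ?q ^ (j1 + j) * exp (\<Sum>i<j1 + j. b (k1 + i)) * rho k1"
      using greedy_rho[OF greedy, of k1 "j1 + j"] by (simp add: add.assoc)
    also have "\<dots> \<le> ?q ^ (j1 + j) * 2 * (2 * real d * \<kappa>\<^sup>2)"
      using sum_b_le[OF rate_power_le[OF k1], of "j1 + j"] rho_upper[of k1] rho_nonneg[of k1] q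
      by (intro mult_mono) auto
    also have "\<dots> = 1 / 2 * ?q ^ j * (?q ^ j1 * (8 * real d * \<kappa>\<^sup>2))" by (simp add: power_add)
    also have "\<dots> \<le> 1 / 2 * ?q ^ j * 1"
    proof (rule mult_left_mono)
      show "?q ^ j1 * (8 * real d * \<kappa>\<^sup>2) \<le> 1"
        by (rule power_le_inverse[OF _ _ j1]) (use d2 \<kappa>_ge_1 in auto)
    qed (use q in simp)
    finally show ?thesis by simp
  qed
  from superlinear[OF q this] show ?thesis by (simp add: lam_def init)
qed

end

lemma unit_of_greedy:
  assumes "greedy_directions rule d f M x G F s"
  shows "s k \<in> carrier_vec d" "s k \<bullet> s k = 1"
proof -
  have "s k \<in> std_basis d"
    using assms unfolding greedy_directions_def is_arg_max_def Let_def by blast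
  then show "s k \<in> carrier_vec d" "s k \<bullet> s k = 1" by (auto simp: std_basis_def)
qed

lemma (in qn_problem) log_bounds:
  fixes \<delta> :: real
  assumes \<delta>: "0 < \<delta>" "\<delta> \<le> 1"
  defines "l \<equiv> ln (real d * \<kappa> / \<delta>)"
  shows "1 \<le> real d * l" "2 * \<kappa> * ln (4 * (real d * \<kappa>)) \<le> 6 * (\<kappa> * l)"
    "real d * ln (8 * real d * \<kappa>\<^sup>2) \<le> 5 * (real d * l)"
    "(real d + 1) * ln (8 * real d ^ 3 * \<kappa>\<^sup>2 / \<delta>) \<le> 9 * (real d * l)"
proof -
  define y where "y = real d * \<kappa> / \<delta>"
  have D: "2 \<le> real d * \<kappa>" by (rule d_kappa_ge_2)
  have Dy: "real d * \<kappa> \<le> y" unfolding y_def using \<delta> D by (simp add: pos_le_divide_eq mult_left_le)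
  have y2: "2 \<le> y" using D Dy by simp
  have l: "l = ln y" by (simp add: l_def y_def)
  have "1 / 2 \<le> ln (2 :: real)" using ln_one_minus_pos_upper_bound[of "1 / 2 :: real"] by (simp add: ln_div)
  also have "\<dots> \<le> l" unfolding l using y2 by simp
  finally have lh: "1 / 2 \<le> l" .
  have "2 * (1 / 2) \<le> real d * l" using d2 lh by (intro mult_mono) auto
  then show "1 \<le> real d * l" by simp
  have y4: "4 \<le> y ^ 2" using power_mono[of 2 y 2] y2 by simp
  have y8: "8 \<le> y ^ 3" using power_mono[of 2 y 3] y2 by simp
  have "4 * (real d * \<kappa>) \<le> y ^ 2 * y" using y4 Dy D by (intro mult_mono) auto
  then have "ln (4 * (real d * \<kappa>)) \<le> 3 * l"
    unfolding l using ln_pow_le[of "4 * (real d * \<kappa>)" y 3] D y2 by (simp add: power2_eq_square power3_eq_cube)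
  then have "2 * \<kappa> * ln (4 * (real d * \<kappa>)) \<le> 2 * \<kappa> * (3 * l)" using \<kappa>_ge_1 by (intro mult_left_mono) auto
  then show "2 * \<kappa> * ln (4 * (real d * \<kappa>)) \<le> 6 * (\<kappa> * l)" by simp
  have dk: "real d * \<kappa>\<^sup>2 \<le> (real d * \<kappa>)\<^sup>2"
    using mult_left_mono[of 1 "real d" "real d * \<kappa>\<^sup>2"] d2 \<kappa>_ge_1 by (simp add: power_mult_distrib power2_eq_square mult_ac)
  also have "\<dots> \<le> y\<^sup>2" using Dy D by (intro power_mono) auto
  finally have "8 * (real d * \<kappa>\<^sup>2) \<le> y ^ 3 * y\<^sup>2" using y8 d2 y2 by (intro mult_mono) auto
  also have "\<dots> = y ^ 5" by (simp flip: power_add)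
  finally have "ln (8 * real d * \<kappa>\<^sup>2) \<le> 5 * l"
    unfolding l using ln_pow_le[of "8 * real d * \<kappa>\<^sup>2" y 5] d2 \<kappa>_ge_1 y2 by simp
  then have "real d * ln (8 * real d * \<kappa>\<^sup>2) \<le> real d * (5 * l)" by (intro mult_left_mono) auto
  then show "real d * ln (8 * real d * \<kappa>\<^sup>2) \<le> 5 * (real d * l)" by simp
  have "real d ^ 3 * \<kappa>\<^sup>2 / \<delta> \<le> y ^ 3"
  proof -
    have "real d ^ 3 * \<kappa>\<^sup>2 * 1 \<le> (real d ^ 3 * \<kappa>\<^sup>2) * \<kappa>" using \<kappa>_ge_1 by (intro mult_left_mono) auto
    also have "\<dots> = (real d * \<kappa>) ^ 3" by (simp add: power_mult_distrib power2_eq_square power3_eq_cube)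
    finally have "real d ^ 3 * \<kappa>\<^sup>2 / \<delta> \<le> (real d * \<kappa>) ^ 3 / \<delta>" using \<delta> by (simp add: divide_right_mono)
    also have "\<dots> = (real d * \<kappa>) ^ 2 * y" by (simp add: y_def power2_eq_square power3_eq_cube)
    also have "\<dots> \<le> y ^ 2 * y" using Dy D y2 by (intro mult_right_mono power_mono) auto
    finally show ?thesis by (simp add: power2_eq_square power3_eq_cube)
  qed
  then have "8 * (real d ^ 3 * \<kappa>\<^sup>2 / \<delta>) \<le> y ^ 3 * y ^ 3" using y8 \<delta> y2 by (intro mult_mono) auto
  also have "\<dots> = y ^ 6" by (simp flip: power_add)
  finally have L: "ln (8 * real d ^ 3 * \<kappa>\<^sup>2 / \<delta>) \<le> 6 * l"
    unfolding l using ln_pow_le[of "8 * real d ^ 3 * \<kappa>\<^sup>2 / \<delta>" y 6] d2 \<kappa>_ge_1 y2 \<delta> by simp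
  then have "(real d + 1) * ln (8 * real d ^ 3 * \<kappa>\<^sup>2 / \<delta>) \<le> (real d + 1) * (6 * l)" by (intro mult_left_mono) auto
  also have "\<dots> \<le> (3 / 2 * real d) * (6 * l)" using d2 lh by (intro mult_right_mono) auto
  finally show "(real d + 1) * ln (8 * real d ^ 3 * \<kappa>\<^sup>2 / \<delta>) \<le> 9 * (real d * l)" by (simp add: mult_ac)
qed

text \<open>k0 is fixed before the factor, the tie-breaking and the run, as it depends on d and
  \<kappa> only.\<close>

lemma (in qn_problem) greedy_k0:
  "\<exists>k0::nat. real k0 \<le> 11 * ((real d + \<kappa>) * ln (real d * \<kappa>)) \<and>
    (\<forall>F0 x G F s. F0 \<in> carrier_mat d d \<and> transpose_mat F0 * F0 = minv (L \<cdot>\<^sub>m 1\<^sub>m d) \<and>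
       qn_run rule d f M x0 (L \<cdot>\<^sub>m 1\<^sub>m d) F0 x G F s \<and> greedy_directions rule d f M x G F s \<longrightarrow>
       (\<forall>k. nd (x (k0 + k)) \<le> (1 - 1 / real d) ^ (k * (k - 1) div 2) * (1 / 2) ^ k * rate ^ k0 * nd x0))"
proof -
  define l where "l = ln (real d * \<kappa>)"
  note lb = log_bounds[of 1, simplified, folded l_def]
  define k1 where "k1 = nat \<lceil>2 * \<kappa> * ln (4 * (real d * \<kappa>))\<rceil>"
  define j1 where "j1 = nat \<lceil>real d * ln (8 * real d * \<kappa>\<^sup>2)\<rceil>"
  have k1: "2 * \<kappa> * ln (4 * (real d * \<kappa>)) \<le> real k1" "real k1 \<le> 2 * \<kappa> * ln (4 * (real d * \<kappa>)) + 1"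
    using d_kappa_ge_2 \<kappa>_ge_1 by (auto simp: k1_def)
  have j1: "real d * ln (8 * real d * \<kappa>\<^sup>2) \<le> real j1" "real j1 \<le> real d * ln (8 * real d * \<kappa>\<^sup>2) + 1"
  proof -
    have "1 * 1 \<le> (8 * real d) * \<kappa>\<^sup>2" using d2 \<kappa>_ge_1 by (intro mult_mono) auto
    then have "0 \<le> real d * ln (8 * real d * \<kappa>\<^sup>2)" by simp
    then show "real d * ln (8 * real d * \<kappa>\<^sup>2) \<le> real j1" "real j1 \<le> real d * ln (8 * real d * \<kappa>\<^sup>2) + 1"
      unfolding j1_def by linarith+
  qed
  have "0 \<le> \<kappa> * l" using d_kappa_ge_2 \<kappa>_ge_1 by (simp add: l_def)
  then have "real (k1 + j1) \<le> 11 * ((real d + \<kappa>) * l)"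
    using lb k1(2) j1(2) by (simp add: distrib_right)
  moreover have "nd (x (k1 + j1 + k)) \<le> (1 - 1 / real d) ^ (k * (k - 1) div 2) * (1 / 2) ^ k * rate ^ (k1 + j1) * nd x0"
    if a: "F0 \<in> carrier_mat d d" "transpose_mat F0 * F0 = minv (L \<cdot>\<^sub>m 1\<^sub>m d)"
      "qn_run rule d f M x0 (L \<cdot>\<^sub>m 1\<^sub>m d) F0 x G F s" "greedy_directions rule d f M x G F s" for F0 x G F s k
  proof -
    interpret qn_trajectory d f M \<mu> L \<kappa> x0 rule F0 x G F s
      by unfold_locales (use a unit_of_greedy[OF a(4)] in auto)
    show ?thesis by (rule greedy_superlinear[OF a(4) k1(1) j1(1)])
  qed
  ultimately show ?thesis unfolding l_def by blast
qed

section \<open>The uniform distribution on the sphere\<close>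

text \<open>Coordinate permutations combined with sign changes: a finite group of isometries that
  already determines the second moments of an invariant distribution on the sphere.\<close>

definition signed_perm :: "nat \<Rightarrow> (nat \<Rightarrow> real) \<Rightarrow> (nat \<Rightarrow> nat) \<Rightarrow> (nat \<Rightarrow> real) \<Rightarrow> nat \<Rightarrow> real" where
  "signed_perm d \<sigma> \<pi> y = (\<lambda>i\<in>{..<d}. \<sigma> i * y (\<pi> i))"

definition radial :: "nat \<Rightarrow> (nat \<Rightarrow> real) \<Rightarrow> nat \<Rightarrow> real" where
  "radial d y = (\<lambda>i\<in>{..<d}. y i / sqrt (\<Sum>j<d. (y j)\<^sup>2))"

abbreviation lebesgue_product :: "nat \<Rightarrow> (nat \<Rightarrow> real) measure" where
  "lebesgue_product d \<equiv> Pi\<^sub>M {..<d} (\<lambda>_. lborel)"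

definition unit_ball :: "nat \<Rightarrow> (nat \<Rightarrow> real) set" where
  "unit_ball d = {y \<in> space (lebesgue_product d). (\<Sum>i<d. (y i)\<^sup>2) \<le> 1}"

lemma sets_lebesgue_product: "sets (lebesgue_product d) = sets (Pi\<^sub>M {..<d} (\<lambda>_. borel))"
  by (rule sets_PiM_cong) auto

lemma space_lebesgue_product: "space (lebesgue_product d) = {..<d} \<rightarrow>\<^sub>E UNIV"
  by (simp add: space_PiM)

lemma unif_sphere_eq:
  "unif_sphere d = distr (uniform_measure (lebesgue_product d) (unit_ball d)) (Pi\<^sub>M {..<d} (\<lambda>_. borel)) (radial d)"
  unfolding unif_sphere_def unit_ball_def radial_def ..

lemma component_measurable [measurable]:
  "i < d \<Longrightarrow> (\<lambda>y. y i) \<in> borel_measurable (Pi\<^sub>M {..<d} (\<lambda>_. borel :: real measure))"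
  by (rule measurable_component_singleton) simp

lemma component_measurable' [measurable]:
  "i < d \<Longrightarrow> (\<lambda>y. y i) \<in> borel_measurable (lebesgue_product d)"
  using measurable_component_singleton[of i "{..<d}" "\<lambda>_. lborel"] by simp

lemma sum_sq_measurable [measurable]:
  "(\<lambda>y. \<Sum>i<d. (y i)\<^sup>2) \<in> borel_measurable (lebesgue_product d)"
  "(\<lambda>y. \<Sum>i<d. (y i)\<^sup>2) \<in> borel_measurable (Pi\<^sub>M {..<d} (\<lambda>_. borel :: real measure))"
  by (intro borel_measurable_sum borel_measurable_power component_measurable' component_measurable; simp)+

lemma unit_ball_sets [measurable]: "unit_ball d \<in> sets (lebesgue_product d)"
  unfolding unit_ball_def by measurable

lemma signed_perm_measurable:
  assumes "\<pi> permutes {..<d}"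
  shows "signed_perm d \<sigma> \<pi> \<in> measurable (Pi\<^sub>M {..<d} (\<lambda>_. borel)) (Pi\<^sub>M {..<d} (\<lambda>_. borel))"
  unfolding signed_perm_def
proof (rule measurable_restrict)
  fix i assume "i \<in> {..<d}"
  then have "\<pi> i < d" using permutes_in_image[OF assms, of i] by simp
  then show "(\<lambda>y. \<sigma> i * y (\<pi> i)) \<in> borel_measurable (Pi\<^sub>M {..<d} (\<lambda>_. borel))" by measurable
qed

lemma signed_perm_measurable':
  assumes "\<pi> permutes {..<d}"
  shows "signed_perm d \<sigma> \<pi> \<in> measurable (lebesgue_product d) (lebesgue_product d)"
  using signed_perm_measurable[OF assms] measurable_cong_sets[OF sets_lebesgue_product sets_lebesgue_product] by blast

lemma radial_measurable: "radial d \<in> measurable (lebesgue_product d) (Pi\<^sub>M {..<d} (\<lambda>_. borel))"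
  unfolding radial_def
proof (rule measurable_restrict)
  fix i assume "i \<in> {..<d}"
  then have [measurable]: "(\<lambda>y. y i) \<in> borel_measurable (lebesgue_product d)" by simp
  show "(\<lambda>y. y i / sqrt (\<Sum>j<d. (y j)\<^sup>2)) \<in> borel_measurable (lebesgue_product d)"
    by measurable
qed

lemma lborel_sign_invariant:
  assumes "s = 1 \<or> s = (-1 :: real)" "A \<in> sets lborel"
  shows "emeasure lborel ((\<lambda>r. s * r) -` A) = emeasure lborel A"
  using assms(1)
proof
  assume "s = -1"
  have "emeasure lborel A = emeasure (distr lborel borel uminus) A" by (simp add: lborel_distr_uminus)
  also have "\<dots> = emeasure lborel (uminus -` A)" using assms(2) by (subst emeasure_distr) auto
  finally show ?thesis using \<open>s = -1\<close> by (simp add: vimage_def)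
qed simp

lemma signed_perm_sum_sq:
  assumes "\<pi> permutes {..<d}" "\<And>i. \<sigma> i = 1 \<or> \<sigma> i = (-1 :: real)"
  shows "(\<Sum>i<d. (signed_perm d \<sigma> \<pi> y i)\<^sup>2) = (\<Sum>i<d. (y i)\<^sup>2)"
proof -
  have sq: "(\<sigma> i)\<^sup>2 = 1" for i using assms(2)[of i] by (auto simp: power2_eq_square)
  have "(\<Sum>i<d. (signed_perm d \<sigma> \<pi> y i)\<^sup>2) = (\<Sum>i<d. (y (\<pi> i))\<^sup>2)"
    by (intro sum.cong) (auto simp: signed_perm_def power_mult_distrib sq)
  also have "\<dots> = (\<Sum>i<d. (y i)\<^sup>2)"
    using sum.permute[OF assms(1), of "\<lambda>i. (y i)\<^sup>2"] by (simp add: o_def)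
  finally show ?thesis .
qed

text \<open>A product measure is determined by its values on boxes, and the preimage of a box is
  again a box, with sides permuted and possibly reflected.\<close>

lemma lebesgue_product_signed_perm:
  assumes \<pi>: "\<pi> permutes {..<d}" and \<sigma>: "\<And>i. \<sigma> i = 1 \<or> \<sigma> i = (-1 :: real)"
  shows "distr (lebesgue_product d) (lebesgue_product d) (signed_perm d \<sigma> \<pi>) = lebesgue_product d"
proof (rule product_sigma_finite.PiM_eqI)
  interpret product_sigma_finite "\<lambda>_ :: nat. lborel :: real measure" ..
  show "product_sigma_finite (\<lambda>_ :: nat. lborel :: real measure)" ..
  fix A :: "nat \<Rightarrow> real set" assume A: "\<And>i. i \<in> {..<d} \<Longrightarrow> A i \<in> sets lborel"
  let ?T = "signed_perm d \<sigma> \<pi>" and ?r = "inv_into UNIV \<pi>"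
  \<comment> \<open>Coordinate j of the argument is read by the output coordinate with index
    \<open>?r j\<close>, so its side is pulled back from that index.\<close>
  define B where "B j = (\<lambda>r. \<sigma> (?r j) * r) -` A (?r j)" for j
  have r: "?r permutes {..<d}" by (rule permutes_inv[OF \<pi>])
  have rj: "?r j < d" if "j < d" for j using permutes_in_image[OF r, of j] that by simp
  have \<pi>j: "\<pi> j < d" if "j < d" for j using permutes_in_image[OF \<pi>, of j] that by simp
  have B: "B j \<in> sets lborel" if "j < d" for j
  proof -
    have "(\<lambda>r. \<sigma> (?r j) * r) \<in> measurable borel borel" by measurable
    moreover have "A (?r j) \<in> sets borel" using A[of "?r j"] rj[OF that] by simp
    ultimately have "(\<lambda>r. \<sigma> (?r j) * r) -` A (?r j) \<inter> space borel \<in> sets borel" by (rule measurable_sets)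
    then show ?thesis by (simp add: B_def)
  qed
  have box: "?T -` (\<Pi>\<^sub>E i\<in>{..<d}. A i) \<inter> space (lebesgue_product d) = (\<Pi>\<^sub>E j\<in>{..<d}. B j)"
  proof (intro equalityI subsetI)
    fix y assume y: "y \<in> ?T -` (\<Pi>\<^sub>E i\<in>{..<d}. A i) \<inter> space (lebesgue_product d)"
    have "y j \<in> B j" if "j < d" for j
    proof -
      have "?T y (?r j) \<in> A (?r j)" using y rj[OF that] by (auto simp: PiE_def Pi_def)
      then show ?thesis using rj[OF that] permutes_inverses(1)[OF \<pi>] by (simp add: signed_perm_def B_def)
    qed
    then show "y \<in> (\<Pi>\<^sub>E j\<in>{..<d}. B j)" using y by (auto simp: space_lebesgue_product PiE_def Pi_def)
  next
    fix y assume y: "y \<in> (\<Pi>\<^sub>E j\<in>{..<d}. B j)"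
    have "?T y i \<in> A i" if "i < d" for i
    proof -
      have "y (\<pi> i) \<in> B (\<pi> i)" using y \<pi>j[OF that] by auto
      then show ?thesis using that permutes_inverses(2)[OF \<pi>] by (simp add: signed_perm_def B_def)
    qed
    then have "?T y \<in> (\<Pi>\<^sub>E i\<in>{..<d}. A i)" by (auto simp: PiE_def Pi_def signed_perm_def extensional_def)
    then show "y \<in> ?T -` (\<Pi>\<^sub>E i\<in>{..<d}. A i) \<inter> space (lebesgue_product d)"
      using y by (auto simp: space_lebesgue_product PiE_def)
  qed
  have AS: "(\<Pi>\<^sub>E i\<in>{..<d}. A i) \<in> sets (lebesgue_product d)" using A by (intro sets_PiM_I_finite) auto
  have "emeasure (distr (lebesgue_product d) (lebesgue_product d) ?T) (\<Pi>\<^sub>E i\<in>{..<d}. A i)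
      = emeasure (lebesgue_product d) (\<Pi>\<^sub>E j\<in>{..<d}. B j)"
    using emeasure_distr[OF signed_perm_measurable'[OF \<pi>] AS] box by simp
  also have "\<dots> = (\<Prod>j<d. emeasure lborel (B j))" using B by (intro emeasure_PiM) auto
  also have "\<dots> = (\<Prod>j<d. emeasure lborel (A (?r j)))"
    unfolding B_def using A rj \<sigma> by (intro prod.cong refl lborel_sign_invariant) auto
  also have "\<dots> = (\<Prod>i<d. emeasure lborel (A i))"
    using prod.permute[OF r, of "\<lambda>i. emeasure lborel (A i)"] by (simp add: o_def)
  finally show "emeasure (distr (lebesgue_product d) (lebesgue_product d) ?T) (\<Pi>\<^sub>E i\<in>{..<d}. A i)
      = (\<Prod>i<d. emeasure lborel (A i))" .
qed auto

lemma unif_ball_signed_perm: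
  assumes \<pi>: "\<pi> permutes {..<d}" and \<sigma>: "\<And>i. \<sigma> i = 1 \<or> \<sigma> i = (-1 :: real)"
  defines "W \<equiv> uniform_measure (lebesgue_product d) (unit_ball d)"
  shows "distr W (lebesgue_product d) (signed_perm d \<sigma> \<pi>) = W"
proof (rule measure_eqI)
  let ?P = "lebesgue_product d" and ?T = "signed_perm d \<sigma> \<pi>"
  have T: "?T \<in> measurable ?P ?P" by (rule signed_perm_measurable'[OF \<pi>])
  then have TW: "?T \<in> measurable W ?P" by (simp add: W_def measurable_def)
  show "sets (distr W ?P ?T) = sets W" by (simp add: W_def)
  fix A assume "A \<in> sets (distr W ?P ?T)"
  then have A: "A \<in> sets ?P" by simp
  have TA: "?T -` A \<inter> space ?P \<in> sets ?P" using T A by (rule measurable_sets)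
  have eq: "unit_ball d \<inter> (?T -` A \<inter> space ?P) = ?T -` (unit_ball d \<inter> A) \<inter> space ?P"
    using measurable_space[OF T] by (auto simp: unit_ball_def signed_perm_sum_sq[OF \<pi> \<sigma>])
  have "emeasure ?P (unit_ball d \<inter> (?T -` A \<inter> space ?P)) = emeasure (distr ?P ?P ?T) (unit_ball d \<inter> A)"
    unfolding eq using T A by (subst emeasure_distr) auto
  also have "\<dots> = emeasure ?P (unit_ball d \<inter> A)" by (simp add: lebesgue_product_signed_perm[OF \<pi> \<sigma>])
  finally show "emeasure (distr W ?P ?T) A = emeasure W A"
    using emeasure_distr[OF TW A] A TA
    by (simp add: W_def emeasure_uniform_measure)
qed

lemma radial_signed_perm:
  assumes \<pi>: "\<pi> permutes {..<d}" and \<sigma>: "\<And>i. \<sigma> i = 1 \<or> \<sigma> i = (-1 :: real)"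
  shows "radial d (signed_perm d \<sigma> \<pi> y) = signed_perm d \<sigma> \<pi> (radial d y)"
proof
  fix i
  have "\<pi> i < d" if "i < d" using permutes_in_image[OF \<pi>, of i] that by simp
  then show "radial d (signed_perm d \<sigma> \<pi> y) i = signed_perm d \<sigma> \<pi> (radial d y) i"
    unfolding radial_def signed_perm_sum_sq[OF \<pi> \<sigma>] by (simp add: signed_perm_def)
qed

text \<open>Signed permutations preserve the Euclidean norm. They therefore commute with the radial
  projection, and invariance passes from the ball to the sphere.\<close>

lemma unif_sphere_signed_perm:
  assumes \<pi>: "\<pi> permutes {..<d}" and \<sigma>: "\<And>i. \<sigma> i = 1 \<or> \<sigma> i = (-1 :: real)"
  shows "distr (unif_sphere d) (Pi\<^sub>M {..<d} (\<lambda>_. borel)) (signed_perm d \<sigma> \<pi>) = unif_sphere d"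
proof -
  let ?B = "Pi\<^sub>M {..<d} (\<lambda>_. borel :: real measure)" and ?T = "signed_perm d \<sigma> \<pi>" and ?P = "lebesgue_product d"
  define W where "W = uniform_measure ?P (unit_ball d)"
  have R: "radial d \<in> measurable W ?B" using radial_measurable by (simp add: W_def measurable_def)
  have TW: "?T \<in> measurable W ?P" using signed_perm_measurable'[OF \<pi>] by (simp add: W_def measurable_def)
  have "distr (distr W ?B (radial d)) ?B ?T = distr W ?B (?T \<circ> radial d)"
    by (rule distr_distr[OF signed_perm_measurable[OF \<pi>] R])
  also have "?T \<circ> radial d = radial d \<circ> ?T" using radial_signed_perm[OF \<pi> \<sigma>] by auto
  also have "distr W ?B (radial d \<circ> ?T) = distr (distr W ?P ?T) ?B (radial d)"
    by (rule distr_distr[OF radial_measurable TW, symmetric])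
  also have "distr W ?P ?T = W" unfolding W_def by (rule unif_ball_signed_perm[OF \<pi> \<sigma>])
  finally show ?thesis unfolding unif_sphere_eq W_def[symmetric] .
qed

text \<open>The ball lies between two cubes: half side 1/d is small enough, since d (1/d)^2 <= 1,
  and half side 1 is large enough.\<close>

lemma unit_ball_emeasure:
  assumes "1 \<le> d"
  shows "emeasure (lebesgue_product d) (unit_ball d) \<noteq> 0" "emeasure (lebesgue_product d) (unit_ball d) \<noteq> \<infinity>"
proof -
  interpret product_sigma_finite "\<lambda>_ :: nat. lborel :: real measure" ..
  let ?P = "lebesgue_product d"
  have box: "emeasure ?P (\<Pi>\<^sub>E i\<in>{..<d}. {-c..c}) = ennreal (2 * c) ^ d" if "0 \<le> c" for c :: real
    using that by (subst emeasure_PiM) (auto simp: prod_constant)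
  have c0: "1 / real d > 0" using assms by simp
  have "(\<Pi>\<^sub>E i\<in>{..<d}. {-(1 / real d)..1 / real d}) \<subseteq> unit_ball d"
  proof
    fix y assume y: "y \<in> (\<Pi>\<^sub>E i\<in>{..<d}. {-(1 / real d)..1 / real d})"
    have "(\<Sum>i<d. (y i)\<^sup>2) \<le> (\<Sum>i<d. (1 / real d)\<^sup>2)"
    proof (intro sum_mono)
      fix i assume "i \<in> {..<d}"
      then have "\<bar>y i\<bar> \<le> 1 / real d" using y by (fastforce simp: abs_le_iff)
      then have "\<bar>y i\<bar>\<^sup>2 \<le> (1 / real d)\<^sup>2" by (intro power_mono) auto
      then show "(y i)\<^sup>2 \<le> (1 / real d)\<^sup>2" by simp
    qed
    also have "\<dots> = 1 / real d" using assms by (simp add: power2_eq_square)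
    also have "\<dots> \<le> 1" using assms by simp
    finally show "y \<in> unit_ball d" using y by (auto simp: unit_ball_def space_lebesgue_product PiE_def)
  qed
  then have "ennreal (2 * (1 / real d)) ^ d \<le> emeasure ?P (unit_ball d)"
    using box[of "1 / real d"] c0 emeasure_mono[OF _ unit_ball_sets, of "\<Pi>\<^sub>E i\<in>{..<d}. {-(1 / real d)..1 / real d}" d] by simp
  moreover have "ennreal (2 * (1 / real d)) ^ d > 0"
    using c0 by (simp add: ennreal_power zero_less_power del: of_nat_Suc)
  ultimately show "emeasure ?P (unit_ball d) \<noteq> 0" by auto
  have "unit_ball d \<subseteq> (\<Pi>\<^sub>E i\<in>{..<d}. {-1..1})"
  proof
    fix y assume y: "y \<in> unit_ball d"
    have "y i \<in> {-1..1}" if "i < d" for i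
    proof -
      have "(y i)\<^sup>2 \<le> (\<Sum>i<d. (y i)\<^sup>2)" using that by (intro member_le_sum) auto
      then have "(y i)\<^sup>2 \<le> 1" using y by (simp add: unit_ball_def)
      then show ?thesis using abs_square_le_1[of "y i"] by (auto simp: abs_le_iff)
    qed
    then show "y \<in> (\<Pi>\<^sub>E i\<in>{..<d}. {-1..1})" using y by (auto simp: unit_ball_def space_lebesgue_product PiE_def)
  qed
  then have "emeasure ?P (unit_ball d) \<le> (ennreal 2) ^ d"
    using box[of 1] emeasure_mono[of "unit_ball d" "\<Pi>\<^sub>E i\<in>{..<d}. {-1..1}" ?P]
    by (simp add: sets_PiM_I_finite)
  also have "ennreal 2 ^ d = ennreal (2 ^ d)" by (rule ennreal_power) simp
  also have "\<dots> < \<infinity>" by simp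
  finally show "emeasure ?P (unit_ball d) \<noteq> \<infinity>" by simp
qed

lemma unif_sphere_prob_space:
  assumes "1 \<le> d"
  shows "prob_space (unif_sphere d)"
  unfolding unif_sphere_eq
proof (rule prob_space.prob_space_distr)
  show "prob_space (uniform_measure (lebesgue_product d) (unit_ball d))"
    by (rule prob_space_uniform_measure[OF unit_ball_emeasure[OF assms]])
  show "radial d \<in> measurable (uniform_measure (lebesgue_product d) (unit_ball d)) (Pi\<^sub>M {..<d} (\<lambda>_. borel))"
    using radial_measurable by (simp add: measurable_def)
qed

lemma sets_unif_sphere [measurable_cong]: "sets (unif_sphere d) = sets (Pi\<^sub>M {..<d} (\<lambda>_. borel))"
  by (simp add: unif_sphere_eq)

text \<open>Only almost everywhere: division by zero makes \<open>radial\<close> send the origin to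
  the zero vector, and the origin is a null set as d >= 1.\<close>

lemma unif_sphere_norm:
  assumes d: "1 \<le> d"
  shows "AE s in unif_sphere d. (\<Sum>i<d. (s i)\<^sup>2) = 1"
proof -
  interpret product_sigma_finite "\<lambda>_ :: nat. lborel :: real measure" ..
  let ?P = "lebesgue_product d" and ?B = "Pi\<^sub>M {..<d} (\<lambda>_. borel :: real measure)"
  define W where "W = uniform_measure ?P (unit_ball d)"
  have R: "radial d \<in> measurable W ?B" using radial_measurable by (simp add: W_def measurable_def)
  have meas: "{s \<in> space ?B. (\<Sum>i<d. (s i)\<^sup>2) = 1} \<in> sets ?B" by measurable
  have null: "(\<Pi>\<^sub>E i\<in>{..<d}. {0 :: real}) \<in> null_sets ?P"
  proof -
    have "emeasure ?P (\<Pi>\<^sub>E i\<in>{..<d}. {0 :: real}) = 0"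
      using d by (subst emeasure_PiM) (auto simp: prod_constant power_0_left)
    moreover have "(\<Pi>\<^sub>E i\<in>{..<d}. {0 :: real}) \<in> sets ?P" by (rule sets_PiM_I_finite) auto
    ultimately show ?thesis by (rule null_setsI)
  qed
  have "AE y in ?P. (\<Sum>i<d. (y i)\<^sup>2) \<noteq> 0"
  proof (rule AE_I'[OF null])
    show "{y \<in> space ?P. \<not> (\<Sum>i<d. (y i)\<^sup>2) \<noteq> 0} \<subseteq> (\<Pi>\<^sub>E i\<in>{..<d}. {0})"
      by (auto simp: space_lebesgue_product sum_nonneg_eq_0_iff PiE_def intro!: extensionalityI[where A = "{..<d}"])
  qed
  then have "AE y in W. (\<Sum>i<d. (y i)\<^sup>2) \<noteq> 0"
    unfolding W_def by (intro AE_uniform_measureI[OF unit_ball_sets]) auto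
  then have "AE y in W. (\<Sum>i<d. (radial d y i)\<^sup>2) = 1"
  proof (rule AE_mp, intro AE_I2 impI)
    fix y :: "nat \<Rightarrow> real" assume n: "(\<Sum>i<d. (y i)\<^sup>2) \<noteq> 0"
    have n0: "0 \<le> (\<Sum>i<d. (y i)\<^sup>2)" by (simp add: sum_nonneg)
    have "(\<Sum>i<d. (radial d y i)\<^sup>2) = (\<Sum>i<d. (y i)\<^sup>2 / (\<Sum>j<d. (y j)\<^sup>2))"
      by (intro sum.cong) (auto simp: radial_def power_divide n0)
    also have "\<dots> = 1" using n by (simp flip: sum_divide_distrib)
    finally show "(\<Sum>i<d. (radial d y i)\<^sup>2) = 1" .
  qed
  then show ?thesis
    unfolding unif_sphere_eq W_def[symmetric] using AE_distr_iff[OF R meas] by simp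
qed

text \<open>Flipping the sign of coordinate i negates the mixed moments, so they vanish. Exchanging
  coordinates shows that the d second moments agree, and they sum to 1.\<close>

lemma unif_sphere_moments:
  assumes d: "1 \<le> d" and i: "i < d" and j: "j < d"
  shows "integrable (unif_sphere d) (\<lambda>s. s i * s j)"
    "integral\<^sup>L (unif_sphere d) (\<lambda>s. s i * s j) = (if i = j then 1 / real d else 0)"
proof -
  interpret prob_space "unif_sphere d" by (rule unif_sphere_prob_space[OF d])
  let ?U = "unif_sphere d" and ?B = "Pi\<^sub>M {..<d} (\<lambda>_. borel :: real measure)"
  have meas: "(\<lambda>s. s i * s j) \<in> borel_measurable ?B" if "i < d" "j < d" for i j
    using that by measurable
  have int: "integrable ?U (\<lambda>s. s i * s j)" if ij: "i < d" "j < d" for i j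
  proof (rule integrable_const_bound[where B = 1])
    show "AE s in ?U. norm (s i * s j) \<le> 1"
      using unif_sphere_norm[OF d]
    proof (rule AE_mp, intro AE_I2 impI)
      fix s :: "nat \<Rightarrow> real" assume n: "(\<Sum>i<d. (s i)\<^sup>2) = 1"
      have "\<bar>s k\<bar> \<le> 1" if "k < d" for k
      proof -
        have "(s k)\<^sup>2 \<le> (\<Sum>i<d. (s i)\<^sup>2)" using that by (intro member_le_sum) auto
        then show ?thesis using n abs_square_le_1[of "s k"] by simp
      qed
      then have "\<bar>s i\<bar> * \<bar>s j\<bar> \<le> 1 * 1" using ij by (intro mult_mono) auto
      then show "norm (s i * s j) \<le> 1" by (simp add: abs_mult)
    qed
    show "(\<lambda>s. s i * s j) \<in> borel_measurable ?U" using meas[OF ij] by (simp cong: measurable_cong_sets)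
  qed
  show "integrable ?U (\<lambda>s. s i * s j)" by (rule int[OF i j])
  have sym: "integral\<^sup>L ?U (\<lambda>s. s i * s j) = integral\<^sup>L ?U (\<lambda>s. signed_perm d \<sigma> \<pi> s i * signed_perm d \<sigma> \<pi> s j)"
    if "\<pi> permutes {..<d}" "\<And>i. \<sigma> i = 1 \<or> \<sigma> i = (-1 :: real)" "i < d" "j < d" for \<pi> \<sigma> i j
  proof -
    have T: "signed_perm d \<sigma> \<pi> \<in> measurable ?U ?B"
      using signed_perm_measurable[OF that(1)] by (simp cong: measurable_cong_sets)
    have "integral\<^sup>L (distr ?U ?B (signed_perm d \<sigma> \<pi>)) (\<lambda>s. s i * s j)
        = integral\<^sup>L ?U (\<lambda>s. signed_perm d \<sigma> \<pi> s i * signed_perm d \<sigma> \<pi> s j)"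
      by (rule integral_distr[OF T meas[OF that(3,4)]])
    then show ?thesis unfolding unif_sphere_signed_perm[OF that(1,2)] .
  qed
  show "integral\<^sup>L ?U (\<lambda>s. s i * s j) = (if i = j then 1 / real d else 0)"
  proof (cases "i = j")
    case False
    have "integral\<^sup>L ?U (\<lambda>s. s i * s j) = integral\<^sup>L ?U (\<lambda>s. - (s i * s j))"
      using sym[OF permutes_id, of "\<lambda>k. if k = i then -1 else 1" i j] i j False by (simp add: signed_perm_def)
    then show ?thesis using False by simp
  next
    case True
    have eq: "integral\<^sup>L ?U (\<lambda>s. s k * s k) = integral\<^sup>L ?U (\<lambda>s. s i * s i)" if k: "k < d" for k
      using sym[OF permutes_swap_id[of k "{..<d}" i], of "\<lambda>_. 1" k k] i k by (simp add: signed_perm_def)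
    have "real d * integral\<^sup>L ?U (\<lambda>s. s i * s i) = (\<Sum>k<d. integral\<^sup>L ?U (\<lambda>s. s k * s k))"
      using eq by simp
    also have "\<dots> = integral\<^sup>L ?U (\<lambda>s. \<Sum>k<d. s k * s k)" using int by (subst Bochner_Integration.integral_sum) auto
    also have "\<dots> = integral\<^sup>L ?U (\<lambda>_. 1)"
    proof (rule integral_cong_AE)
      show "AE s in ?U. (\<Sum>k<d. s k * s k) = 1" using unif_sphere_norm[OF d] by (simp add: power2_eq_square)
      show "(\<lambda>s. \<Sum>k<d. s k * s k) \<in> borel_measurable ?U" using int by (intro borel_measurable_sum) auto
    qed simp
    also have "\<dots> = 1" by (simp add: prob_space)
    finally show ?thesis using True d by (simp add: field_simps)
  qed
qed

lemma unif_sphere_quadratic: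
  assumes d: "1 \<le> d" and Q: "Q \<in> carrier_mat d d"
  shows "integrable (unif_sphere d) (\<lambda>s. vec d s \<bullet> (Q *\<^sub>v vec d s))"
    "integral\<^sup>L (unif_sphere d) (\<lambda>s. vec d s \<bullet> (Q *\<^sub>v vec d s)) = tr Q / real d"
proof -
  have eq: "vec d s \<bullet> (Q *\<^sub>v vec d s) = (\<Sum>i<d. \<Sum>j<d. Q $$ (i, j) * (s i * s j))" for s :: "nat \<Rightarrow> real"
    using Q by (auto simp: scalar_prod_def atLeast0LessThan sum_distrib_left mult_ac intro!: sum.cong)
  note m = unif_sphere_moments[OF d]
  show "integrable (unif_sphere d) (\<lambda>s. vec d s \<bullet> (Q *\<^sub>v vec d s))"
    unfolding eq using m by (intro Bochner_Integration.integrable_sum integrable_mult_right) auto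
  have "integral\<^sup>L (unif_sphere d) (\<lambda>s. vec d s \<bullet> (Q *\<^sub>v vec d s))
      = (\<Sum>i<d. \<Sum>j<d. Q $$ (i, j) * integral\<^sup>L (unif_sphere d) (\<lambda>s. s i * s j))"
    unfolding eq
  proof (subst Bochner_Integration.integral_sum)
    show "integrable (unif_sphere d) (\<lambda>s. \<Sum>j<d. Q $$ (i, j) * (s i * s j))" if "i \<in> {..<d}" for i
      using m that by (intro Bochner_Integration.integrable_sum integrable_mult_right) auto
    show "(\<Sum>i<d. integral\<^sup>L (unif_sphere d) (\<lambda>s. \<Sum>j<d. Q $$ (i, j) * (s i * s j)))
        = (\<Sum>i<d. \<Sum>j<d. Q $$ (i, j) * integral\<^sup>L (unif_sphere d) (\<lambda>s. s i * s j))"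
      using m by (intro sum.cong refl) (subst Bochner_Integration.integral_sum, auto intro!: integrable_mult_right)
  qed
  also have "\<dots> = (\<Sum>i<d. \<Sum>j<d. if i = j then Q $$ (i, j) / real d else 0)"
    using m by (intro sum.cong refl) auto
  also have "\<dots> = tr Q / real d" using Q by (simp add: tr_def sum_divide_distrib)
  finally show "integral\<^sup>L (unif_sphere d) (\<lambda>s. vec d s \<bullet> (Q *\<^sub>v vec d s)) = tr Q / real d" .
qed

section \<open>Measurable vector- and matrix-valued functions\<close>

text \<open>Measurability is encoded entry by entry, with the dimension required only on the space
  of the measure, in keeping with vectors whose dimension is a number.\<close>

definition vec_measurable :: "nat \<Rightarrow> 'a measure \<Rightarrow> ('a \<Rightarrow> real vec) \<Rightarrow> bool" where
  "vec_measurable n N X \<longleftrightarrow> (\<forall>\<omega>\<in>space N. X \<omega> \<in> carrier_vec n) \<and>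
     (\<forall>i<n. (\<lambda>\<omega>. X \<omega> $ i) \<in> borel_measurable N)"

definition mat_measurable :: "nat \<Rightarrow> 'a measure \<Rightarrow> ('a \<Rightarrow> real mat) \<Rightarrow> bool" where
  "mat_measurable n N A \<longleftrightarrow> (\<forall>\<omega>\<in>space N. A \<omega> \<in> carrier_mat n n) \<and>
     (\<forall>i<n. \<forall>j<n. (\<lambda>\<omega>. A \<omega> $$ (i, j)) \<in> borel_measurable N)"

lemma vec_measurableI:
  assumes "\<And>\<omega>. \<omega> \<in> space N \<Longrightarrow> X \<omega> \<in> carrier_vec n"
    and "\<And>i \<omega>. i < n \<Longrightarrow> \<omega> \<in> space N \<Longrightarrow> X \<omega> $ i = Y i \<omega>"
    and "\<And>i. i < n \<Longrightarrow> Y i \<in> borel_measurable N"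
  shows "vec_measurable n N X"
  unfolding vec_measurable_def using assms measurable_cong[of N "\<lambda>\<omega>. X \<omega> $ i" "Y i" for i] by auto

lemma mat_measurableI:
  assumes "\<And>\<omega>. \<omega> \<in> space N \<Longrightarrow> A \<omega> \<in> carrier_mat n n"
    and "\<And>i j \<omega>. i < n \<Longrightarrow> j < n \<Longrightarrow> \<omega> \<in> space N \<Longrightarrow> A \<omega> $$ (i, j) = Y i j \<omega>"
    and "\<And>i j. i < n \<Longrightarrow> j < n \<Longrightarrow> Y i j \<in> borel_measurable N"
  shows "mat_measurable n N A"
  unfolding mat_measurable_def using assms measurable_cong[of N "\<lambda>\<omega>. A \<omega> $$ (i, j)" "Y i j" for i j] by auto

lemma vec_measurableD:
  assumes "vec_measurable n N X"
  shows "\<omega> \<in> space N \<Longrightarrow> X \<omega> \<in> carrier_vec n" "\<omega> \<in> space N \<Longrightarrow> dim_vec (X \<omega>) = n"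
    "i < n \<Longrightarrow> (\<lambda>\<omega>. X \<omega> $ i) \<in> borel_measurable N"
  using assms by (auto simp: vec_measurable_def)

lemma mat_measurableD:
  assumes "mat_measurable n N A"
  shows "\<omega> \<in> space N \<Longrightarrow> A \<omega> \<in> carrier_mat n n" "\<omega> \<in> space N \<Longrightarrow> dim_row (A \<omega>) = n"
    "\<omega> \<in> space N \<Longrightarrow> dim_col (A \<omega>) = n"
    "i < n \<Longrightarrow> j < n \<Longrightarrow> (\<lambda>\<omega>. A \<omega> $$ (i, j)) \<in> borel_measurable N"
  using assms by (auto simp: mat_measurable_def)

lemma scalar_prod_measurable:
  assumes X: "vec_measurable n N X" and Y: "vec_measurable n N Y"
  shows "(\<lambda>\<omega>. X \<omega> \<bullet> Y \<omega>) \<in> borel_measurable N"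
proof -
  have "(\<lambda>\<omega>. \<Sum>i<n. X \<omega> $ i * Y \<omega> $ i) \<in> borel_measurable N"
    by (intro borel_measurable_sum borel_measurable_times vec_measurableD(3)[OF X] vec_measurableD(3)[OF Y]) auto
  moreover have "(\<Sum>i<n. X \<omega> $ i * Y \<omega> $ i) = X \<omega> \<bullet> Y \<omega>" if "\<omega> \<in> space N" for \<omega>
    using vec_measurableD(2)[OF Y that] by (simp add: scalar_prod_def atLeast0LessThan)
  ultimately show ?thesis by (subst (asm) measurable_cong) auto
qed

lemma mult_mat_vec_measurable:
  assumes A: "mat_measurable n N A" and X: "vec_measurable n N X"
  shows "vec_measurable n N (\<lambda>\<omega>. A \<omega> *\<^sub>v X \<omega>)"
proof (rule vec_measurableI)
  show "A \<omega> *\<^sub>v X \<omega> \<in> carrier_vec n" if "\<omega> \<in> space N" for \<omega>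
    using mat_measurableD(2)[OF A that] by (intro carrier_vecI) simp
  show "(A \<omega> *\<^sub>v X \<omega>) $ i = (\<Sum>j<n. A \<omega> $$ (i, j) * X \<omega> $ j)" if "i < n" "\<omega> \<in> space N" for i \<omega>
    using mat_measurableD(2,3)[OF A that(2)] vec_measurableD(2)[OF X that(2)] that(1)
    by (simp add: scalar_prod_def atLeast0LessThan)
  show "(\<lambda>\<omega>. \<Sum>j<n. A \<omega> $$ (i, j) * X \<omega> $ j) \<in> borel_measurable N" if "i < n" for i
    by (intro borel_measurable_sum borel_measurable_times mat_measurableD(4)[OF A that] vec_measurableD(3)[OF X]) auto
qed

lemma vec_add_measurable:
  assumes X: "vec_measurable n N X" and Y: "vec_measurable n N Y"
  shows "vec_measurable n N (\<lambda>\<omega>. X \<omega> + Y \<omega>)" "vec_measurable n N (\<lambda>\<omega>. X \<omega> - Y \<omega>)"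
  by (rule vec_measurableI[where Y = "\<lambda>i \<omega>. X \<omega> $ i + Y \<omega> $ i"],
      use vec_measurableD(2,3)[OF X] vec_measurableD(2,3)[OF Y] in \<open>auto intro!: carrier_vecI\<close>)
    (rule vec_measurableI[where Y = "\<lambda>i \<omega>. X \<omega> $ i - Y \<omega> $ i"],
      use vec_measurableD(2,3)[OF X] vec_measurableD(2,3)[OF Y] in \<open>auto intro!: carrier_vecI\<close>)

lemma vec_smult_measurable:
  assumes X: "vec_measurable n N X" and c: "c \<in> borel_measurable N"
  shows "vec_measurable n N (\<lambda>\<omega>. c \<omega> \<cdot>\<^sub>v X \<omega>)"
  by (rule vec_measurableI[where Y = "\<lambda>i \<omega>. c \<omega> * X \<omega> $ i"])
    (use vec_measurableD(2,3)[OF X] c in \<open>auto intro!: carrier_vecI\<close>)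

lemma mat_add_measurable:
  assumes A: "mat_measurable n N A" and B: "mat_measurable n N B"
  shows "mat_measurable n N (\<lambda>\<omega>. A \<omega> + B \<omega>)" "mat_measurable n N (\<lambda>\<omega>. A \<omega> - B \<omega>)"
  by (rule mat_measurableI[where Y = "\<lambda>i j \<omega>. A \<omega> $$ (i, j) + B \<omega> $$ (i, j)"],
      use mat_measurableD[OF A] mat_measurableD[OF B] in auto)
    (rule mat_measurableI[where Y = "\<lambda>i j \<omega>. A \<omega> $$ (i, j) - B \<omega> $$ (i, j)"],
      use mat_measurableD[OF A] mat_measurableD[OF B] in auto)

lemma mat_smult_measurable:
  assumes A: "mat_measurable n N A" and c: "c \<in> borel_measurable N"
  shows "mat_measurable n N (\<lambda>\<omega>. c \<omega> \<cdot>\<^sub>m A \<omega>)"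
  by (rule mat_measurableI[where Y = "\<lambda>i j \<omega>. c \<omega> * A \<omega> $$ (i, j)"])
    (use mat_measurableD[OF A] c in auto)

lemma transpose_measurable:
  assumes A: "mat_measurable n N A"
  shows "mat_measurable n N (\<lambda>\<omega>. transpose_mat (A \<omega>))"
  by (rule mat_measurableI[where Y = "\<lambda>i j \<omega>. A \<omega> $$ (j, i)"])
    (use mat_measurableD[OF A] in auto)

lemma outer_prod_measurable:
  assumes X: "vec_measurable n N X" and Y: "vec_measurable n N Y"
  shows "mat_measurable n N (\<lambda>\<omega>. outer_prod (X \<omega>) (Y \<omega>))"
  by (rule mat_measurableI[where Y = "\<lambda>i j \<omega>. X \<omega> $ i * Y \<omega> $ j"])
    (use vec_measurableD(2,3)[OF X] vec_measurableD(2,3)[OF Y] in \<open>auto simp: outer_prod_def\<close>)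

lemma mat_mult_measurable:
  assumes A: "mat_measurable n N A" and B: "mat_measurable n N B"
  shows "mat_measurable n N (\<lambda>\<omega>. A \<omega> * B \<omega>)"
proof (rule mat_measurableI)
  show "A \<omega> * B \<omega> \<in> carrier_mat n n" if "\<omega> \<in> space N" for \<omega>
    using mat_measurableD(1)[OF A that] mat_measurableD(1)[OF B that] by simp
  show "(A \<omega> * B \<omega>) $$ (i, j) = (\<Sum>l<n. A \<omega> $$ (i, l) * B \<omega> $$ (l, j))" if "i < n" "j < n" "\<omega> \<in> space N" for i j \<omega>
    using mat_measurableD(2,3)[OF A that(3)] mat_measurableD(2,3)[OF B that(3)] that(1,2)
    by (simp add: scalar_prod_def atLeast0LessThan)
  show "(\<lambda>\<omega>. \<Sum>l<n. A \<omega> $$ (i, l) * B \<omega> $$ (l, j)) \<in> borel_measurable N" if "i < n" "j < n" for i j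
    by (intro borel_measurable_sum borel_measurable_times mat_measurableD(4)[OF A that(1)] mat_measurableD(4)[OF B _ that(2)]) auto
qed

lemma tr_measurable:
  assumes A: "mat_measurable n N A"
  shows "(\<lambda>\<omega>. tr (A \<omega>)) \<in> borel_measurable N"
proof -
  have "(\<lambda>\<omega>. \<Sum>i<n. A \<omega> $$ (i, i)) \<in> borel_measurable N"
    by (intro borel_measurable_sum mat_measurableD(4)[OF A]) auto
  moreover have "(\<Sum>i<n. A \<omega> $$ (i, i)) = tr (A \<omega>)" if "\<omega> \<in> space N" for \<omega>
    using mat_measurableD(2)[OF A that] by (simp add: tr_def)
  ultimately show ?thesis by (subst (asm) measurable_cong) auto
qed

lemma det_measurable:
  assumes A: "mat_measurable n N A"
  shows "(\<lambda>\<omega>. Determinant.det (A \<omega>)) \<in> borel_measurable N"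
proof -
  have p: "p i < n" if "p permutes {0..<n}" "i < n" for p i
    using permutes_in_image[OF that(1), of i] that(2) by simp
  have "(\<lambda>\<omega>. \<Sum>p | p permutes {0..<n}. of_int (sign p) * (\<Prod>i = 0..<n. A \<omega> $$ (i, p i))) \<in> borel_measurable N"
    by (intro borel_measurable_sum borel_measurable_times borel_measurable_prod borel_measurable_const mat_measurableD(4)[OF A])
      (use p in auto)
  moreover have "(\<Sum>p | p permutes {0..<n}. of_int (sign p) * (\<Prod>i = 0..<n. A \<omega> $$ (i, p i))) = Determinant.det (A \<omega>)"
    if "\<omega> \<in> space N" for \<omega>
    using mat_measurableD(2,3)[OF A that] by (simp add: Determinant.det_def)
  ultimately show ?thesis by (subst (asm) measurable_cong) auto
qed

lemma cofactor_measurable: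
  assumes A: "mat_measurable n N A" and ij: "i < n" "j < n"
  shows "(\<lambda>\<omega>. cofactor (A \<omega>) i j) \<in> borel_measurable N"
proof -
  have "mat_measurable (n - 1) N (\<lambda>\<omega>. mat_delete (A \<omega>) i j)"
  proof (rule mat_measurableI)
    show "mat_delete (A \<omega>) i j \<in> carrier_mat (n - 1) (n - 1)" if "\<omega> \<in> space N" for \<omega>
      using mat_measurableD(2,3)[OF A that] by (simp add: mat_delete_def)
    show "mat_delete (A \<omega>) i j $$ (i', j') =
        A \<omega> $$ (if i' < i then i' else Suc i', if j' < j then j' else Suc j')"
      if "i' < n - 1" "j' < n - 1" "\<omega> \<in> space N" for i' j' \<omega>
      using mat_measurableD(2,3)[OF A that(3)] that(1,2) by (simp add: mat_delete_def)
    show "(\<lambda>\<omega>. A \<omega> $$ (if i' < i then i' else Suc i', if j' < j then j' else Suc j')) \<in> borel_measurable N"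
      if "i' < n - 1" "j' < n - 1" for i' j'
      by (rule mat_measurableD(4)[OF A]) (use that ij in auto)
  qed
  then show ?thesis unfolding cofactor_def by (intro borel_measurable_times det_measurable) auto
qed

text \<open>Cramer's rule. It expresses the result of the elimination algorithm behind
  \<open>minv\<close> as a rational function of the entries, from which measurability is read
  off.\<close>

lemma minv_cofactor:
  assumes "pd n A" "i < n" "j < n"
  shows "minv A $$ (i, j) = cofactor A j i / Determinant.det A"
proof -
  have A: "A \<in> carrier_mat n n" using assms by (simp add: pd_def)
  have "Determinant.det A \<noteq> 0"
  proof
    assume "Determinant.det A = 0"
    then obtain v where v: "v \<in> carrier_vec n" "v \<noteq> 0\<^sub>v n" "A *\<^sub>v v = 0\<^sub>v n"
      using det_0_iff_vec_prod_zero_field[OF A] by auto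
    then have "v \<bullet> (A *\<^sub>v v) = 0" by simp
    with v assms show False by (auto simp: pd_def)
  qed
  then have "A * ((1 / Determinant.det A) \<cdot>\<^sub>m adj_mat A) = 1\<^sub>m n"
    using adj_mat[OF A] mult_smult_distrib[OF A adj_mat(1)[OF A]] by (auto intro!: eq_matI)
  then have "minv A = (1 / Determinant.det A) \<cdot>\<^sub>m adj_mat A"
    using adj_mat(1)[OF A] by (intro minv_eqI[OF A]) auto
  then show ?thesis using A assms(2,3) by (simp add: adj_mat_def)
qed

lemma minv_measurable:
  assumes A: "mat_measurable n N A" and pd: "\<And>\<omega>. \<omega> \<in> space N \<Longrightarrow> pd n (A \<omega>)"
  shows "mat_measurable n N (\<lambda>\<omega>. minv (A \<omega>))"
  by (rule mat_measurableI[where Y = "\<lambda>i j \<omega>. cofactor (A \<omega>) j i / Determinant.det (A \<omega>)"])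
    (use pd_minv[OF pd] minv_cofactor[OF pd] cofactor_measurable[OF A] det_measurable[OF A] in auto)

text \<open>The vector is embedded into the functions from nat to real with the product topology.
  There \<phi> composed with \<open>vec n\<close> is continuous, as it sees only finitely many
  coordinates.\<close>

lemma continuous_comp_measurable:
  assumes X: "vec_measurable n N X"
    and cont: "\<And>x \<epsilon>. x \<in> carrier_vec n \<Longrightarrow> 0 < \<epsilon> \<Longrightarrow>
      \<exists>\<delta>>0. \<forall>y\<in>carrier_vec n. vnorm (y - x) < \<delta> \<longrightarrow> \<bar>\<phi> y - \<phi> x\<bar> < (\<epsilon> :: real)"
  shows "(\<lambda>\<omega>. \<phi> (X \<omega>)) \<in> borel_measurable N"
proof -
  \<comment> \<open>Padding by zero makes every coordinate measurable; \<open>vec n\<close> discards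
    the padding again.\<close>
  define X' where "X' \<omega> = (\<lambda>i. if i < n then X \<omega> $ i else 0)" for \<omega>
  have "X' \<in> borel_measurable N"
  proof (rule measurable_coordinatewise_then_product)
    show "(\<lambda>\<omega>. X' \<omega> i) \<in> borel_measurable N" for i
      unfolding X'_def by (cases "i < n") (simp_all add: vec_measurableD(3)[OF X])
  qed
  moreover have "continuous_on UNIV (\<lambda>y. \<phi> (vec n y))"
    unfolding continuous_on_def
  proof (intro ballI tendstoI)
    fix y :: "nat \<Rightarrow> real" and \<epsilon> :: real assume "0 < \<epsilon>"
    then obtain \<delta> where \<delta>: "\<delta> > 0" and close: "\<And>y'. vnorm (vec n y' - vec n y) < \<delta> \<Longrightarrow> \<bar>\<phi> (vec n y') - \<phi> (vec n y)\<bar> < \<epsilon>"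
      using cont[of "vec n y" \<epsilon>] by auto
    have "continuous_on UNIV (\<lambda>y' :: nat \<Rightarrow> real. sqrt (\<Sum>i<n. (y' i - y i)\<^sup>2))"
      by (intro continuous_intros continuous_on_product_coordinates)
    then have "((\<lambda>y'. sqrt (\<Sum>i<n. (y' i - y i)\<^sup>2)) \<longlongrightarrow> sqrt (\<Sum>i<n. (y i - y i)\<^sup>2)) (at y)"
      unfolding continuous_on_def by blast
    then have "((\<lambda>y'. sqrt (\<Sum>i<n. (y' i - y i)\<^sup>2)) \<longlongrightarrow> 0) (at y)" by simp
    then have "\<forall>\<^sub>F y' in at y. dist (sqrt (\<Sum>i<n. (y' i - y i)\<^sup>2)) 0 < \<delta>" using \<delta> by (rule tendstoD)
    then show "\<forall>\<^sub>F y' in at y. dist (\<phi> (vec n y')) (\<phi> (vec n y)) < \<epsilon>"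
    proof (rule eventually_mono)
      fix y' :: "nat \<Rightarrow> real" assume "dist (sqrt (\<Sum>i<n. (y' i - y i)\<^sup>2)) 0 < \<delta>"
      moreover have "vnorm (vec n y' - vec n y) = sqrt (\<Sum>i<n. (y' i - y i)\<^sup>2)"
        by (simp add: vnorm_def scalar_prod_def atLeast0LessThan power2_eq_square)
      ultimately have "vnorm (vec n y' - vec n y) < \<delta>" by (simp add: dist_real_def)
      then show "dist (\<phi> (vec n y')) (\<phi> (vec n y)) < \<epsilon>" using close by (simp add: dist_real_def)
    qed
  qed
  then have "(\<lambda>y. \<phi> (vec n y)) \<in> borel_measurable borel" by (rule borel_measurable_continuous_onI)
  ultimately have "(\<lambda>\<omega>. \<phi> (vec n (X' \<omega>))) \<in> borel_measurable N" by (rule measurable_compose)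
  moreover have "vec n (X' \<omega>) = X \<omega>" if "\<omega> \<in> space N" for \<omega>
    using vec_measurableD(2)[OF X that] by (intro eq_vecI) (auto simp: X'_def)
  ultimately show ?thesis by (subst (asm) measurable_cong) auto
qed

lemma vec_index_le_vnorm:
  assumes "dim_vec v = d" "i < d"
  shows "\<bar>v $ i\<bar> \<le> vnorm v"
  using scalar_prod_le_vnorm[of "unit_vec d i" d v] assms
  by (simp add: scalar_prod_left_unit[OF carrier_vecI] vnorm_def scalar_prod_right_unit)

section \<open>Measurability of gradient, Hessian and Newton decrement\<close>

context objective
begin

lemma grad_comp_measurable:
  assumes X: "vec_measurable d N X"
  shows "vec_measurable d N (\<lambda>\<omega>. g (X \<omega>))"
  unfolding vec_measurable_def
proof (intro conjI ballI allI impI)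
  fix i assume i: "i < d"
  show "(\<lambda>\<omega>. g (X \<omega>) $ i) \<in> borel_measurable N"
  proof (rule continuous_comp_measurable[OF X])
    fix x :: "real vec" and \<epsilon> assume x: "x \<in> carrier_vec d" and \<epsilon>: "0 < (\<epsilon> :: real)"
    have ed: "dim_vec (unit_vec d i :: real vec) = d" by simp
    \<comment> \<open>Entry i of the gradient changes by at most the norm of row i of the Hessian
      plus 1, times the displacement; the 1 bounds the remainder of differentiability with
      \<epsilon> = 1.\<close>
    define K where "K = vnorm (H x *\<^sub>v unit_vec d i) + 1"
    have K: "K > 0" unfolding K_def by (simp add: add_nonneg_pos)
    obtain \<delta> where \<delta>: "\<delta> > 0" and lin: "\<And>k. k \<in> carrier_vec d \<Longrightarrow> vnorm k < \<delta> \<Longrightarrow>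
        vnorm (g (x + k) - g x - H x *\<^sub>v k) \<le> 1 * vnorm k"
    proof -
      have "\<forall>\<epsilon>>0. \<exists>\<delta>>0. \<forall>k\<in>carrier_vec d. vnorm k < \<delta> \<longrightarrow> vnorm (g (x + k) - g x - H x *\<^sub>v k) \<le> \<epsilon> * vnorm k"
        using hess_jacobian[OF x] by (simp add: has_jacobian_def)
      from this[rule_format, of 1] show ?thesis using that by auto
    qed
    show "\<exists>\<delta>>0. \<forall>y\<in>carrier_vec d. vnorm (y - x) < \<delta> \<longrightarrow> \<bar>g y $ i - g x $ i\<bar> < \<epsilon>"
    proof (intro exI[of _ "min \<delta> (\<epsilon> / K)"] conjI ballI impI)
      show "0 < min \<delta> (\<epsilon> / K)" using \<delta> \<epsilon> K by simp
      fix y assume y: "y \<in> carrier_vec d" and n: "vnorm (y - x) < min \<delta> (\<epsilon> / K)"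
      let ?k = "y - x"
      have kd: "dim_vec ?k = d" using x by simp
      have xk: "x + ?k = y" using x y by (intro eq_vecI) auto
      let ?r = "g y - g x - H x *\<^sub>v ?k"
      have rd: "dim_vec ?r = d" using hess_dims[OF x] by simp
      have r: "vnorm ?r \<le> vnorm ?k" using lin[of ?k] n x y unfolding xk by simp
      have "(H x *\<^sub>v ?k) $ i = unit_vec d i \<bullet> (H x *\<^sub>v ?k)"
        using i hess_dims[OF x] by (subst scalar_prod_left_unit[of _ d]) (auto intro!: carrier_vecI)
      also have "\<dots> = ?k \<bullet> (H x *\<^sub>v unit_vec d i)"
        using hess_pd[OF x] kd unfolding pd_def by (intro sym_bilinear[of _ d]) auto
      finally have "\<bar>(H x *\<^sub>v ?k) $ i\<bar> \<le> vnorm ?k * (K - 1)"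
        using scalar_prod_le_vnorm[OF kd, of "H x *\<^sub>v unit_vec d i"] hess_dims[OF x] by (simp add: K_def)
      moreover have "\<bar>?r $ i\<bar> \<le> vnorm ?k" using vec_index_le_vnorm[OF rd i] r by linarith
      moreover have "g y $ i - g x $ i = ?r $ i + (H x *\<^sub>v ?k) $ i"
        using i hess_dims[OF x] grad_carrier[OF x] grad_carrier[OF y] by simp
      ultimately have "\<bar>g y $ i - g x $ i\<bar> \<le> vnorm ?k * K" by (simp add: algebra_simps)
      also have "\<dots> < \<epsilon>" using n K by (simp add: pos_less_divide_eq)
      finally show "\<bar>g y $ i - g x $ i\<bar> < \<epsilon>" .
    qed
  qed
qed (use grad_carrier vec_measurableD(1)[OF X] in auto)

text \<open>Self-concordance bounds the difference of Hessians from both sides by a multiple of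
  \<open>H x\<close>, and polarisation passes from the form to its entries. The factor
  \<open>sqrt L\<close> comes from the local norm of y - x, the factor L from
  \<open>H x\<close>.\<close>

lemma hess_entry_lipschitz:
  assumes x: "x \<in> carrier_vec d" and y: "y \<in> carrier_vec d" and ij: "i < d" "j < d"
  shows "\<bar>H y $$ (i, j) - H x $$ (i, j)\<bar> \<le> M * L * sqrt L * vnorm (y - x)"
proof -
  let ?B = "H y - H x"
  define c where "c = M * L * sqrt L * vnorm (y - x)"
  have kd: "dim_vec (y - x) = d" using x by simp
  have Hc: "H x \<in> carrier_mat d d" "transpose_mat (H x) = H x" "H y \<in> carrier_mat d d" "transpose_mat (H y) = H y"
    using hess_pd[OF x] hess_pd[OF y] by (auto simp: pd_def)
  have B: "?B \<in> carrier_mat d d" "transpose_mat ?B = ?B" using Hc by (auto simp: transpose_minus)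
  have I: "psd d (1\<^sub>m d)" unfolding psd_def by (auto intro: scalar_prod_self_nonneg)
  have ln: "local_norm d f x v \<le> sqrt L * vnorm v" if "dim_vec v = d" for v
    using real_sqrt_le_mono[OF hess_bounds(2)[OF x that]] by (simp add: local_norm_def vnorm_def real_sqrt_mult)
  have "x - y = (-1) \<cdot>\<^sub>v (y - x)" using x y by (intro eq_vecI) auto
  then have lnxy: "local_norm d f x (x - y) = local_norm d f x (y - x)" using local_norm_smult[OF x kd, of "-1"] by simp
  have "\<bar>h \<bullet> (?B *\<^sub>v h)\<bar> \<le> c * (h \<bullet> (1\<^sub>m d *\<^sub>v h))" if h: "h \<in> carrier_vec d" for h
  proof -
    have hd: "dim_vec h = d" using h by simp
    have b: "M * local_norm d f x (y - x) * (h \<bullet> (H x *\<^sub>v h)) \<le> M * (sqrt L * vnorm (y - x)) * (L * (h \<bullet> h))"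
      using ln[OF kd] hess_bounds(2)[OF x hd] M L local_norm_nonneg[OF x kd] psdD[OF pd_imp_psd[OF hess_pd[OF x]] hd]
      by (intro mult_mono mult_left_mono) auto
    have "h \<bullet> (?B *\<^sub>v h) = h \<bullet> (H y *\<^sub>v h) - h \<bullet> (H x *\<^sub>v h)"
      using hd hess_dims[OF x] hess_dims[OF y] by (simp add: mat_vec_simps)
    moreover have "c * (h \<bullet> (1\<^sub>m d *\<^sub>v h)) = M * (sqrt L * vnorm (y - x)) * (L * (h \<bullet> h))"
      using h by (simp add: c_def)
    ultimately show ?thesis
      using hess_compare[OF x y x x hd] hess_compare[OF y x x x hd] b unfolding lnxy by linarith
  qed
  from two_sided_Cauchy_Schwarz[OF I B this, of "unit_vec d i" "unit_vec d j"]
  have "\<bar>unit_vec d i \<bullet> (?B *\<^sub>v unit_vec d j)\<bar> \<le> c"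
    using ij M L by (simp add: c_def scalar_prod_right_unit)
  then show ?thesis using unit_vec_quadratic[OF B(1) ij] ij Hc by (simp add: c_def)
qed

lemma hess_comp_measurable:
  assumes X: "vec_measurable d N X"
  shows "mat_measurable d N (\<lambda>\<omega>. H (X \<omega>))"
  unfolding mat_measurable_def
proof (intro conjI ballI allI impI)
  fix i j assume ij: "i < d" "j < d"
  show "(\<lambda>\<omega>. H (X \<omega>) $$ (i, j)) \<in> borel_measurable N"
  proof (rule continuous_comp_measurable[OF X])
    fix x :: "real vec" and \<epsilon> assume x: "x \<in> carrier_vec d" and \<epsilon>: "0 < (\<epsilon> :: real)"
    define c where "c = M * L * sqrt L"
    have c: "c > 0" using M L by (simp add: c_def)
    show "\<exists>\<delta>>0. \<forall>y\<in>carrier_vec d. vnorm (y - x) < \<delta> \<longrightarrow> \<bar>H y $$ (i, j) - H x $$ (i, j)\<bar> < \<epsilon>"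
    proof (intro exI[of _ "\<epsilon> / c"] conjI ballI impI)
      show "0 < \<epsilon> / c" using c \<epsilon> by simp
      fix y assume y: "y \<in> carrier_vec d" and n: "vnorm (y - x) < \<epsilon> / c"
      have "\<bar>H y $$ (i, j) - H x $$ (i, j)\<bar> \<le> c * vnorm (y - x)"
        unfolding c_def by (rule hess_entry_lipschitz[OF x y ij])
      also have "\<dots> < \<epsilon>" using n c by (simp add: pos_less_divide_eq mult.commute)
      finally show "\<bar>H y $$ (i, j) - H x $$ (i, j)\<bar> < \<epsilon>" .
    qed
  qed
qed (use hess_pd vec_measurableD(1)[OF X] in \<open>auto simp: pd_def\<close>)

lemma nd_comp_measurable:
  assumes X: "vec_measurable d N X"
  shows "(\<lambda>\<omega>. nd (X \<omega>)) \<in> borel_measurable N"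
  unfolding newton_decrement_def
  by (rule measurable_compose[OF _ borel_measurable_sqrt], intro scalar_prod_measurable[of d] mult_mat_vec_measurable minv_measurable
      hess_comp_measurable grad_comp_measurable X hess_pd vec_measurableD(1)[OF X])

lemma local_norm_measurable:
  assumes X: "vec_measurable d N X" and Y: "vec_measurable d N Y"
  shows "(\<lambda>\<omega>. local_norm d f (X \<omega>) (Y \<omega>)) \<in> borel_measurable N"
  unfolding local_norm_def
  by (rule measurable_compose[OF _ borel_measurable_sqrt], intro scalar_prod_measurable[of d] mult_mat_vec_measurable hess_comp_measurable X Y)

end

section \<open>Random methods\<close>

lemma vec_measurable_cong:
  "vec_measurable n N Y \<Longrightarrow> (\<And>\<omega>. \<omega> \<in> space N \<Longrightarrow> X \<omega> = Y \<omega>) \<Longrightarrow> vec_measurable n N X"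
  unfolding vec_measurable_def by (simp cong: measurable_cong)

lemma mat_measurable_cong:
  "mat_measurable n N Y \<Longrightarrow> (\<And>\<omega>. \<omega> \<in> space N \<Longrightarrow> X \<omega> = Y \<omega>) \<Longrightarrow> mat_measurable n N X"
  unfolding mat_measurable_def by (simp cong: measurable_cong)

text \<open>The processes are arbitrary functions of the sample point that satisfy the recursion;
  adaptedness and measurability are derived from it.\<close>

locale qn_random = qn_problem +
  fixes F0 :: "real mat" and x :: "(nat \<Rightarrow> nat \<Rightarrow> real) \<Rightarrow> nat \<Rightarrow> real vec"
    and G F :: "(nat \<Rightarrow> nat \<Rightarrow> real) \<Rightarrow> nat \<Rightarrow> real mat"
  assumes F0: "F0 \<in> carrier_mat d d" "transpose_mat F0 * F0 = minv (L \<cdot>\<^sub>m 1\<^sub>m d)"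
    and run: "\<And>\<omega>. \<omega> \<in> space (direction_space d) \<Longrightarrow>
      qn_run rule d f M x0 (L \<cdot>\<^sub>m 1\<^sub>m d) F0 (x \<omega>) (G \<omega>) (F \<omega>) (directions d \<omega>)"
begin

abbreviation "U \<equiv> unif_sphere d"
abbreviation "S \<equiv> direction_space d"

text \<open>The event of probability one on which all directions have unit length, so that each
  sample point yields a deterministic trajectory in the sense of
  \<open>qn_trajectory\<close>.\<close>

definition \<Omega> :: "(nat \<Rightarrow> nat \<Rightarrow> real) set" where
  "\<Omega> = {\<omega> \<in> space S. \<forall>k. (\<Sum>i<d. (\<omega> k i)\<^sup>2) = 1}"

lemma prob_space_U: "prob_space U"
  using unif_sphere_prob_space d2 by simp

lemma prob_space_S: "prob_space S"
  unfolding direction_space_def by (rule prob_space_PiM) (rule prob_space_U)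

lemma space_S: "\<omega> \<in> space S \<longleftrightarrow> (\<forall>k. \<omega> k \<in> space U)"
  by (auto simp: direction_space_def space_PiM PiE_def Pi_def)

lemma direction_measurable: "i < d \<Longrightarrow> (\<lambda>\<omega>. \<omega> k i) \<in> borel_measurable S"
proof -
  assume i: "i < d"
  have "(\<lambda>\<omega>. \<omega> k) \<in> measurable S U" unfolding direction_space_def by (rule measurable_component_singleton) simp
  moreover have "(\<lambda>s. s i) \<in> borel_measurable U" using component_measurable[OF i] by (simp cong: measurable_cong_sets add: sets_unif_sphere)
  ultimately show ?thesis by (rule measurable_compose)
qed

lemma \<Omega>_sets: "\<Omega> \<in> sets S"
proof -
  have "(\<lambda>\<omega>. \<Sum>i<d. (\<omega> k i)\<^sup>2) \<in> borel_measurable S" for k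
    by (intro borel_measurable_sum borel_measurable_power direction_measurable) simp
  then have "{\<omega> \<in> space S. (\<Sum>i<d. (\<omega> k i)\<^sup>2) = 1} \<in> sets S" for k by measurable
  then show ?thesis unfolding \<Omega>_def by (rule sets.sets_Collect_countable_All)
qed

lemma \<Omega>_AE: "AE \<omega> in S. \<omega> \<in> \<Omega>"
proof -
  have "AE \<omega> in S. (\<Sum>i<d. (\<omega> k i)\<^sup>2) = 1" for k
    unfolding direction_space_def
    by (rule AE_PiM_component[OF prob_space_U UNIV_I]) (use unif_sphere_norm d2 in simp)
  then have "AE \<omega> in S. \<forall>k. (\<Sum>i<d. (\<omega> k i)\<^sup>2) = 1" by (subst AE_all_countable) simp
  then show ?thesis using AE_space by eventually_elim (simp add: \<Omega>_def)
qed

lemma trajectory: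
  assumes "\<omega> \<in> \<Omega>"
  shows "qn_trajectory d f M \<mu> L \<kappa> x0 rule F0 (x \<omega>) (G \<omega>) (F \<omega>) (directions d \<omega>)"
proof unfold_locales
  show "directions d \<omega> k \<in> carrier_vec d" for k by (simp add: directions_def)
  show "directions d \<omega> k \<bullet> directions d \<omega> k = 1" for k
    using assms by (simp add: \<Omega>_def directions_def scalar_prod_def atLeast0LessThan power2_eq_square)
  show "qn_run rule d f M x0 (L \<cdot>\<^sub>m 1\<^sub>m d) F0 (x \<omega>) (G \<omega>) (F \<omega>) (directions d \<omega>)"
    using assms by (intro run) (simp add: \<Omega>_def)
qed (use F0 in auto)

definition Rho :: "(nat \<Rightarrow> nat \<Rightarrow> real) \<Rightarrow> nat \<Rightarrow> real" where
  "Rho \<omega> k = qn_trajectory.rho d f M \<mu> \<kappa> rule (x \<omega>) (G \<omega>) k"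

text \<open>The recursion is deterministic given the directions, so the state at time k is a
  function of the first k of them. This takes the place of a filtration; \<open>F\<close> is covered
  for BFGS only, where the recursion determines it.\<close>

lemma adapted:
  assumes \<omega>: "\<omega> \<in> space S" "\<omega>' \<in> space S"
  shows "(\<And>j. j < k \<Longrightarrow> \<omega> j = \<omega>' j) \<Longrightarrow>
    x \<omega> k = x \<omega>' k \<and> G \<omega> k = G \<omega>' k \<and> (rule = BFGS \<longrightarrow> F \<omega> k = F \<omega>' k)"
proof (induction k)
  case 0
  then show ?case using run[OF \<omega>(1)] run[OF \<omega>(2)] by (simp add: qn_run_def)
next
  case (Suc k)
  then have IH: "x \<omega> k = x \<omega>' k" "G \<omega> k = G \<omega>' k" "rule = BFGS \<Longrightarrow> F \<omega> k = F \<omega>' k" and s: "\<omega> k = \<omega>' k"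
    by auto
  have r: "x \<omega> (Suc k) = x \<omega> k - minv (G \<omega> k) *\<^sub>v g (x \<omega> k)" "qn_update rule d f M (x \<omega>) (G \<omega>) (F \<omega>) (directions d \<omega>) k"
    "x \<omega>' (Suc k) = x \<omega>' k - minv (G \<omega>' k) *\<^sub>v g (x \<omega>' k)" "qn_update rule d f M (x \<omega>') (G \<omega>') (F \<omega>') (directions d \<omega>') k"
    using run[OF \<omega>(1)] run[OF \<omega>(2)] by (auto simp: qn_run_def)
  have x: "x \<omega> (Suc k) = x \<omega>' (Suc k)" using r(1,3) IH by simp
  show ?case
  proof (cases rule)
    case SR1
    have "G \<omega> (Suc k) = G \<omega>' (Suc k)"
      using r(2,4) unfolding qn_update_def Let_def scaled_G_def qn_scale_def directions_def SR1 by (simp add: IH x s)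
    then show ?thesis using x SR1 by simp
  next
    case BFGS
    have "G \<omega> (Suc k) = G \<omega>' (Suc k)" "F \<omega> (Suc k) = F \<omega>' (Suc k)"
      using r(2,4) IH(3)[OF BFGS]
      unfolding qn_update_def Let_def scaled_G_def scaled_F_def qn_scale_def directions_def BFGS
      by (simp_all add: IH(1,2) x s)
    then show ?thesis using x by simp
  qed
qed

lemma upd_\<Omega>: "\<omega> \<in> \<Omega> \<Longrightarrow> s \<in> space U \<Longrightarrow> (\<Sum>i<d. (s i)\<^sup>2) = 1 \<Longrightarrow> fun_upd \<omega> k s \<in> \<Omega>"
  by (auto simp: \<Omega>_def space_S)

text \<open>The right-hand side depends on the new direction \<open>s\<close> only through the quadratic form.\<close>

lemma Rho_upd:
  assumes \<omega>: "\<omega> \<in> \<Omega>" and s: "s \<in> space U" "(\<Sum>i<d. (s i)\<^sup>2) = 1"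
  shows "0 \<le> Rho (fun_upd \<omega> k s) (Suc k)"
    "Rho (fun_upd \<omega> k s) (Suc k) \<le> qn_trajectory.thetat d f M \<mu> rule (x \<omega>) (G \<omega>) k
      - vec d s \<bullet> (qn_trajectory.Q d f M \<mu> rule (x \<omega>) (G \<omega>) (F \<omega>) k *\<^sub>v vec d s)
      + 2 * (real d * \<kappa>) * (M * nd (x \<omega> (Suc k)))"
proof -
  let ?\<omega> = "fun_upd \<omega> k s"
  interpret T: qn_trajectory d f M \<mu> L \<kappa> x0 rule F0 "x \<omega>" "G \<omega>" "F \<omega>" "directions d \<omega>"
    by (rule trajectory[OF \<omega>])
  interpret T': qn_trajectory d f M \<mu> L \<kappa> x0 rule F0 "x ?\<omega>" "G ?\<omega>" "F ?\<omega>" "directions d ?\<omega>"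
    by (rule trajectory[OF upd_\<Omega>[OF \<omega> s]])
  show "0 \<le> Rho ?\<omega> (Suc k)" unfolding Rho_def by (rule T'.rho_nonneg)
  have sp: "\<omega> \<in> space S" "?\<omega> \<in> space S" using \<omega> upd_\<Omega>[OF \<omega> s] by (auto simp: \<Omega>_def)
  have eq: "x ?\<omega> k = x \<omega> k" "G ?\<omega> k = G \<omega> k" "rule = BFGS \<Longrightarrow> F ?\<omega> k = F \<omega> k"
    using adapted[OF sp, of k] by auto
  \<comment> \<open>The step to the next point uses only the state at time k. The new Hessian and
    the scaling therefore do not see direction k either.\<close>
  have xS: "x ?\<omega> (Suc k) = x \<omega> (Suc k)"
    using run[OF sp(1)] run[OF sp(2)] eq by (simp add: qn_run_def)
  have A: "T'.A k = T.A k" by (simp add: T.A_def T'.A_def xS)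
  have c: "T'.c k = T.c k" by (simp add: T.c_def T'.c_def qn_scale_def xS eq)
  have Gt: "T'.Gt k = T.Gt k" by (simp add: T.Gt_def T'.Gt_def c eq)
  have th: "T'.thetat k = T.thetat k \<and> T'.Q k = T.Q k"
  proof (cases rule)
    case SR1
    show ?thesis unfolding T.SR1_simps[OF SR1] T'.SR1_simps[OF SR1] A Gt by simp
  next
    case BFGS
    have "T'.Ft k = T.Ft k" by (simp add: T.Ft_def T'.Ft_def c eq(3)[OF BFGS])
    then show ?thesis unfolding T.BFGS_simps[OF BFGS] T'.BFGS_simps[OF BFGS] A Gt by simp
  qed
  have "directions d ?\<omega> k = vec d s" by (simp add: directions_def)
  then have "T'.theta (Suc k) \<le> T.thetat k - vec d s \<bullet> (T.Q k *\<^sub>v vec d s)"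
    using T'.theta_Suc[of k] th by simp
  moreover have "T'.lam (Suc k) = nd (x \<omega> (Suc k))" by (simp add: T'.lam_def xS)
  ultimately show "Rho ?\<omega> (Suc k) \<le> T.thetat k - vec d s \<bullet> (T.Q k *\<^sub>v vec d s)
      + 2 * (real d * \<kappa>) * (M * nd (x \<omega> (Suc k)))"
    unfolding Rho_def T'.rho_def by simp
qed

subsection \<open>Measurability of the iterates\<close>

abbreviation "N \<equiv> restrict_space S \<Omega>"

lemma space_N: "space N = \<Omega>"
  by (auto simp: space_restrict_space \<Omega>_def)

lemma N_space: "\<omega> \<in> space N \<Longrightarrow> \<omega> \<in> space S"
  by (simp add: space_restrict_space)

lemma directions_measurable: "vec_measurable d N (\<lambda>\<omega>. directions d \<omega> k)"
proof (rule vec_measurableI)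
  show "directions d \<omega> k \<in> carrier_vec d" for \<omega> by (simp add: directions_def)
  show "directions d \<omega> k $ i = \<omega> k i" if "i < d" for \<omega> i using that by (simp add: directions_def)
  show "(\<lambda>\<omega>. \<omega> k i) \<in> borel_measurable N" if "i < d" for i
    by (rule measurable_restrict_space1[OF direction_measurable[OF that]])
qed

lemma state_measurable:
  "vec_measurable d N (\<lambda>\<omega>. x \<omega> k) \<and> mat_measurable d N (\<lambda>\<omega>. G \<omega> k) \<and>
   (rule = BFGS \<longrightarrow> mat_measurable d N (\<lambda>\<omega>. F \<omega> k))"
proof (induction k)
  case 0
  have i: "x \<omega> 0 = x0" "G \<omega> 0 = L \<cdot>\<^sub>m 1\<^sub>m d" "F \<omega> 0 = F0" if "\<omega> \<in> space N" for \<omega>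
    using run[OF N_space[OF that]] by (auto simp: qn_run_def)
  have "vec_measurable d N (\<lambda>\<omega>. x0)" "mat_measurable d N (\<lambda>\<omega>. L \<cdot>\<^sub>m 1\<^sub>m d)" "mat_measurable d N (\<lambda>\<omega>. F0)"
    using x0 F0(1) by (simp_all add: vec_measurable_def mat_measurable_def)
  then show ?case
    using vec_measurable_cong[of d N "\<lambda>\<omega>. x0" "\<lambda>\<omega>. x \<omega> 0"]
      mat_measurable_cong[of d N "\<lambda>\<omega>. L \<cdot>\<^sub>m 1\<^sub>m d" "\<lambda>\<omega>. G \<omega> 0"]
      mat_measurable_cong[of d N "\<lambda>\<omega>. F0" "\<lambda>\<omega>. F \<omega> 0"] i by simp
next
  case (Suc k)
  then have X: "vec_measurable d N (\<lambda>\<omega>. x \<omega> k)" and Gm: "mat_measurable d N (\<lambda>\<omega>. G \<omega> k)"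
    and Fm: "rule = BFGS \<Longrightarrow> mat_measurable d N (\<lambda>\<omega>. F \<omega> k)" by auto
  have T: "qn_trajectory d f M \<mu> L \<kappa> x0 rule F0 (x \<omega>) (G \<omega>) (F \<omega>) (directions d \<omega>)" if "\<omega> \<in> space N" for \<omega>
    by (rule trajectory) (use that in \<open>simp only: space_N\<close>)
  have step: "x \<omega> (Suc k) = x \<omega> k - minv (G \<omega> k) *\<^sub>v g (x \<omega> k)" if "\<omega> \<in> space N" for \<omega>
    using run[OF N_space[OF that]] by (auto simp: qn_run_def)
  \<comment> \<open>This is why the induction runs on the restriction to \<Omega>: there the
    invariants of a trajectory hold, and inverses of positive definite matrices are
    measurable.\<close>
  have Gpd: "pd d (G \<omega> k)" if "\<omega> \<in> space N" for \<omega>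
  proof -
    interpret qn_trajectory d f M \<mu> L \<kappa> x0 rule F0 "x \<omega>" "G \<omega>" "F \<omega>" "directions d \<omega>" by (rule T[OF that])
    show ?thesis by (rule Gk_pd[OF good])
  qed
  have "vec_measurable d N (\<lambda>\<omega>. x \<omega> k - minv (G \<omega> k) *\<^sub>v g (x \<omega> k))"
    by (rule vec_add_measurable(2)[OF X mult_mat_vec_measurable[OF minv_measurable[OF Gm Gpd] grad_comp_measurable[OF X]]])
  then have XS: "vec_measurable d N (\<lambda>\<omega>. x \<omega> (Suc k))"
    by (rule vec_measurable_cong) (rule step)
  define c where "c \<omega> = qn_scale d f M (x \<omega>) k" for \<omega>
  have c: "c \<in> borel_measurable N"
    unfolding c_def qn_scale_def
    by (intro borel_measurable_add borel_measurable_times borel_measurable_const local_norm_measurable X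
        vec_add_measurable(2)[OF XS X])
  define A where "A \<omega> = H (x \<omega> (Suc k))" for \<omega>
  have A: "mat_measurable d N A" unfolding A_def by (rule hess_comp_measurable[OF XS])
  define Gt where "Gt \<omega> = c \<omega> \<cdot>\<^sub>m G \<omega> k" for \<omega>
  have Gt: "mat_measurable d N Gt" unfolding Gt_def by (rule mat_smult_measurable[OF Gm c])
  have inv: "(\<lambda>\<omega>. 1 / (X \<omega> \<bullet> Y \<omega>)) \<in> borel_measurable N" if "vec_measurable d N X" "vec_measurable d N Y" for X Y
    by (intro borel_measurable_divide borel_measurable_const scalar_prod_measurable[OF that])
  have defl: "mat_measurable d N (\<lambda>\<omega>. deflate (B \<omega>) (v \<omega>))" if "mat_measurable d N B" "vec_measurable d N v" for B v
    unfolding deflate_def using that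
    by (intro mat_add_measurable mat_smult_measurable outer_prod_measurable mult_mat_vec_measurable inv)
  show ?case
  proof (cases rule)
    case SR1
    have eq: "G \<omega> (Suc k) = A \<omega> + deflate (Gt \<omega> - A \<omega>) (directions d \<omega> k)" if "\<omega> \<in> space N" for \<omega>
    proof -
      interpret T: qn_trajectory d f M \<mu> L \<kappa> x0 rule F0 "x \<omega>" "G \<omega>" "F \<omega>" "directions d \<omega>" by (rule T[OF that])
      have AG: "A \<omega> = T.A k" "Gt \<omega> = T.Gt k" by (simp_all add: A_def T.A_def Gt_def T.Gt_def c_def T.c_def)
      show ?thesis
        unfolding T.SR1_Suc[OF SR1] AG
        using T.A_dims[OF T.good[of k]] T.Gt_carrier[OF T.good[of k]] T.s_dims[OF T.good, of k]
        by (intro SR1_update_eq) (auto simp: transpose_minus)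
    qed
    have "mat_measurable d N (\<lambda>\<omega>. A \<omega> + deflate (Gt \<omega> - A \<omega>) (directions d \<omega> k))"
      by (rule mat_add_measurable(1)[OF A defl[OF mat_add_measurable(2)[OF Gt A] directions_measurable]])
    then have "mat_measurable d N (\<lambda>\<omega>. G \<omega> (Suc k))" by (rule mat_measurable_cong) (rule eq)
    then show ?thesis using XS SR1 by simp
  next
    case BFGS
    define Ft where "Ft \<omega> = (1 / sqrt (c \<omega>)) \<cdot>\<^sub>m F \<omega> k" for \<omega>
    have sq: "(\<lambda>\<omega>. sqrt (h \<omega>)) \<in> borel_measurable N" if "h \<in> borel_measurable N" for h
      using that by measurable
    have Ft: "mat_measurable d N Ft"
      unfolding Ft_def by (intro mat_smult_measurable[OF Fm[OF BFGS]] borel_measurable_divide borel_measurable_const sq c)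
    define u where "u \<omega> = transpose_mat (Ft \<omega>) *\<^sub>v directions d \<omega> k" for \<omega>
    have u: "vec_measurable d N u"
      unfolding u_def by (rule mult_mat_vec_measurable[OF transpose_measurable[OF Ft] directions_measurable])
    have Au: "vec_measurable d N (\<lambda>\<omega>. A \<omega> *\<^sub>v u \<omega>)" by (rule mult_mat_vec_measurable[OF A u])
    have eqG: "G \<omega> (Suc k) = deflate (Gt \<omega>) (u \<omega>) + (1 / (u \<omega> \<bullet> (A \<omega> *\<^sub>v u \<omega>))) \<cdot>\<^sub>m outer_prod (A \<omega> *\<^sub>v u \<omega>) (A \<omega> *\<^sub>v u \<omega>)"
      and eqF: "F \<omega> (Suc k) = Ft \<omega> - (1 / (u \<omega> \<bullet> (A \<omega> *\<^sub>v u \<omega>))) \<cdot>\<^sub>m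
        outer_prod (Ft \<omega> *\<^sub>v (A \<omega> *\<^sub>v u \<omega>) - (sqrt (u \<omega> \<bullet> (A \<omega> *\<^sub>v u \<omega>)) / vnorm (directions d \<omega> k)) \<cdot>\<^sub>v directions d \<omega> k) (u \<omega>)"
      if "\<omega> \<in> space N" for \<omega>
    proof -
      interpret T: qn_trajectory d f M \<mu> L \<kappa> x0 rule F0 "x \<omega>" "G \<omega>" "F \<omega>" "directions d \<omega>" by (rule T[OF that])
      have AG: "A \<omega> = T.A k" "Gt \<omega> = T.Gt k" "Ft \<omega> = T.Ft k"
        by (simp_all add: A_def T.A_def Gt_def T.Gt_def c_def T.c_def Ft_def T.Ft_def)
      show "G \<omega> (Suc k) = deflate (Gt \<omega>) (u \<omega>) + (1 / (u \<omega> \<bullet> (A \<omega> *\<^sub>v u \<omega>))) \<cdot>\<^sub>m outer_prod (A \<omega> *\<^sub>v u \<omega>) (A \<omega> *\<^sub>v u \<omega>)"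
        unfolding T.BFGS_Suc(1)[OF BFGS] u_def AG
        using T.A_dims[OF T.good[of k]] T.Gt_carrier[OF T.good[of k]] T.Ft_facts(1)[OF T.good[of k] BFGS]
        by (intro BFGS_update_eq) auto
      show "F \<omega> (Suc k) = Ft \<omega> - (1 / (u \<omega> \<bullet> (A \<omega> *\<^sub>v u \<omega>))) \<cdot>\<^sub>m
        outer_prod (Ft \<omega> *\<^sub>v (A \<omega> *\<^sub>v u \<omega>) - (sqrt (u \<omega> \<bullet> (A \<omega> *\<^sub>v u \<omega>)) / vnorm (directions d \<omega> k)) \<cdot>\<^sub>v directions d \<omega> k) (u \<omega>)"
        unfolding T.BFGS_Suc(2)[OF BFGS] u_def AG ..
    qed
    have "mat_measurable d N (\<lambda>\<omega>. deflate (Gt \<omega>) (u \<omega>) + (1 / (u \<omega> \<bullet> (A \<omega> *\<^sub>v u \<omega>))) \<cdot>\<^sub>m outer_prod (A \<omega> *\<^sub>v u \<omega>) (A \<omega> *\<^sub>v u \<omega>))"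
      by (intro mat_add_measurable(1) defl Gt u mat_smult_measurable outer_prod_measurable Au inv)
    then have GS: "mat_measurable d N (\<lambda>\<omega>. G \<omega> (Suc k))" by (rule mat_measurable_cong) (rule eqG)
    have vn: "(\<lambda>\<omega>. vnorm (directions d \<omega> k)) \<in> borel_measurable N"
      unfolding vnorm_def by (rule sq[OF scalar_prod_measurable[OF directions_measurable directions_measurable]])
    have "vec_measurable d N (\<lambda>\<omega>. Ft \<omega> *\<^sub>v (A \<omega> *\<^sub>v u \<omega>) - (sqrt (u \<omega> \<bullet> (A \<omega> *\<^sub>v u \<omega>)) / vnorm (directions d \<omega> k)) \<cdot>\<^sub>v directions d \<omega> k)"
      by (intro vec_add_measurable(2) mult_mat_vec_measurable[OF Ft Au] vec_smult_measurable directions_measurable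
          borel_measurable_divide sq scalar_prod_measurable[OF u Au] vn)
    then have "mat_measurable d N (\<lambda>\<omega>. Ft \<omega> - (1 / (u \<omega> \<bullet> (A \<omega> *\<^sub>v u \<omega>))) \<cdot>\<^sub>m
        outer_prod (Ft \<omega> *\<^sub>v (A \<omega> *\<^sub>v u \<omega>) - (sqrt (u \<omega> \<bullet> (A \<omega> *\<^sub>v u \<omega>)) / vnorm (directions d \<omega> k)) \<cdot>\<^sub>v directions d \<omega> k) (u \<omega>))"
      by (intro mat_add_measurable(2) Ft mat_smult_measurable outer_prod_measurable u inv Au)
    then have "mat_measurable d N (\<lambda>\<omega>. F \<omega> (Suc k))" by (rule mat_measurable_cong) (rule eqF)
    then show ?thesis using XS GS by simp
  qed
qed

lemma Rho_measurable: "(\<lambda>\<omega>. Rho \<omega> k) \<in> borel_measurable N"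
proof -
  have X: "vec_measurable d N (\<lambda>\<omega>. x \<omega> k)" and Gm: "mat_measurable d N (\<lambda>\<omega>. G \<omega> k)"
    using state_measurable[of k] by auto
  note Hm = hess_comp_measurable[OF X]
  have Hi: "mat_measurable d N (\<lambda>\<omega>. minv (H (x \<omega> k)))"
    by (rule minv_measurable[OF Hm hess_pd[OF vec_measurableD(1)[OF X]]])
  define th where "th \<omega> = (case rule of SR1 \<Rightarrow> tr (G \<omega> k - H (x \<omega> k)) / \<mu>
      | BFGS \<Rightarrow> tr (minv (H (x \<omega> k)) * G \<omega> k) - real d)" for \<omega>
  have t: "th \<in> borel_measurable N"
  proof (cases rule)
    case SR1
    have "(\<lambda>\<omega>. tr (G \<omega> k - H (x \<omega> k)) / \<mu>) \<in> borel_measurable N"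
      by (intro borel_measurable_divide borel_measurable_const tr_measurable[OF mat_add_measurable(2)[OF Gm Hm]])
    then show ?thesis unfolding th_def by (simp add: SR1)
  next
    case BFGS
    have "(\<lambda>\<omega>. tr (minv (H (x \<omega> k)) * G \<omega> k) - real d) \<in> borel_measurable N"
      by (intro borel_measurable_diff borel_measurable_const tr_measurable[OF mat_mult_measurable[OF Hi Gm]])
    then show ?thesis unfolding th_def by (simp add: BFGS)
  qed
  have "(\<lambda>\<omega>. th \<omega> + 2 * (real d * \<kappa>) * (M * nd (x \<omega> k))) \<in> borel_measurable N"
    by (intro borel_measurable_add borel_measurable_times borel_measurable_const t nd_comp_measurable[OF X])
  moreover have "th \<omega> + 2 * (real d * \<kappa>) * (M * nd (x \<omega> k)) = Rho \<omega> k" if "\<omega> \<in> space N" for \<omega>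
  proof -
    interpret qn_trajectory d f M \<mu> L \<kappa> x0 rule F0 "x \<omega>" "G \<omega>" "F \<omega>" "directions d \<omega>"
      by (rule trajectory) (use that in \<open>simp only: space_N\<close>)
    show ?thesis unfolding Rho_def rho_def theta_def lam_def th_def ..
  qed
  ultimately show ?thesis by (subst (asm) measurable_cong) auto
qed

subsection \<open>Expected decrease\<close>

text \<open>Setting the potential to zero off \<Omega> makes it measurable on the whole product
  space, and nonnegative extended values spare a separate integrability argument.\<close>

definition V :: "nat \<Rightarrow> (nat \<Rightarrow> nat \<Rightarrow> real) \<Rightarrow> ennreal" where
  "V k \<omega> = ennreal (Rho \<omega> k) * indicator \<Omega> \<omega>"

lemma V_measurable: "V k \<in> borel_measurable S"
proof -
  have "(\<lambda>\<omega>. ennreal (Rho \<omega> k)) \<in> borel_measurable N" using Rho_measurable by measurable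
  then show ?thesis
    unfolding V_def using borel_measurable_restrict_space_iff_ennreal[of \<Omega> S "\<lambda>\<omega>. ennreal (Rho \<omega> k)"]
      \<Omega>_sets by (auto simp: sets.Int_space_eq2)
qed

lemma Rho_nonneg: "\<omega> \<in> \<Omega> \<Longrightarrow> 0 \<le> Rho \<omega> k"
  unfolding Rho_def by (rule qn_trajectory.rho_nonneg[OF trajectory])

text \<open>The integral over coordinate k alone, with the others frozen, acts as the conditional
  expectation. The potential is bounded by a constant minus the form \<open>Q\<close> at s, and the
  mean of that form over the sphere is its trace divided by d.\<close>

lemma V_inner:
  assumes \<omega>: "\<omega> \<in> \<Omega>"
  shows "(\<integral>\<^sup>+ s. V (Suc k) (fun_upd \<omega> k s) \<partial>U) \<le> ennreal ((1 - 1 / real d) * exp (b k)) * V k \<omega>"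
proof -
  interpret U: prob_space U by (rule prob_space_U)
  interpret T: qn_trajectory d f M \<mu> L \<kappa> x0 rule F0 "x \<omega>" "G \<omega>" "F \<omega>" "directions d \<omega>"
    by (rule trajectory[OF \<omega>])
  define C where "C = T.thetat k + 2 * (real d * \<kappa>) * (M * nd (x \<omega> (Suc k)))"
  define B where "B s = C - vec d s \<bullet> (T.Q k *\<^sub>v vec d s)" for s
  have d1: "1 \<le> d" using d2 by simp
  note q = unif_sphere_quadratic[OF d1 T.Q_carrier[of k]]
  have Bi: "integrable U B" unfolding B_def using q(1) by simp
  have "integral\<^sup>L U B = C - tr (T.Q k) / real d"
    unfolding B_def using q by (simp add: U.prob_space)
  also have "\<dots> = (1 - 1 / real d) * T.thetat k + 2 * (real d * \<kappa>) * (M * T.lam (Suc k))"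
    unfolding C_def T.tr_Q T.lam_def by (simp add: algebra_simps)
  also have "\<dots> \<le> (1 - 1 / real d) * exp (b k) * Rho \<omega> k"
    unfolding Rho_def by (rule T.rho_step_b)
  finally have BI: "integral\<^sup>L U B \<le> (1 - 1 / real d) * exp (b k) * Rho \<omega> k" .
  \<comment> \<open>Nonnegativity of \<open>B\<close>, inherited from the potential below it, lets
    its nonnegative integral be evaluated as a Bochner integral.\<close>
  have bound: "AE s in U. V (Suc k) (fun_upd \<omega> k s) \<le> ennreal (B s) \<and> 0 \<le> B s"
    using unif_sphere_norm[OF d1] AE_space
  proof eventually_elim
    case (elim s)
    have "Rho (fun_upd \<omega> k s) (Suc k) \<le> B s" "0 \<le> Rho (fun_upd \<omega> k s) (Suc k)"
      using Rho_upd[OF \<omega> elim(2,1), of k] unfolding B_def C_def by linarith+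
    moreover have "V (Suc k) (fun_upd \<omega> k s) = ennreal (Rho (fun_upd \<omega> k s) (Suc k))"
      using upd_\<Omega>[OF \<omega> elim(2,1)] by (simp add: V_def)
    ultimately show ?case by (simp add: ennreal_leI)
  qed
  have "(\<integral>\<^sup>+ s. V (Suc k) (fun_upd \<omega> k s) \<partial>U) \<le> (\<integral>\<^sup>+ s. ennreal (B s) \<partial>U)"
    by (rule nn_integral_mono_AE) (use bound in auto)
  also have "\<dots> = ennreal (integral\<^sup>L U B)"
    by (rule nn_integral_eq_integral[OF Bi]) (use bound in auto)
  also have "\<dots> \<le> ennreal ((1 - 1 / real d) * exp (b k) * Rho \<omega> k)" by (rule ennreal_leI[OF BI])
  also have "\<dots> = ennreal ((1 - 1 / real d) * exp (b k)) * V k \<omega>"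
    using \<omega> Rho_nonneg[OF \<omega>] d1 by (simp add: V_def ennreal_mult)
  finally show ?thesis .
qed

text \<open>Independence enters here: replacing coordinate k by a fresh draw maps the product of the
  sphere measure and the direction measure to the direction measure. Integrating over the fresh draw
  first reduces the claim to the inner estimate, valid for almost every sample point.\<close>

lemma V_step: "(\<integral>\<^sup>+ \<omega>. V (Suc k) \<omega> \<partial>S) \<le> ennreal ((1 - 1 / real d) * exp (b k)) * (\<integral>\<^sup>+ \<omega>. V k \<omega> \<partial>S)"
proof -
  interpret U: prob_space U by (rule prob_space_U)
  interpret S: prob_space S by (rule prob_space_S)
  interpret P: pair_sigma_finite U S ..
  have dist: "distr (U \<Otimes>\<^sub>M S) S (\<lambda>(s, \<omega>). fun_upd \<omega> k s) = S"
    using distr_pair_PiM_eq_PiM[of UNIV "\<lambda>_. U" k] prob_space_U by (simp add: direction_space_def)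
  have upd: "(\<lambda>(s, \<omega>). fun_upd \<omega> k s) \<in> measurable (U \<Otimes>\<^sub>M S) S"
    unfolding split_beta' direction_space_def
    by (rule measurable_fun_upd[where J = UNIV]) (auto intro: measurable_fst measurable_snd)
  have "(\<integral>\<^sup>+ \<omega>. V (Suc k) \<omega> \<partial>S) = (\<integral>\<^sup>+ \<omega>. V (Suc k) \<omega> \<partial>distr (U \<Otimes>\<^sub>M S) S (\<lambda>(s, \<omega>). fun_upd \<omega> k s))"
    by (simp add: dist)
  also have "\<dots> = (\<integral>\<^sup>+ z. V (Suc k) (case z of (s, \<omega>) \<Rightarrow> fun_upd \<omega> k s) \<partial>(U \<Otimes>\<^sub>M S))"
    by (rule nn_integral_distr[OF upd]) (simp add: V_measurable)
  also have "\<dots> = (\<integral>\<^sup>+ \<omega>. \<integral>\<^sup>+ s. V (Suc k) (case (s, \<omega>) of (s, \<omega>) \<Rightarrow> fun_upd \<omega> k s) \<partial>U \<partial>S)"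
    by (rule P.nn_integral_snd[symmetric]) (rule measurable_compose[OF upd V_measurable])
  also have "\<dots> = (\<integral>\<^sup>+ \<omega>. \<integral>\<^sup>+ s. V (Suc k) (fun_upd \<omega> k s) \<partial>U \<partial>S)" by simp
  also have "\<dots> \<le> (\<integral>\<^sup>+ \<omega>. ennreal ((1 - 1 / real d) * exp (b k)) * V k \<omega> \<partial>S)"
    by (rule nn_integral_mono_AE) (use \<Omega>_AE V_inner in auto)
  also have "\<dots> = ennreal ((1 - 1 / real d) * exp (b k)) * (\<integral>\<^sup>+ \<omega>. V k \<omega> \<partial>S)"
    by (rule nn_integral_cmult[OF V_measurable])
  finally show ?thesis .
qed

lemma V_bound:
  "(\<integral>\<^sup>+ \<omega>. V (k1 + j) \<omega> \<partial>S) \<le> ennreal ((1 - 1 / real d) ^ j * exp (\<Sum>i<j. b (k1 + i)) * (2 * real d * \<kappa>\<^sup>2))"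
proof (induction j)
  case 0
  interpret S: prob_space S by (rule prob_space_S)
  have "V k1 \<omega> \<le> ennreal (2 * real d * \<kappa>\<^sup>2)" for \<omega>
    using qn_trajectory.rho_upper[OF trajectory, of \<omega> k1]
    by (cases "\<omega> \<in> \<Omega>") (auto simp: V_def Rho_def intro: ennreal_leI)
  then have "(\<integral>\<^sup>+ \<omega>. V k1 \<omega> \<partial>S) \<le> (\<integral>\<^sup>+ \<omega>. ennreal (2 * real d * \<kappa>\<^sup>2) \<partial>S)" by (intro nn_integral_mono) auto
  then show ?case by (simp add: S.emeasure_space_1)
next
  case (Suc j)
  let ?q = "1 - 1 / real d"
  have q: "0 \<le> ?q" using d2 by simp
  have "(\<integral>\<^sup>+ \<omega>. V (k1 + Suc j) \<omega> \<partial>S) \<le> ennreal (?q * exp (b (k1 + j))) * (\<integral>\<^sup>+ \<omega>. V (k1 + j) \<omega> \<partial>S)"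
    using V_step[of "k1 + j"] by simp
  also have "\<dots> \<le> ennreal (?q * exp (b (k1 + j))) * ennreal (?q ^ j * exp (\<Sum>i<j. b (k1 + i)) * (2 * real d * \<kappa>\<^sup>2))"
    by (rule mult_left_mono[OF Suc]) simp
  also have "\<dots> = ennreal (?q ^ Suc j * exp (\<Sum>i<Suc j. b (k1 + i)) * (2 * real d * \<kappa>\<^sup>2))"
    using q by (subst ennreal_mult[symmetric]) (auto simp: exp_add mult_ac)
  finally show ?case .
qed

text \<open>With \<open>p = 1 - 1/(d+1)\<close>, the ratio of the expected decay \<open>1 - 1/d\<close> to \<open>p\<close> is \<open>1 - 1/d\<^sup>2\<close>, so Markov's
  inequality and a union bound over all steps lose a factor \<open>d\<^sup>2\<close>.\<close>

lemma random_event: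
  assumes \<delta>: "0 < \<delta>" "\<delta> < 1" and k1: "2 * \<kappa> * ln (4 * (real d * \<kappa>)) \<le> real k1"
  shows "\<exists>E\<in>sets S. E \<subseteq> \<Omega> \<and> measure S E \<ge> 1 - \<delta> \<and>
    (\<forall>\<omega>\<in>E. \<forall>j. Rho \<omega> (k1 + j) \<le> (4 * real d ^ 3 * \<kappa>\<^sup>2 / \<delta>) * (1 - 1 / (real d + 1)) ^ j)"
proof -
  interpret S: prob_space S by (rule prob_space_S)
  \<comment> \<open>By Markov's inequality step j fails with probability at most (4 d \<kappa>^2 /
    t) r^j, where 4 d \<kappa>^2 is the a priori bound times the factor 2 from the exponentials. The
    series in r = 1 - 1/d^2 sums to d^2, so this \<open>t\<close> makes the total exactly
    \<delta>.\<close>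
  define p q t where "p = 1 - 1 / (real d + 1)" and "q = 1 - 1 / real d" and "t = 4 * real d ^ 3 * \<kappa>\<^sup>2 / \<delta>"
  define r where "r = q / p"
  have dp: "real d > 0" using d2 by simp
  have p: "0 < p" using dp by (simp add: p_def field_simps)
  have q: "0 \<le> q" using d2 by (simp add: q_def)
  have t: "0 < t" using dp \<kappa>_ge_1 \<delta> by (simp add: t_def)
  have r: "r = 1 - 1 / (real d)\<^sup>2"
    using dp by (simp add: r_def p_def q_def field_simps power2_eq_square)
  have r0: "0 \<le> r" unfolding r_def using p q by simp
  have r1: "r < 1" unfolding r using dp by simp
  define Bad where "Bad j = {\<omega> \<in> space S. 1 \<le> ennreal (1 / (t * p ^ j)) * V (k1 + j) \<omega>}" for j
  have Bad_sets: "Bad j \<in> sets S" for j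
    unfolding Bad_def using V_measurable[of "k1 + j"] by measurable
  have Bad_em: "emeasure S (Bad j) \<le> ennreal (\<delta> / (real d)\<^sup>2 * r ^ j)" for j
  proof -
    have "emeasure S (Bad j) \<le> ennreal (1 / (t * p ^ j)) * (\<integral>\<^sup>+ \<omega>. V (k1 + j) \<omega> * indicator (space S) \<omega> \<partial>S)"
      unfolding Bad_def by (rule nn_integral_Markov_inequality) (use V_measurable[of "k1 + j"] in measurable)
    also have "(\<integral>\<^sup>+ \<omega>. V (k1 + j) \<omega> * indicator (space S) \<omega> \<partial>S) = (\<integral>\<^sup>+ \<omega>. V (k1 + j) \<omega> \<partial>S)"
      by (rule nn_integral_cong) simp
    also have "ennreal (1 / (t * p ^ j)) * (\<integral>\<^sup>+ \<omega>. V (k1 + j) \<omega> \<partial>S)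
        \<le> ennreal (1 / (t * p ^ j)) * ennreal (q ^ j * exp (\<Sum>i<j. b (k1 + i)) * (2 * real d * \<kappa>\<^sup>2))"
      unfolding q_def by (rule mult_left_mono[OF V_bound]) simp
    also have "\<dots> = ennreal (1 / (t * p ^ j) * (q ^ j * exp (\<Sum>i<j. b (k1 + i)) * (2 * real d * \<kappa>\<^sup>2)))"
      using t p q by (intro ennreal_mult[symmetric]) auto
    also have "\<dots> \<le> ennreal (1 / (t * p ^ j) * (q ^ j * 2 * (2 * real d * \<kappa>\<^sup>2)))"
      using t p q sum_b_le[OF rate_power_le[OF k1], of j]
      by (intro ennreal_leI mult_left_mono mult_right_mono) auto
    also have "1 / (t * p ^ j) * (q ^ j * 2 * (2 * real d * \<kappa>\<^sup>2)) = \<delta> / (real d)\<^sup>2 * r ^ j"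
    proof -
      have "1 / (t * p ^ j) * (q ^ j * 2 * (2 * real d * \<kappa>\<^sup>2)) = (4 * real d * \<kappa>\<^sup>2 / t) * (q ^ j / p ^ j)"
        by (simp add: mult_ac)
      also have "q ^ j / p ^ j = r ^ j" by (simp add: r_def power_divide)
      also have "4 * real d * \<kappa>\<^sup>2 / t = \<delta> / (real d)\<^sup>2"
        using dp \<kappa>_ge_1 \<delta> by (simp add: t_def field_simps power2_eq_square power3_eq_cube)
      finally show ?thesis .
    qed
    finally show ?thesis .
  qed
  define W where "W = (\<Union>j. Bad j)"
  have W: "W \<in> sets S" unfolding W_def using Bad_sets by auto
  have "emeasure S W \<le> (\<Sum>j. emeasure S (Bad j))"
    unfolding W_def by (rule emeasure_subadditive_countably) (use Bad_sets in auto)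
  also have "\<dots> \<le> (\<Sum>j. ennreal (\<delta> / (real d)\<^sup>2 * r ^ j))" by (intro suminf_le Bad_em) auto
  also have "\<dots> = ennreal \<delta>"
  proof (rule suminf_ennreal_eq)
    show "0 \<le> \<delta> / (real d)\<^sup>2 * r ^ j" for j using \<delta> r0 r1 by simp
    have "(\<lambda>j. \<delta> / (real d)\<^sup>2 * r ^ j) sums (\<delta> / (real d)\<^sup>2 * (1 / (1 - r)))"
      using r0 r1 by (intro sums_mult geometric_sums) auto
    then show "(\<lambda>j. \<delta> / (real d)\<^sup>2 * r ^ j) sums \<delta>" using dp by (simp add: r)
  qed
  finally have Wd: "measure S W \<le> \<delta>" using \<delta> by (simp add: S.emeasure_eq_measure)
  define E where "E = \<Omega> - W"
  have ES: "E \<in> sets S" unfolding E_def using \<Omega>_sets W by auto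
  have O1: "measure S \<Omega> = 1" using S.prob_eq_1[OF \<Omega>_sets] \<Omega>_AE by simp
  have "measure S \<Omega> \<le> measure S (E \<union> W)"
  proof (rule S.finite_measure_mono)
    show "E \<union> W \<in> sets S" using ES W by (rule sets.Un)
  qed (auto simp: E_def)
  also have "\<dots> \<le> measure S E + measure S W"
    by (rule measure_subadditive[OF ES W]) (simp_all add: S.emeasure_eq_measure)
  finally have "1 - \<delta> \<le> measure S E" using O1 Wd by simp
  moreover have "Rho \<omega> (k1 + j) \<le> t * p ^ j" if "\<omega> \<in> E" for \<omega> j
  proof (rule ccontr)
    assume n: "\<not> Rho \<omega> (k1 + j) \<le> t * p ^ j"
    have \<omega>: "\<omega> \<in> \<Omega>" "\<omega> \<notin> Bad j" using that by (auto simp: E_def W_def)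
    have tp: "0 < t * p ^ j" using t p by simp
    have "1 \<le> 1 / (t * p ^ j) * Rho \<omega> (k1 + j)" using n tp by (simp add: field_simps)
    then have "ennreal 1 \<le> ennreal (1 / (t * p ^ j) * Rho \<omega> (k1 + j))" by (rule ennreal_leI)
    also have "\<dots> = ennreal (1 / (t * p ^ j)) * V (k1 + j) \<omega>"
      unfolding V_def using \<omega>(1) tp Rho_nonneg[OF \<omega>(1)] by (subst ennreal_mult) auto
    finally have "\<omega> \<in> Bad j" using \<omega>(1) by (simp add: Bad_def \<Omega>_def)
    then show False using \<omega>(2) by simp
  qed
  ultimately show ?thesis using ES unfolding t_def p_def by (intro bexI[of _ E]) (auto simp: E_def)
qed

text \<open>j1 is chosen so that (1 - 1/(d + 1))^j1 brings the prefactor 4 d^3 \<kappa>^2 / \<delta>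
  of the event below 1/2. On the event the deterministic product argument applies to each sample
  point.\<close>

lemma random_superlinear:
  assumes \<delta>: "0 < \<delta>" "\<delta> < 1" and k1: "2 * \<kappa> * ln (4 * (real d * \<kappa>)) \<le> real k1"
    and j1: "(real d + 1) * ln (8 * real d ^ 3 * \<kappa>\<^sup>2 / \<delta>) \<le> real j1"
  shows "\<exists>E\<in>sets S. measure S E \<ge> 1 - \<delta> \<and>
    (\<forall>\<omega>\<in>E. \<forall>k. nd (x \<omega> (k1 + j1 + k))
      \<le> (1 - 1 / (real d + 1)) ^ (k * (k - 1) div 2) * (1 / 2) ^ k * rate ^ (k1 + j1) * nd x0)"
proof -
  obtain E where E: "E \<in> sets S" "E \<subseteq> \<Omega>" "measure S E \<ge> 1 - \<delta>"
    and R: "\<And>\<omega> j. \<omega> \<in> E \<Longrightarrow> Rho \<omega> (k1 + j) \<le> (4 * real d ^ 3 * \<kappa>\<^sup>2 / \<delta>) * (1 - 1 / (real d + 1)) ^ j"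
    using random_event[OF \<delta> k1] by blast
  let ?p = "1 - 1 / (real d + 1)"
  have p: "0 \<le> ?p" by simp
  have "nd (x \<omega> (k1 + j1 + k)) \<le> ?p ^ (k * (k - 1) div 2) * (1 / 2) ^ k * rate ^ (k1 + j1) * nd x0"
    if "\<omega> \<in> E" for \<omega> k
  proof -
    interpret T: qn_trajectory d f M \<mu> L \<kappa> x0 rule F0 "x \<omega>" "G \<omega>" "F \<omega>" "directions d \<omega>"
      by (rule trajectory) (use that E in auto)
    have "T.rho (k1 + j1 + j) \<le> 1 / 2 * ?p ^ j" for j
    proof -
      have "T.rho (k1 + j1 + j) \<le> (4 * real d ^ 3 * \<kappa>\<^sup>2 / \<delta>) * ?p ^ (j1 + j)"
        using R[OF that, of "j1 + j"] by (simp add: Rho_def add.assoc)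
      also have "\<dots> = 1 / 2 * ?p ^ j * (?p ^ j1 * (8 * real d ^ 3 * \<kappa>\<^sup>2 / \<delta>))" by (simp add: power_add)
      also have "\<dots> \<le> 1 / 2 * ?p ^ j * 1"
      proof (rule mult_left_mono)
        show "?p ^ j1 * (8 * real d ^ 3 * \<kappa>\<^sup>2 / \<delta>) \<le> 1"
          by (rule power_le_inverse[OF _ _ j1]) (use d2 \<kappa>_ge_1 \<delta> in auto)
      qed (use p in simp)
      finally show ?thesis by simp
    qed
    from T.superlinear[OF p this] show ?thesis by (simp add: T.lam_def T.init)
  qed
  then show ?thesis using E by blast
qed

end

text \<open>The event may depend on the factor and the run, but k0 is fixed before them.\<close>

lemma (in qn_problem) random_k0:
  assumes \<delta>: "0 < \<delta>" "\<delta> < 1"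
  shows "\<exists>k0::nat. real k0 \<le> 11 * ((real d + \<kappa>) * ln (real d * \<kappa> / \<delta>)) \<and>
    (\<forall>F0 x G F. F0 \<in> carrier_mat d d \<and> transpose_mat F0 * F0 = minv (L \<cdot>\<^sub>m 1\<^sub>m d) \<and>
       (\<forall>\<omega>\<in>space (direction_space d).
          qn_run rule d f M x0 (L \<cdot>\<^sub>m 1\<^sub>m d) F0 (x \<omega>) (G \<omega>) (F \<omega>) (directions d \<omega>)) \<longrightarrow>
       (\<exists>E\<in>sets (direction_space d). measure (direction_space d) E \<ge> 1 - \<delta> \<and>
          (\<forall>\<omega>\<in>E. \<forall>k. nd (x \<omega> (k0 + k))
            \<le> (1 - 1 / (real d + 1)) ^ (k * (k - 1) div 2) * (1 / 2) ^ k * rate ^ k0 * nd x0)))"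
proof -
  define l where "l = ln (real d * \<kappa> / \<delta>)"
  note lb = log_bounds[OF \<delta>(1) less_imp_le[OF \<delta>(2)], folded l_def]
  define k1 where "k1 = nat \<lceil>2 * \<kappa> * ln (4 * (real d * \<kappa>))\<rceil>"
  define j1 where "j1 = nat \<lceil>(real d + 1) * ln (8 * real d ^ 3 * \<kappa>\<^sup>2 / \<delta>)\<rceil>"
  have k1: "2 * \<kappa> * ln (4 * (real d * \<kappa>)) \<le> real k1" "real k1 \<le> 2 * \<kappa> * ln (4 * (real d * \<kappa>)) + 1"
    using d_kappa_ge_2 \<kappa>_ge_1 by (auto simp: k1_def)
  have j1: "(real d + 1) * ln (8 * real d ^ 3 * \<kappa>\<^sup>2 / \<delta>) \<le> real j1"
    "real j1 \<le> (real d + 1) * ln (8 * real d ^ 3 * \<kappa>\<^sup>2 / \<delta>) + 1"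
  proof -
    have "1 \<le> real d ^ 3" using d2 by (intro one_le_power) simp
    then have "1 * 1 \<le> (8 * real d ^ 3) * \<kappa>\<^sup>2" using \<kappa>_ge_1 by (intro mult_mono) auto
    then have "1 \<le> 8 * real d ^ 3 * \<kappa>\<^sup>2 / \<delta>" using \<delta> by (simp add: pos_le_divide_eq)
    then have "0 \<le> (real d + 1) * ln (8 * real d ^ 3 * \<kappa>\<^sup>2 / \<delta>)" by simp
    then show "(real d + 1) * ln (8 * real d ^ 3 * \<kappa>\<^sup>2 / \<delta>) \<le> real j1"
      "real j1 \<le> (real d + 1) * ln (8 * real d ^ 3 * \<kappa>\<^sup>2 / \<delta>) + 1"
      unfolding j1_def by linarith+
  qed
  have "0 \<le> l"
  proof -
    have "real d * \<kappa> * 1 \<le> real d * \<kappa> / \<delta>" using d_kappa_ge_2 \<delta> by (simp add: pos_le_divide_eq mult_left_le)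
    then show ?thesis using d_kappa_ge_2 unfolding l_def by (intro ln_ge_zero) linarith
  qed
  then have "0 \<le> \<kappa> * l" using \<kappa>_ge_1 by simp
  then have "real (k1 + j1) \<le> 11 * ((real d + \<kappa>) * l)"
    using lb k1(2) j1(2) by (simp add: distrib_right)
  moreover have "\<exists>E\<in>sets (direction_space d). measure (direction_space d) E \<ge> 1 - \<delta> \<and>
          (\<forall>\<omega>\<in>E. \<forall>k. nd (x \<omega> (k1 + j1 + k))
            \<le> (1 - 1 / (real d + 1)) ^ (k * (k - 1) div 2) * (1 / 2) ^ k * rate ^ (k1 + j1) * nd x0)"
    if a: "F0 \<in> carrier_mat d d" "transpose_mat F0 * F0 = minv (L \<cdot>\<^sub>m 1\<^sub>m d)"
      "\<forall>\<omega>\<in>space (direction_space d).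
          qn_run rule d f M x0 (L \<cdot>\<^sub>m 1\<^sub>m d) F0 (x \<omega>) (G \<omega>) (F \<omega>) (directions d \<omega>)" for F0 x G F
  proof -
    interpret qn_random d f M \<mu> L \<kappa> x0 rule F0 x G F
      by unfold_locales (use a in auto)
    show ?thesis by (rule random_superlinear[OF \<delta> k1(1) j1(1)])
  qed
  ultimately show ?thesis unfolding l_def by blast
qed

theorem corollary20:
  shows "\<exists>C::real. C > 0 \<and>
    (\<forall>(d::nat) (f :: real vec \<Rightarrow> real) (M::real) (\<mu>::real) (L::real) (\<kappa>::real) (x0 :: real vec) (rule :: qn_rule).
      d \<ge> 2 \<and> M > 0 \<and> \<mu> > 0 \<and> L > 0 \<and> \<kappa> = L / \<mu> \<and>
      twice_differentiable d f \<and> strongly_self_concordant d M f \<and>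
      strongly_convex d \<mu> f \<and> smooth d L f \<and>
      x0 \<in> carrier_vec d \<and> M * newton_decrement d f x0 \<le> ln (3 / 2) / (4 * \<kappa>) \<longrightarrow>
      (\<exists>k0::nat. real k0 \<le> C * ((real d + \<kappa>) * ln (real d * \<kappa>)) \<and>
        (\<forall>F0 x G F s.
           F0 \<in> carrier_mat d d \<and> transpose_mat F0 * F0 = minv (L \<cdot>\<^sub>m 1\<^sub>m d) \<and>
           qn_run rule d f M x0 (L \<cdot>\<^sub>m 1\<^sub>m d) F0 x G F s \<and>
           greedy_directions rule d f M x G F s \<longrightarrow>
           (\<forall>k. newton_decrement d f (x (k0 + k))
                  \<le> (1 - 1 / real d) ^ (k * (k - 1) div 2) * (1 / 2) ^ k
                     * (1 - 1 / (2 * \<kappa>)) ^ k0 * newton_decrement d f x0))) \<and>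
      (\<forall>\<delta>::real. 0 < \<delta> \<and> \<delta> < 1 \<longrightarrow>
        (\<exists>k0::nat. real k0 \<le> C * ((real d + \<kappa>) * ln (real d * \<kappa> / \<delta>)) \<and>
          (\<forall>F0 x G F.
             F0 \<in> carrier_mat d d \<and> transpose_mat F0 * F0 = minv (L \<cdot>\<^sub>m 1\<^sub>m d) \<and>
             (\<forall>\<omega>\<in>space (direction_space d).
                qn_run rule d f M x0 (L \<cdot>\<^sub>m 1\<^sub>m d) F0 (x \<omega>) (G \<omega>) (F \<omega>) (directions d \<omega>)) \<longrightarrow>
             (\<exists>E\<in>sets (direction_space d).
                measure (direction_space d) E \<ge> 1 - \<delta> \<and>
                (\<forall>\<omega>\<in>E. \<forall>k. newton_decrement d f (x \<omega> (k0 + k))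
                  \<le> (1 - 1 / (real d + 1)) ^ (k * (k - 1) div 2) * (1 / 2) ^ k
                     * (1 - 1 / (2 * \<kappa>)) ^ k0 * newton_decrement d f x0))))))"
\<comment> \<open>The random count determines the constant: 9 d l from j1 and at most 2 d l for the
  two roundings give the coefficient of d, while the coefficient of \<kappa> is only 6.\<close>
proof (intro exI[of _ "11 :: real"] conjI allI impI; (elim conjE)?)
  show "(0 :: real) < 11" by simp
next
  fix d :: nat and f :: "real vec \<Rightarrow> real" and M \<mu> L \<kappa> :: real and x0 :: "real vec" and rule :: qn_rule
  assume a: "2 \<le> d" "0 < M" "0 < \<mu>" "0 < L" "\<kappa> = L / \<mu>" "twice_differentiable d f"
    "strongly_self_concordant d M f" "strongly_convex d \<mu> f" "smooth d L f" "x0 \<in> carrier_vec d"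
    "M * newton_decrement d f x0 \<le> ln (3 / 2) / (4 * \<kappa>)"
  then interpret qn_problem d f M \<mu> L \<kappa> x0 rule by unfold_locales
  show "\<exists>k0::nat. real k0 \<le> 11 * ((real d + \<kappa>) * ln (real d * \<kappa>)) \<and>
        (\<forall>F0 x G F s.
           F0 \<in> carrier_mat d d \<and> transpose_mat F0 * F0 = minv (L \<cdot>\<^sub>m 1\<^sub>m d) \<and>
           qn_run rule d f M x0 (L \<cdot>\<^sub>m 1\<^sub>m d) F0 x G F s \<and>
           greedy_directions rule d f M x G F s \<longrightarrow>
           (\<forall>k. newton_decrement d f (x (k0 + k))
                  \<le> (1 - 1 / real d) ^ (k * (k - 1) div 2) * (1 / 2) ^ k
                     * (1 - 1 / (2 * \<kappa>)) ^ k0 * newton_decrement d f x0))"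
    using greedy_k0 unfolding rate_def .
  fix \<delta> :: real assume "0 < \<delta>" "\<delta> < 1"
  then show "\<exists>k0::nat. real k0 \<le> 11 * ((real d + \<kappa>) * ln (real d * \<kappa> / \<delta>)) \<and>
          (\<forall>F0 x G F.
             F0 \<in> carrier_mat d d \<and> transpose_mat F0 * F0 = minv (L \<cdot>\<^sub>m 1\<^sub>m d) \<and>
             (\<forall>\<omega>\<in>space (direction_space d).
                qn_run rule d f M x0 (L \<cdot>\<^sub>m 1\<^sub>m d) F0 (x \<omega>) (G \<omega>) (F \<omega>) (directions d \<omega>)) \<longrightarrow>
             (\<exists>E\<in>sets (direction_space d).
                measure (direction_space d) E \<ge> 1 - \<delta> \<and>
                (\<forall>\<omega>\<in>E. \<forall>k. newton_decrement d f (x \<omega> (k0 + k))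
                  \<le> (1 - 1 / (real d + 1)) ^ (k * (k - 1) div 2) * (1 / 2) ^ k
                     * (1 - 1 / (2 * \<kappa>)) ^ k0 * newton_decrement d f x0)))"
    using random_k0 unfolding rate_def by blast
qed

end
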